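(* Let $\mathfrak{r}\in\mathbb{H}^2_d$ be an NC rational function with minimal realization $(A,b,c)$ of size $N$. If $\mathfrak{r}=\Theta\cdot f$ is the NC inner-outer factorization of $\mathfrak{r}$, then both $\Theta$ and $f$ are NC rational functions and the inner factor $\Theta$ is NC Blaschke. The NC outer factor $f$ has a realization $(A,\widetilde b,c)$ for some $\widetilde b\in\mathbb{C}^N$, and the minimal realization of $\Theta$ is of size at most $2N+1$.
   Context: Fock space. Fix an integer $d\ge1$. $\mathbb{F}^d$ is the free monoid of words in the letters $1,\dots,d$; for $\alpha=i_1\cdots i_n$ put $|\alpha|=n$, $\mathfrak{z}^\alpha=\mathfrak{z}_{i_1}\cdots\mathfrak{z}_{i_n}$, $X^\alpha=X_{i_1}\cdots X_{i_n}$. $\mathbb{H}^2_d$ is the Hilbert space of formal power series $f=\sum_\alpha\hat f_\alpha\mathfrak{z}^\alpha$ in noncommuting variables with $\sum_\alpha|\hat f_\alpha|^2<\infty$. $L_k,R_k$ are left, right multiplication by $\mathfrak{z}_k$. $\mathbb{B}^d_n$ is the set of $d$-tuples $X$ of $n\times n$ complex matrices with $\|X\|:=\|\sum_jX_jX_j^*\|^{1/2}<1$; $\mathbb{B}^d_\infty$ is the set of such strict row contractions on a fixed separable infinite-dimensional Hilbert space (denoted $\mathbb{C}^\infty$); $\mathbb{B}^d_{\mathbb{N}}=\bigsqcup_{n\in\mathbb{N}}\mathbb{B}^d_n$. For $Z$ in any of these, $f(Z)=\sum_{k\ge0}\sum_{|\alpha|=k}\hat f_\alpha Z^\alpha$.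 $\mathbb{H}^\infty_d$ is the WOT-closed unital algebra generated by $L_1,\dots,L_d$, identified via $F(L)\mapsto F=F(L)1$ with the left multipliers of $\mathbb{H}^2_d$. Inner-outer. $\Theta\in\mathbb{H}^\infty_d$ is inner if $\Theta(L)$ is an isometry; $f\in\mathbb{H}^2_d$ is outer if the closed span of $\{R^\alpha f\}_\alpha$ is $\mathbb{H}^2_d$. Every nonzero $h\in\mathbb{H}^2_d$ factors as $h=\Theta(L)f$ with $\Theta$ inner and $f$ outer, uniquely up to a unimodular constant; this is its NC inner-outer factorization. For $f\in\mathbb{H}^2_d$, $\mathrm{Sing}_n(f)=\{(Z,y)\in\mathbb{B}^d_n\times(\mathbb{C}^n\setminus\{0\}):y^*f(Z)=0\}$ and $\mathrm{Sing}(f)=\bigsqcup_{n\in\mathbb{N}\cup\{\infty\}}\mathrm{Sing}_n(f)$. An inner $\Theta$ is NC Blaschke if $\mathrm{Ran}(\Theta(L))=\{h\in\mathbb{H}^2_d: y^*h(Z)=0\ \forall(Z,y)\in\mathrm{Sing}(\Theta)\}$. NC rational functions. An NC rational expression is a syntactically valid combination of $\mathfrak{z}_1,\dots,\mathfrak{z}_d$, complex scalars, $+,\cdot,{}^{-1}$ and parentheses; its domain is the set of $d$-tuples of matrices (of any common finite size) where it can be evaluated. An NC rational function is an equivalence class of expressions with nonempty domain, where two expressions are equivalent if their domains intersect and they agree on the intersection; $\mathrm{Dom}(\mathfrak{r})$ is the union of the domains of representatives. If $0\in\mathrm{Dom}(\mathfrak{r})$, a realization of size $n$ is a triple $(A,b,c)\in(\mathbb{C}^{n\times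 n})^d\times\mathbb{C}^n\times\mathbb{C}^n$ with $\mathfrak{r}(X)=(b^*\otimes I_m)L_A(X)^{-1}(c\otimes I_m)$ for all $X\in(\mathbb{C}^{m\times m})^d$ (all $m$) with $L_A(X):=I_n\otimes I_m-\sum_jA_j\otimes X_j$ invertible; it is minimal if $n$ is as small as possible. $\mathfrak{r}$ belongs to (or equals an element of) $\mathbb{H}^2_d$ or $\mathbb{H}^\infty_d$ if its power series at $0$, $\sum_\omega(b^*A^\omega c)\mathfrak{z}^\omega$, does. *)

theory Defs
  imports
    "HOL-Analysis.Infinite_Sum"
    "HOL-Analysis.Bounded_Linear_Function"
    "HOL-Analysis.L2_Norm"
    "HOL.Hull"
    "Jordan_Normal_Form.Gauss_Jordan_Elimination"
    "Jordan_Normal_Form.Schur_Decomposition"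
begin

section \<open>Complex square-summable families\<close>

typedef 'a ell2 = "{x :: 'a \<Rightarrow> complex. (\<lambda>i. (cmod (x i))\<^sup>2) summable_on UNIV}"
  morphisms ell2_nth Abs_ell2
  by (rule exI[of _ "\<lambda>_. 0"]) simp

setup_lifting type_definition_ell2

lemma ell2_eqI: "(\<And>i. ell2_nth x i = ell2_nth y i) \<Longrightarrow> x = y"
  by (metis ell2_nth_inject ext)

lemma ell2_eq_iff: "x = y \<longleftrightarrow> (\<forall>i. ell2_nth x i = ell2_nth y i)"
  by (auto intro: ell2_eqI)

lemma ell2_nth_summable: "(\<lambda>i. (cmod (ell2_nth x i))\<^sup>2) summable_on UNIV"
  using ell2_nth[of x] by simp

lemma sq_summable_add:
  fixes x y :: "'a \<Rightarrow> complex"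
  assumes "(\<lambda>i. (cmod (x i))\<^sup>2) summable_on UNIV" "(\<lambda>i. (cmod (y i))\<^sup>2) summable_on UNIV"
  shows "(\<lambda>i. (cmod (x i + y i))\<^sup>2) summable_on UNIV"
proof (rule summable_on_comparison_test)
  show "(\<lambda>i. 2 * (cmod (x i))\<^sup>2 + 2 * (cmod (y i))\<^sup>2) summable_on UNIV"
    using assms by (intro summable_on_add summable_on_cmult_right)
  fix i
  have "(cmod (x i + y i))\<^sup>2 \<le> (cmod (x i) + cmod (y i))\<^sup>2"
    by (simp add: norm_triangle_ineq power_mono)
  also have "\<dots> \<le> 2 * (cmod (x i))\<^sup>2 + 2 * (cmod (y i))\<^sup>2"
    using zero_le_power2[of "cmod (x i) - cmod (y i)"]
    by (simp add: power2_eq_square algebra_simps)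
  finally show "(cmod (x i + y i))\<^sup>2 \<le> 2 * (cmod (x i))\<^sup>2 + 2 * (cmod (y i))\<^sup>2" .
qed simp

lemma sq_summable_mult:
  fixes x y :: "'a \<Rightarrow> complex"
  assumes "(\<lambda>i. (cmod (x i))\<^sup>2) summable_on UNIV" "(\<lambda>i. (cmod (y i))\<^sup>2) summable_on UNIV"
  shows "(\<lambda>i. x i * cnj (y i)) summable_on UNIV"
proof (rule abs_summable_summable, rule summable_on_comparison_test)
  show "(\<lambda>i. (cmod (x i))\<^sup>2 + (cmod (y i))\<^sup>2) summable_on UNIV"
    using assms by (rule summable_on_add)
  fix i
  have "2 * (cmod (x i) * cmod (y i)) \<le> (cmod (x i))\<^sup>2 + (cmod (y i))\<^sup>2"
    using zero_le_power2[of "cmod (x i) - cmod (y i)"]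
    by (simp add: power2_eq_square algebra_simps)
  moreover have "0 \<le> cmod (x i) * cmod (y i)"
    by simp
  ultimately show "norm (x i * cnj (y i)) \<le> (cmod (x i))\<^sup>2 + (cmod (y i))\<^sup>2"
    unfolding norm_mult complex_mod_cnj by linarith
qed simp

lemma sq_summable_scale:
  fixes x :: "'a \<Rightarrow> complex"
  assumes "(\<lambda>i. (cmod (x i))\<^sup>2) summable_on UNIV"
  shows "(\<lambda>i. (cmod (c * x i))\<^sup>2) summable_on UNIV"
  using summable_on_cmult_right[OF assms, of "(cmod c)\<^sup>2"]
  by (simp add: norm_mult power_mult_distrib)

lift_definition scaleC :: "complex \<Rightarrow> 'a ell2 \<Rightarrow> 'a ell2" (infixr \<open>*\<^sub>C\<close> 75)
  is "\<lambda>c x i. c * x i"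
  by (rule sq_summable_scale)

definition cinner :: "'a ell2 \<Rightarrow> 'a ell2 \<Rightarrow> complex" where
  "cinner x y = (\<Sum>\<^sub>\<infinity>i. ell2_nth x i * cnj (ell2_nth y i))"

instantiation ell2 :: (type) real_vector
begin

lift_definition zero_ell2 :: "'a ell2" is "\<lambda>_. 0"
  by simp

lift_definition plus_ell2 :: "'a ell2 \<Rightarrow> 'a ell2 \<Rightarrow> 'a ell2" is "\<lambda>x y i. x i + y i"
  by (rule sq_summable_add)

lift_definition uminus_ell2 :: "'a ell2 \<Rightarrow> 'a ell2" is "\<lambda>x i. - x i"
  by simp

definition minus_ell2 :: "'a ell2 \<Rightarrow> 'a ell2 \<Rightarrow> 'a ell2" where
  "minus_ell2 x y = x + (- y)"

definition scaleR_ell2 :: "real \<Rightarrow> 'a ell2 \<Rightarrow> 'a ell2" where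
  "scaleR_ell2 r x = complex_of_real r *\<^sub>C x"

instance
proof
  fix x y z :: "'a ell2" and r s :: real
  show "x + y + z = x + (y + z)" by transfer (simp add: add.assoc)
  show "x + y = y + x" by transfer (simp add: add.commute)
  show "0 + x = x" by transfer simp
  show "- x + x = 0" by transfer simp
  show "x - y = x + - y" by (simp add: minus_ell2_def)
  show "r *\<^sub>R (x + y) = r *\<^sub>R x + r *\<^sub>R y"
    unfolding scaleR_ell2_def by transfer (simp add: algebra_simps)
  show "(r + s) *\<^sub>R x = r *\<^sub>R x + s *\<^sub>R x"
    unfolding scaleR_ell2_def by transfer (simp add: algebra_simps)
  show "r *\<^sub>R s *\<^sub>R x = (r * s) *\<^sub>R x"
    unfolding scaleR_ell2_def by transfer (simp add: algebra_simps)
  show "1 *\<^sub>R x = x" unfolding scaleR_ell2_def by transfer simp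
qed

end

text \<open>The real inner product is the real part of \<^const>\<open>cinner\<close>; it induces the usual norm, and for
  complex-linear operators the adjoints with respect to both products coincide.\<close>

instantiation ell2 :: (type) real_inner
begin

definition inner_ell2 :: "'a ell2 \<Rightarrow> 'a ell2 \<Rightarrow> real" where
  "inner_ell2 x y = Re (cinner x y)"

definition norm_ell2 :: "'a ell2 \<Rightarrow> real" where
  "norm_ell2 x = sqrt (\<Sum>\<^sub>\<infinity>i. (cmod (ell2_nth x i))\<^sup>2)"

definition sgn_ell2 :: "'a ell2 \<Rightarrow> 'a ell2" where
  "sgn_ell2 x = x /\<^sub>R norm x"

definition dist_ell2 :: "'a ell2 \<Rightarrow> 'a ell2 \<Rightarrow> real" where
  "dist_ell2 x y = norm (x - y)"

definition uniformity_ell2 :: "('a ell2 \<times> 'a ell2) filter" where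
  "uniformity_ell2 = (INF e\<in>{0<..}. principal {(x :: 'a ell2, y). dist x y < e})"

definition open_ell2 :: "'a ell2 set \<Rightarrow> bool" where
  "open_ell2 U \<longleftrightarrow> (\<forall>x\<in>U. \<forall>\<^sub>F (x', y) in uniformity. x' = x \<longrightarrow> y \<in> U)"

lemma cinner_summable: "(\<lambda>i. ell2_nth x i * cnj (ell2_nth y i)) summable_on UNIV"
  by (intro sq_summable_mult ell2_nth_summable)

lemma inner_ell2_self: "inner x x = (\<Sum>\<^sub>\<infinity>i. (cmod (ell2_nth x i))\<^sup>2)" for x :: "'a ell2"
proof -
  have "cinner x x = (\<Sum>\<^sub>\<infinity>i. complex_of_real ((cmod (ell2_nth x i))\<^sup>2))"
    unfolding cinner_def by (intro infsum_cong) (simp add: complex_norm_square del: of_real_power)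
  also have "\<dots> = complex_of_real (\<Sum>\<^sub>\<infinity>i. (cmod (ell2_nth x i))\<^sup>2)"
    using has_sum_of_real[OF has_sum_infsum[OF ell2_nth_summable[of x]]]
    by (rule infsumI)
  finally show ?thesis
    by (simp add: inner_ell2_def)
qed

instance
proof
  fix x y z :: "'a ell2" and r s :: real
  show "sgn x = x /\<^sub>R norm x" by (rule sgn_ell2_def)
  show "dist x y = norm (x - y)" by (rule dist_ell2_def)
  show "uniformity = (INF e\<in>{0<..}. principal {(x, y :: 'a ell2). dist x y < e})"
    by (rule uniformity_ell2_def)
  show "open U \<longleftrightarrow> (\<forall>x\<in>U. \<forall>\<^sub>F (x', y) in uniformity. x' = x \<longrightarrow> y \<in> U)" for U :: "'a ell2 set"
    by (rule open_ell2_def)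
  have "cinner y x = cnj (cinner x y)"
    unfolding cinner_def infsum_cnj[symmetric] by (intro infsum_cong) simp
  then show "inner x y = inner y x" by (simp add: inner_ell2_def)
  have "cinner (x + y) z = cinner x z + cinner y z"
    unfolding cinner_def plus_ell2.rep_eq distrib_right
    by (intro infsum_add cinner_summable)
  then show "inner (x + y) z = inner x z + inner y z" by (simp add: inner_ell2_def)
  have "cinner (r *\<^sub>R x) y = complex_of_real r * cinner x y"
    unfolding cinner_def scaleR_ell2_def scaleC.rep_eq mult.assoc
    by (rule infsum_cmult_right') 
  then show "inner (r *\<^sub>R x) y = r * inner x y" by (simp add: inner_ell2_def)
  show "0 \<le> inner x x" unfolding inner_ell2_self by (rule infsum_nonneg) simp
  show "inner x x = 0 \<longleftrightarrow> x = 0"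
  proof
    assume "inner x x = 0"
    then have "(cmod (ell2_nth x i))\<^sup>2 = 0" for i
      unfolding inner_ell2_self
      by (rule nonneg_infsum_le_0D[OF order_eq_refl _ _ UNIV_I]) (simp_all add: ell2_nth_summable)
    then show "x = 0" by (intro ell2_eqI) (simp add: zero_ell2.rep_eq)
  next
    assume "x = 0"
    then show "inner x x = 0" unfolding inner_ell2_self by (simp add: zero_ell2.rep_eq)
  qed
  show "norm x = sqrt (inner x x)" by (simp add: norm_ell2_def inner_ell2_self)
qed

end

global_interpretation ell2: vector_space "scaleC :: complex \<Rightarrow> 'a ell2 \<Rightarrow> 'a ell2"
  defines cspan = ell2.span
  by unfold_locales (transfer; simp add: algebra_simps)+

lift_definition ell2_unit :: "'a \<Rightarrow> 'a ell2" is "\<lambda>i j. if j = i then 1 else 0"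
proof -
  fix i :: 'a
  have "(\<lambda>j. (cmod (if j = i then 1 else 0))\<^sup>2) summable_on {i}" by simp
  then show "(\<lambda>j. (cmod (if j = i then 1 else 0))\<^sup>2) summable_on UNIV"
    by (rule summable_on_cong_neutral[THEN iffD1, rotated -1]) auto
qed

lemma cinner_unit: "cinner x (ell2_unit i) = ell2_nth x i"
proof -
  have "cinner x (ell2_unit i) = (\<Sum>\<^sub>\<infinity>j\<in>{i}. ell2_nth x j)"
    unfolding cinner_def ell2_unit.rep_eq by (rule infsum_cong_neutral) auto
  then show ?thesis by simp
qed


section \<open>Bounded operators\<close>

lemma norm_scaleC: "norm (c *\<^sub>C x) = cmod c * norm x"
  unfolding norm_ell2_def scaleC.rep_eq norm_mult power_mult_distrib
  by (subst infsum_cmult_right') (simp add: real_sqrt_mult)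

lift_definition scalar_op :: "complex \<Rightarrow> 'a ell2 \<Rightarrow>\<^sub>L 'a ell2" is "\<lambda>c x. c *\<^sub>C x"
proof (rule bounded_linear_intro)
  fix c :: complex and x y :: "'a ell2" and r :: real
  show "c *\<^sub>C (x + y) = c *\<^sub>C x + c *\<^sub>C y" by (rule ell2.scale_right_distrib)
  show "c *\<^sub>C r *\<^sub>R x = r *\<^sub>R c *\<^sub>C x"
    unfolding scaleR_ell2_def by transfer (simp add: algebra_simps)
  show "norm (c *\<^sub>C x) \<le> norm x * cmod c" by (simp add: norm_scaleC)
qed

lemma blinfun_eq_iff: "S = T \<longleftrightarrow> (\<forall>x. blinfun_apply S x = blinfun_apply T x)"
  by (auto intro: blinfun_eqI)

text \<open>\<open>B(H)\<close>: the type \<open>_ \<Rightarrow>\<^sub>L _\<close> contains all real-linear bounded maps.\<close>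

definition bounded_ops :: "('a ell2 \<Rightarrow>\<^sub>L 'a ell2) set" where
  "bounded_ops = {T. \<forall>c. T o\<^sub>L scalar_op c = scalar_op c o\<^sub>L T}"

definition unital_subalgebra :: "('a ell2 \<Rightarrow>\<^sub>L 'a ell2) set \<Rightarrow> bool" where
  "unital_subalgebra \<A> \<longleftrightarrow>
    \<A> \<subseteq> bounded_ops \<and> range scalar_op \<subseteq> \<A> \<and> (\<forall>S\<in>\<A>. \<forall>T\<in>\<A>. S + T \<in> \<A> \<and> S o\<^sub>L T \<in> \<A>)"

definition weak_operator_topology :: "('a ell2 \<Rightarrow>\<^sub>L 'a ell2) topology" where
  "weak_operator_topology = pullback_topology UNIV (\<lambda>T (x, y). cinner (blinfun_apply T x) y) euclidean"

definition op_word :: "('d \<Rightarrow> 'a ell2 \<Rightarrow>\<^sub>L 'a ell2) \<Rightarrow> 'd list \<Rightarrow> 'a ell2 \<Rightarrow>\<^sub>L 'a ell2" where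
  "op_word Z \<alpha> = foldr (\<lambda>i T. Z i o\<^sub>L T) \<alpha> id_blinfun"


section \<open>The Fock space\<close>

text \<open>The Fock space over \<open>d = CARD('d)\<close> letters is \<open>'d list ell2\<close>: a series is its family of
  coefficients, indexed by words.\<close>

lemma sq_summable_inj:
  fixes x :: "'a \<Rightarrow> complex" and g :: "'a \<Rightarrow> 'b"
  assumes "inj g" and y: "\<And>i. y (g i) = x i" "\<And>j. j \<notin> range g \<Longrightarrow> y j = 0"
    and "((\<lambda>i. (cmod (x i))\<^sup>2) has_sum s) UNIV"
  shows "((\<lambda>j. (cmod (y j))\<^sup>2) has_sum s) UNIV"
proof -
  have "((\<lambda>j. (cmod (y j))\<^sup>2) has_sum s) (range g)"
    using assms by (subst has_sum_reindex) (auto simp: o_def)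
  then show ?thesis
    by (rule has_sum_cong_neutral[THEN iffD1, rotated -1]) (auto simp: y(2))
qed

lift_definition left_shift_fun :: "'d \<Rightarrow> 'd list ell2 \<Rightarrow> 'd list ell2"
  is "\<lambda>k f \<omega>. if \<omega> \<noteq> [] \<and> hd \<omega> = k then f (tl \<omega>) else 0"
proof -
  fix k :: 'd and f :: "'d list \<Rightarrow> complex"
  assume "(\<lambda>i. (cmod (f i))\<^sup>2) summable_on UNIV"
  then obtain s where "((\<lambda>i. (cmod (f i))\<^sup>2) has_sum s) UNIV" by (auto simp: summable_on_def)
  then have "((\<lambda>\<omega>. (cmod (if \<omega> \<noteq> [] \<and> hd \<omega> = k then f (tl \<omega>) else 0))\<^sup>2) has_sum s) UNIV"
    by (rule sq_summable_inj[where g = "\<lambda>\<alpha>. k # \<alpha>", rotated -1])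
      (auto simp: image_iff inj_on_def intro: list.collapse[symmetric])
  then show "(\<lambda>\<omega>. (cmod (if \<omega> \<noteq> [] \<and> hd \<omega> = k then f (tl \<omega>) else 0))\<^sup>2) summable_on UNIV"
    by (auto simp: summable_on_def)
qed

lift_definition right_shift_fun :: "'d \<Rightarrow> 'd list ell2 \<Rightarrow> 'd list ell2"
  is "\<lambda>k f \<omega>. if \<omega> \<noteq> [] \<and> last \<omega> = k then f (butlast \<omega>) else 0"
proof -
  fix k :: 'd and f :: "'d list \<Rightarrow> complex"
  assume "(\<lambda>i. (cmod (f i))\<^sup>2) summable_on UNIV"
  then obtain s where "((\<lambda>i. (cmod (f i))\<^sup>2) has_sum s) UNIV" by (auto simp: summable_on_def)
  then have "((\<lambda>\<omega>. (cmod (if \<omega> \<noteq> [] \<and> last \<omega> = k then f (butlast \<omega>) else 0))\<^sup>2) has_sum s) UNIV"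
    by (rule sq_summable_inj[where g = "\<lambda>\<alpha>. \<alpha> @ [k]", rotated -1])
      (auto simp: image_iff inj_on_def intro: append_butlast_last_id[symmetric])
  then show "(\<lambda>\<omega>. (cmod (if \<omega> \<noteq> [] \<and> last \<omega> = k then f (butlast \<omega>) else 0))\<^sup>2) summable_on UNIV"
    by (auto simp: summable_on_def)
qed

lemma norm_left_shift_fun: "norm (left_shift_fun k f) = norm f"
proof -
  have "((\<lambda>\<omega>. (cmod (ell2_nth (left_shift_fun k f) \<omega>))\<^sup>2) has_sum
      (\<Sum>\<^sub>\<infinity>i. (cmod (ell2_nth f i))\<^sup>2)) UNIV"
    by (rule sq_summable_inj[OF _ _ _ has_sum_infsum[OF ell2_nth_summable], where g = "\<lambda>\<alpha>. k # \<alpha>"])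
      (auto simp: left_shift_fun.rep_eq image_iff inj_on_def intro: list.collapse[symmetric])
  then show ?thesis
    unfolding norm_ell2_def by (simp add: infsumI)
qed

lemma norm_right_shift_fun: "norm (right_shift_fun k f) = norm f"
proof -
  have "((\<lambda>\<omega>. (cmod (ell2_nth (right_shift_fun k f) \<omega>))\<^sup>2) has_sum
      (\<Sum>\<^sub>\<infinity>i. (cmod (ell2_nth f i))\<^sup>2)) UNIV"
    by (rule sq_summable_inj[OF _ _ _ has_sum_infsum[OF ell2_nth_summable], where g = "\<lambda>\<alpha>. \<alpha> @ [k]"])
      (auto simp: right_shift_fun.rep_eq image_iff inj_on_def intro: append_butlast_last_id[symmetric])
  then show ?thesis
    unfolding norm_ell2_def by (simp add: infsumI)
qed

lift_definition left_shift :: "'d \<Rightarrow> 'd list ell2 \<Rightarrow>\<^sub>L 'd list ell2" is left_shift_fun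
proof (rule bounded_linear_intro)
  fix k :: 'd and f g :: "'d list ell2" and r :: real
  show "left_shift_fun k (f + g) = left_shift_fun k f + left_shift_fun k g"
    by (rule ell2_eqI) (simp add: left_shift_fun.rep_eq plus_ell2.rep_eq)
  show "left_shift_fun k (r *\<^sub>R f) = r *\<^sub>R left_shift_fun k f"
    by (rule ell2_eqI) (simp add: left_shift_fun.rep_eq scaleR_ell2_def scaleC.rep_eq)
  show "norm (left_shift_fun k f) \<le> norm f * 1"
    by (simp add: norm_left_shift_fun)
qed

lift_definition right_shift :: "'d \<Rightarrow> 'd list ell2 \<Rightarrow>\<^sub>L 'd list ell2" is right_shift_fun
proof (rule bounded_linear_intro)
  fix k :: 'd and f g :: "'d list ell2" and r :: real
  show "right_shift_fun k (f + g) = right_shift_fun k f + right_shift_fun k g"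
    by (rule ell2_eqI) (simp add: right_shift_fun.rep_eq plus_ell2.rep_eq)
  show "right_shift_fun k (r *\<^sub>R f) = r *\<^sub>R right_shift_fun k f"
    by (rule ell2_eqI) (simp add: right_shift_fun.rep_eq scaleR_ell2_def scaleC.rep_eq)
  show "norm (right_shift_fun k f) \<le> norm f * 1"
    by (simp add: norm_right_shift_fun)
qed

text \<open>The algebra \<open>\<bbbH>\<^sup>\<infinity>\<^sub>d\<close>, first as operators \<open>F(L)\<close>, then as series \<open>F = F(L) 1\<close>; here \<open>1\<close> is
  \<^term>\<open>ell2_unit []\<close>, and \<open>mult_op F\<close> is \<open>F(L)\<close>.\<close>

definition hardy_ops :: "('d list ell2 \<Rightarrow>\<^sub>L 'd list ell2) set" where
  "hardy_ops =
    (\<lambda>\<A>. unital_subalgebra \<A> \<and> closedin weak_operator_topology \<A>) hull (range left_shift)"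

definition hardy :: "'d list ell2 set" where
  "hardy = (\<lambda>T. blinfun_apply T (ell2_unit [])) ` hardy_ops"

definition mult_op :: "'d list ell2 \<Rightarrow> 'd list ell2 \<Rightarrow>\<^sub>L 'd list ell2" where
  "mult_op F = (THE T. T \<in> hardy_ops \<and> blinfun_apply T (ell2_unit []) = F)"

text \<open>\<open>F(L)\<close> is determined by \<open>F\<close>, because \<^const>\<open>hardy_ops\<close> commutes with the right shifts.\<close>

lemma ell2_unit_has_sum: "((\<lambda>i. ell2_nth x i *\<^sub>C ell2_unit i) has_sum x) UNIV"
proof -
  let ?t = "\<lambda>F. \<Sum>i\<in>F. ell2_nth x i *\<^sub>C ell2_unit i"
  let ?s = "\<Sum>\<^sub>\<infinity>i. (cmod (ell2_nth x i))\<^sup>2"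
  have nth_sum: "ell2_nth (\<Sum>i\<in>F. g i) j = (\<Sum>i\<in>F. ell2_nth (g i) j)"
    for F j and g :: "'a \<Rightarrow> 'a ell2"
    by (induction F rule: infinite_finite_induct) (simp_all add: zero_ell2.rep_eq plus_ell2.rep_eq)
  have nth_minus: "ell2_nth (u - v) j = ell2_nth u j - ell2_nth v j" for u v :: "'a ell2" and j
    unfolding minus_ell2_def plus_ell2.rep_eq uminus_ell2.rep_eq by simp
  have norm_eq: "norm (x - ?t F) = sqrt (?s - (\<Sum>i\<in>F. (cmod (ell2_nth x i))\<^sup>2))" if "finite F" for F
  proof -
    have "ell2_nth (?t F) j = (\<Sum>i\<in>F. if j = i then ell2_nth x i else 0)" for j
      unfolding nth_sum by (intro sum.cong) (auto simp: scaleC.rep_eq ell2_unit.rep_eq)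
    then have nth: "ell2_nth (x - ?t F) j = (if j \<in> F then 0 else ell2_nth x j)" for j
      using that by (simp add: nth_minus)
    have "(\<Sum>\<^sub>\<infinity>j. (cmod (ell2_nth (x - ?t F) j))\<^sup>2) = (\<Sum>\<^sub>\<infinity>j\<in>UNIV - F. (cmod (ell2_nth x j))\<^sup>2)"
      by (rule infsum_cong_neutral) (auto simp: nth)
    also have "\<dots> = ?s - (\<Sum>\<^sub>\<infinity>j\<in>F. (cmod (ell2_nth x j))\<^sup>2)"
      by (rule infsum_Diff) (auto simp: ell2_nth_summable that)
    finally show ?thesis
      using that by (simp add: norm_ell2_def)
  qed
  have "((\<lambda>F. \<Sum>i\<in>F. (cmod (ell2_nth x i))\<^sup>2) \<longlongrightarrow> ?s) (finite_subsets_at_top UNIV)"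
    using has_sum_infsum[OF ell2_nth_summable[of x]] by (simp add: has_sum_def)
  then have "((\<lambda>F. sqrt (?s - (\<Sum>i\<in>F. (cmod (ell2_nth x i))\<^sup>2))) \<longlongrightarrow> sqrt (?s - ?s))
      (finite_subsets_at_top UNIV)"
    by (intro tendsto_intros)
  then have "((\<lambda>F. norm (x - ?t F)) \<longlongrightarrow> 0) (finite_subsets_at_top UNIV)"
    by (auto simp: norm_eq intro!: eventually_finite_subsets_at_top_weakI
        elim!: Lim_transform_eventually)
  then show ?thesis
    unfolding has_sum_def
    by (simp add: tendsto_iff dist_norm norm_minus_commute)
qed

lemma bounded_ops_scaleC: "T \<in> bounded_ops \<Longrightarrow> blinfun_apply T (c *\<^sub>C x) = c *\<^sub>C blinfun_apply T x"
  unfolding bounded_ops_def by (metis (mono_tags) blinfun_apply_blinfun_compose mem_Collect_eq scalar_op.rep_eq)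

lemma bounded_ops_eqI:
  assumes "S \<in> bounded_ops" "T \<in> bounded_ops"
    and "\<And>i. blinfun_apply S (ell2_unit i) = blinfun_apply T (ell2_unit i)"
  shows "S = T"
proof (rule blinfun_eqI)
  fix x :: "'a ell2"
  have "((\<lambda>i. blinfun_apply A (ell2_nth x i *\<^sub>C ell2_unit i)) has_sum blinfun_apply A x) UNIV"
    for A :: "'a ell2 \<Rightarrow>\<^sub>L 'a ell2"
    using has_sum_bounded_linear[OF blinfun.bounded_linear_right ell2_unit_has_sum] .
  from this[of S] this[of T] show "blinfun_apply S x = blinfun_apply T x"
    by (simp add: assms bounded_ops_scaleC) (rule has_sum_unique)
qed

lemma continuous_map_cinner:
  "continuous_map weak_operator_topology euclidean (\<lambda>T. cinner (blinfun_apply T x) y)"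
proof -
  have "continuous_map euclidean euclidean (\<lambda>h :: 'a ell2 \<times> 'a ell2 \<Rightarrow> complex. h (x, y))"
    by (simp add: continuous_on_product_coordinates)
  from continuous_map_pullback[OF this, of UNIV "\<lambda>T (x, y). cinner (blinfun_apply T x) y"]
  show ?thesis
    unfolding weak_operator_topology_def by (simp add: o_def)
qed

lemma topspace_weak_operator_topology [simp]: "topspace weak_operator_topology = UNIV"
  unfolding weak_operator_topology_def by (simp add: topspace_pullback_topology)

lemma closedin_weak_eq:
  "closedin weak_operator_topology
    {T. cinner (blinfun_apply T x) y = a * cinner (blinfun_apply T x') y'}"
proof -
  have "continuous_map weak_operator_topology euclidean
      (\<lambda>T. cinner (blinfun_apply T x) y - a * cinner (blinfun_apply T x') y')"
  proof (intro continuous_map_diff continuous_map_cinner)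
    have "continuous_map euclidean euclidean ((*) a)"
      by (simp add: continuous_on_mult_left continuous_on_id)
    from continuous_map_compose[OF continuous_map_cinner this]
    show "continuous_map weak_operator_topology euclidean
        (\<lambda>T. a * cinner (blinfun_apply T x') y')"
      by (simp add: o_def)
  qed
  from closedin_continuous_map_preimage[OF this, of "{0}"] show ?thesis
    by simp
qed

lemma hardy_ops_commute:
  assumes "T \<in> hardy_ops"
  shows "T \<in> bounded_ops" "T o\<^sub>L right_shift k = right_shift k o\<^sub>L T"
proof -
  let ?C = "\<lambda>k x \<omega>. {T. cinner (blinfun_apply T (right_shift_fun k x)) (ell2_unit \<omega>) =
      (if \<omega> \<noteq> [] \<and> last \<omega> = k then 1 else 0) * cinner (blinfun_apply T x) (ell2_unit (butlast \<omega>))}"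
  let ?B = "\<lambda>c x \<omega>. {T. cinner (blinfun_apply T (c *\<^sub>C x)) (ell2_unit \<omega>) =
      c * cinner (blinfun_apply T x) (ell2_unit \<omega>)}"
  let ?A = "{T \<in> bounded_ops. \<forall>k. T o\<^sub>L right_shift k = right_shift k o\<^sub>L T} ::
    ('a list ell2 \<Rightarrow>\<^sub>L 'a list ell2) set"
  have "T \<in> bounded_ops \<longleftrightarrow> (\<forall>c x \<omega>. T \<in> ?B c x \<omega>)" for T :: "'a list ell2 \<Rightarrow>\<^sub>L 'a list ell2"
    by (simp add: bounded_ops_def cinner_unit blinfun_eq_iff scalar_op.rep_eq scaleC.rep_eq
        ell2_eq_iff)
  moreover have "T o\<^sub>L right_shift k = right_shift k o\<^sub>L T \<longleftrightarrow> (\<forall>x \<omega>. T \<in> ?C k x \<omega>)"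
    for T :: "'a list ell2 \<Rightarrow>\<^sub>L 'a list ell2" and k
    by (auto simp: cinner_unit blinfun_eq_iff right_shift.rep_eq right_shift_fun.rep_eq
        ell2_eq_iff)
  ultimately have A_eq: "?A = (\<Inter>(c, x, \<omega>)\<in>UNIV. ?B c x \<omega>) \<inter> (\<Inter>(k, x, \<omega>)\<in>UNIV. ?C k x \<omega>)"
    by auto
  have "closedin weak_operator_topology ?A"
    unfolding A_eq by (intro closedin_Int closedin_INT) (auto simp: closedin_weak_eq)
  moreover have "unital_subalgebra ?A"
    unfolding unital_subalgebra_def
  proof (intro conjI ballI subsetI)
    fix S :: "'a list ell2 \<Rightarrow>\<^sub>L 'a list ell2" assume "S \<in> range scalar_op"
    then show "S \<in> ?A"
      by (auto simp: bounded_ops_def blinfun_eq_iff scalar_op.rep_eq right_shift.rep_eq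
          right_shift_fun.rep_eq scaleC.rep_eq intro!: ell2_eqI)
  next
    fix S T :: "'a list ell2 \<Rightarrow>\<^sub>L 'a list ell2" assume "S \<in> ?A" "T \<in> ?A"
    then show "S + T \<in> ?A"
      by (auto simp: bounded_ops_def blinfun_eq_iff blinfun.add_left blinfun.add_right)
    from \<open>S \<in> ?A\<close> \<open>T \<in> ?A\<close> show "S o\<^sub>L T \<in> ?A"
      by (auto simp: bounded_ops_def blinfun_eq_iff)
  qed auto
  moreover have "range left_shift \<subseteq> ?A"
  proof safe
    fix j k :: 'a
    show "left_shift j \<in> bounded_ops"
      by (auto simp: bounded_ops_def blinfun_eq_iff scalar_op.rep_eq left_shift.rep_eq
          left_shift_fun.rep_eq scaleC.rep_eq intro!: ell2_eqI)
    have "left_shift_fun j (right_shift_fun k x) = right_shift_fun k (left_shift_fun j x)" for x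
    proof (rule ell2_eqI)
      fix \<omega> :: "'a list"
      show "ell2_nth (left_shift_fun j (right_shift_fun k x)) \<omega> =
          ell2_nth (right_shift_fun k (left_shift_fun j x)) \<omega>"
        by (cases \<omega>; cases "tl \<omega>" rule: rev_cases)
          (auto simp: left_shift_fun.rep_eq right_shift_fun.rep_eq)
    qed
    then show "left_shift j o\<^sub>L right_shift k = right_shift k o\<^sub>L left_shift j"
      by (auto simp: blinfun_eq_iff left_shift.rep_eq right_shift.rep_eq)
  qed
  ultimately have "hardy_ops \<subseteq> ?A"
    unfolding hardy_ops_def by (intro hull_minimal) auto
  then show "T \<in> bounded_ops" "T o\<^sub>L right_shift k = right_shift k o\<^sub>L T"
    using assms by auto
qed

lemma mult_op_eq:
  assumes T: "T \<in> hardy_ops"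
  shows "mult_op (blinfun_apply T (ell2_unit [])) = T"
  unfolding mult_op_def
proof (rule the_equality)
  fix S assume S: "S \<in> hardy_ops \<and> blinfun_apply S (ell2_unit []) = blinfun_apply T (ell2_unit [])"
  have unit: "ell2_unit (\<alpha> @ [k]) = blinfun_apply (right_shift k) (ell2_unit \<alpha>)" for \<alpha> :: "'a list" and k
    by (rule ell2_eqI) (auto simp: right_shift.rep_eq right_shift_fun.rep_eq ell2_unit.rep_eq)
  have "blinfun_apply S (ell2_unit \<alpha>) = blinfun_apply T (ell2_unit \<alpha>)" for \<alpha>
  proof (induction \<alpha> rule: rev_induct)
    case (snoc k \<alpha>)
    then show ?case
      using hardy_ops_commute(2)[of S k] hardy_ops_commute(2)[of T k] S T
      unfolding unit blinfun_apply_blinfun_compose[symmetric] by simp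
  qed (use S in simp)
  then show "S = T"
    using S T by (intro bounded_ops_eqI hardy_ops_commute(1)) auto
qed (use T in simp)


section \<open>Inner and outer series\<close>

definition nc_inner :: "'d list ell2 \<Rightarrow> bool" where
  "nc_inner \<Theta> \<longleftrightarrow> \<Theta> \<in> hardy \<and> (\<forall>h. norm (blinfun_apply (mult_op \<Theta>) h) = norm h)"

definition nc_outer :: "'d list ell2 \<Rightarrow> bool" where
  "nc_outer f \<longleftrightarrow> closure (cspan (range (\<lambda>\<alpha>. blinfun_apply (op_word right_shift \<alpha>) f))) = UNIV"

definition nc_inner_outer_factorization :: "'d list ell2 \<Rightarrow> 'd list ell2 \<Rightarrow> 'd list ell2 \<Rightarrow> bool" where
  "nc_inner_outer_factorization h \<Theta> f \<longleftrightarrow>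
    nc_inner \<Theta> \<and> nc_outer f \<and> h = blinfun_apply (mult_op \<Theta>) f"


section \<open>Row contractions, singularity loci and Blaschke inner functions\<close>

text \<open>Points of finite level \<open>n\<close> are tuples of matrices; points of level \<open>\<infinity>\<close> are tuples of operators
  on \<^typ>\<open>nat ell2\<close>.\<close>

definition mat_word :: "nat \<Rightarrow> ('d \<Rightarrow> complex mat) \<Rightarrow> 'd list \<Rightarrow> complex mat" where
  "mat_word n Z \<alpha> = foldr (\<lambda>i M. Z i * M) \<alpha> (1\<^sub>m n)"

definition vec_l2norm :: "complex Matrix.vec \<Rightarrow> real" where
  "vec_l2norm v = L2_set (\<lambda>i. cmod (v $ i)) {..<dim_vec v}"

definition mat_opnorm :: "complex mat \<Rightarrow> real" where
  "mat_opnorm M = (SUP v\<in>{v \<in> carrier_vec (dim_col M). vec_l2norm v \<le> 1}. vec_l2norm (M *\<^sub>v v))"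

definition row_ball_fin :: "nat \<Rightarrow> ('d::finite \<Rightarrow> complex mat) set" where
  "row_ball_fin n = {Z. (\<forall>j. Z j \<in> carrier_mat n n) \<and>
    sqrt (mat_opnorm (mat n n (\<lambda>p. \<Sum>j\<in>UNIV. (Z j * mat_adjoint (Z j)) $$ p))) < 1}"

text \<open>\<^const>\<open>adjoint\<close> is taken with respect to the real inner product of \<^typ>\<open>nat ell2\<close>; on
  \<^const>\<open>bounded_ops\<close> it is the Hilbert space adjoint.\<close>

definition row_ball_inf :: "('d::finite \<Rightarrow> nat ell2 \<Rightarrow>\<^sub>L nat ell2) set" where
  "row_ball_inf = {Z. (\<forall>j. Z j \<in> bounded_ops) \<and>
    sqrt (onorm (\<lambda>x. \<Sum>j\<in>UNIV. blinfun_apply (Z j) (adjoint (blinfun_apply (Z j)) x))) < 1}"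

definition eval_fin :: "'d::finite list ell2 \<Rightarrow> nat \<Rightarrow> ('d \<Rightarrow> complex mat) \<Rightarrow> complex mat" where
  "eval_fin f n Z =
    mat n n (\<lambda>p. \<Sum>k. \<Sum>\<alpha> | length \<alpha> = k. ell2_nth f \<alpha> * mat_word n Z \<alpha> $$ p)"

definition eval_inf ::
  "'d::finite list ell2 \<Rightarrow> ('d \<Rightarrow> nat ell2 \<Rightarrow>\<^sub>L nat ell2) \<Rightarrow> nat ell2 \<Rightarrow>\<^sub>L nat ell2" where
  "eval_inf f Z = (\<Sum>k. \<Sum>\<alpha> | length \<alpha> = k. scalar_op (ell2_nth f \<alpha>) o\<^sub>L op_word Z \<alpha>)"

text \<open>The condition \<open>y\<^sup>* f(Z) = 0\<close> (the \<open>j\<close>-th entry of the row vector \<open>y\<^sup>* M\<close> is \<open>col M j \<bullet>c y\<close>).\<close>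

definition null_fin :: "'d::finite list ell2 \<Rightarrow> nat \<Rightarrow> ('d \<Rightarrow> complex mat) \<Rightarrow> complex Matrix.vec \<Rightarrow> bool" where
  "null_fin f n Z y \<longleftrightarrow> (\<forall>j<n. col (eval_fin f n Z) j \<bullet>c y = 0)"

definition null_inf ::
  "'d::finite list ell2 \<Rightarrow> ('d \<Rightarrow> nat ell2 \<Rightarrow>\<^sub>L nat ell2) \<Rightarrow> nat ell2 \<Rightarrow> bool" where
  "null_inf f Z y \<longleftrightarrow> (\<forall>x. cinner (blinfun_apply (eval_inf f Z) x) y = 0)"

definition sing_fin :: "'d::finite list ell2 \<Rightarrow> nat \<Rightarrow> (('d \<Rightarrow> complex mat) \<times> complex Matrix.vec) set" where
  "sing_fin f n =
    {(Z, y). Z \<in> row_ball_fin n \<and> y \<in> carrier_vec n \<and> y \<noteq> 0\<^sub>v n \<and> null_fin f n Z y}"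

definition sing_inf :: "'d::finite list ell2 \<Rightarrow> (('d \<Rightarrow> nat ell2 \<Rightarrow>\<^sub>L nat ell2) \<times> nat ell2) set" where
  "sing_inf f = {(Z, y). Z \<in> row_ball_inf \<and> y \<noteq> 0 \<and> null_inf f Z y}"

definition nc_blaschke :: "'d::finite list ell2 \<Rightarrow> bool" where
  "nc_blaschke \<Theta> \<longleftrightarrow> nc_inner \<Theta> \<and>
    range (blinfun_apply (mult_op \<Theta>)) =
      {h. (\<forall>n. \<forall>(Z, y)\<in>sing_fin \<Theta> n. null_fin h n Z y) \<and> (\<forall>(Z, y)\<in>sing_inf \<Theta>. null_inf h Z y)}"


section \<open>NC rational functions\<close>

datatype 'd nc_expr =
    NC_Var 'd
  | NC_Const complex
  | NC_Add "'d nc_expr" "'d nc_expr"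
  | NC_Mult "'d nc_expr" "'d nc_expr"
  | NC_Inv "'d nc_expr"

primrec nc_expr_eval :: "nat \<Rightarrow> ('d \<Rightarrow> complex mat) \<Rightarrow> 'd nc_expr \<Rightarrow> complex mat option" where
  "nc_expr_eval n X (NC_Var j) = Some (X j)"
| "nc_expr_eval n X (NC_Const a) = Some (a \<cdot>\<^sub>m 1\<^sub>m n)"
| "nc_expr_eval n X (NC_Add e1 e2) =
    Option.bind (nc_expr_eval n X e1) (\<lambda>M1. map_option (\<lambda>M2. M1 + M2) (nc_expr_eval n X e2))"
| "nc_expr_eval n X (NC_Mult e1 e2) =
    Option.bind (nc_expr_eval n X e1) (\<lambda>M1. map_option (\<lambda>M2. M1 * M2) (nc_expr_eval n X e2))"
| "nc_expr_eval n X (NC_Inv e) = Option.bind (nc_expr_eval n X e) mat_inverse"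

text \<open>Level \<open>0\<close> is excluded: there, all expressions would agree.\<close>

definition mat_tuples :: "(nat \<times> ('d \<Rightarrow> complex mat)) set" where
  "mat_tuples = {(n, X). 0 < n \<and> (\<forall>j. X j \<in> carrier_mat n n)}"

definition nc_expr_dom :: "'d nc_expr \<Rightarrow> (nat \<times> ('d \<Rightarrow> complex mat)) set" where
  "nc_expr_dom e = {(n, X) \<in> mat_tuples. nc_expr_eval n X e \<noteq> None}"

definition nc_expr_equiv :: "('d nc_expr \<times> 'd nc_expr) set" where
  "nc_expr_equiv = {(e, e'). nc_expr_dom e \<inter> nc_expr_dom e' \<noteq> {} \<and>
    (\<forall>(n, X)\<in>nc_expr_dom e \<inter> nc_expr_dom e'. nc_expr_eval n X e = nc_expr_eval n X e')}"

definition nc_rational_functions :: "'d nc_expr set set" where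
  "nc_rational_functions = {e. nc_expr_dom e \<noteq> {}} // nc_expr_equiv"

definition nc_dom :: "'d nc_expr set \<Rightarrow> (nat \<times> ('d \<Rightarrow> complex mat)) set" where
  "nc_dom \<rr> = (\<Union>e\<in>\<rr>. nc_expr_dom e)"

text \<open>\<open>nc_value \<rr> n X M\<close>: \<open>(n, X)\<close> lies in the domain of \<open>\<rr>\<close> and \<open>\<rr>(X) = M\<close>.\<close>

definition nc_value :: "'d nc_expr set \<Rightarrow> nat \<Rightarrow> ('d \<Rightarrow> complex mat) \<Rightarrow> complex mat \<Rightarrow> bool" where
  "nc_value \<rr> n X M \<longleftrightarrow> (\<exists>e\<in>\<rr>. (n, X) \<in> nc_expr_dom e \<and> nc_expr_eval n X e = Some M)"

definition kronecker :: "complex mat \<Rightarrow> complex mat \<Rightarrow> complex mat" (infixl \<open>\<otimes>\<^sub>m\<close> 70) where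
  "A \<otimes>\<^sub>m B = mat (dim_row A * dim_row B) (dim_col A * dim_col B)
    (\<lambda>(i, j). A $$ (i div dim_row B, j div dim_col B) * B $$ (i mod dim_row B, j mod dim_col B))"

definition linear_pencil ::
  "nat \<Rightarrow> ('d::finite \<Rightarrow> complex mat) \<Rightarrow> nat \<Rightarrow> ('d \<Rightarrow> complex mat) \<Rightarrow> complex mat" where
  "linear_pencil n A m X =
    1\<^sub>m n \<otimes>\<^sub>m 1\<^sub>m m - mat (n * m) (n * m) (\<lambda>p. \<Sum>j\<in>UNIV. (A j \<otimes>\<^sub>m X j) $$ p)"

definition nc_realization ::
  "'d::finite nc_expr set \<Rightarrow> nat \<Rightarrow> ('d \<Rightarrow> complex mat) \<Rightarrow> complex Matrix.vec \<Rightarrow> complex Matrix.vec \<Rightarrow> bool" where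
  "nc_realization \<rr> n A b c \<longleftrightarrow>
    (\<forall>j. A j \<in> carrier_mat n n) \<and> b \<in> carrier_vec n \<and> c \<in> carrier_vec n \<and>
    (\<forall>(m, X)\<in>mat_tuples. \<forall>K. mat_inverse (linear_pencil n A m X) = Some K \<longrightarrow>
      nc_value \<rr> m X
        ((mat_adjoint (mat_of_cols n [b]) \<otimes>\<^sub>m 1\<^sub>m m) * K * (mat_of_cols n [c] \<otimes>\<^sub>m 1\<^sub>m m)))"

definition nc_minimal_realization ::
  "'d::finite nc_expr set \<Rightarrow> nat \<Rightarrow> ('d \<Rightarrow> complex mat) \<Rightarrow> complex Matrix.vec \<Rightarrow> complex Matrix.vec \<Rightarrow> bool" where
  "nc_minimal_realization \<rr> n A b c \<longleftrightarrow>
    nc_realization \<rr> n A b c \<and> (\<forall>n' A' b' c'. nc_realization \<rr> n' A' b' c' \<longrightarrow> n \<le> n')"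

text \<open>The power series of \<open>\<rr>\<close> at \<open>0\<close> is \<open>h\<close>: the coefficient of \<open>\<omega>\<close> is \<open>b\<^sup>* A\<^sup>\<omega> c\<close>, for any
  realization. The requirement that \<open>0\<close> be in the domain is needed for realizations to exist.\<close>

definition nc_equals_series :: "'d::finite nc_expr set \<Rightarrow> 'd list ell2 \<Rightarrow> bool" where
  "nc_equals_series \<rr> h \<longleftrightarrow> (1, \<lambda>_. 0\<^sub>m 1 1) \<in> nc_dom \<rr> \<and>
    (\<exists>n A b c. nc_realization \<rr> n A b c \<and> (\<forall>\<omega>. ell2_nth h \<omega> = (mat_word n A \<omega> *\<^sub>v c) \<bullet>c b))"

end

theory Submission
  imports Defs "Jordan_Normal_Form.Char_Poly"
begin

text \<open>
  Let \<open>T\<close> be the left multiplier of \<open>\<Theta>\<close>, an isometry with adjoint \<open>S\<close>, so that \<open>r = T f\<close> and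
  \<open>f = S r\<close>. Everything rests on one finiteness property. For a realization \<open>(A, b, c)\<close> of size
  \<open>N\<close> the coefficient of \<open>r\<close> at the word \<open>\<alpha> @ \<omega>\<close> is a linear functional, depending on \<open>\<alpha>\<close>, of the
  state \<open>A\<^sup>\<omega> c\<close>, a vector of length \<open>N\<close>. Hence the tails \<open>\<alpha> \<mapsto> r\<^bsub>\<alpha>\<omega>\<^esub>\<close> of \<open>r\<close> inherit every linear
  relation between the states (\<open>right_tail_relation\<close>), and they span a space of finite dimension.

  The outer factor is rational because its coefficient at \<open>\<omega>\<close> is the inner product of the tail of
  \<open>r\<close> at \<open>\<omega>\<close> with \<open>\<Theta>\<close>. It is therefore a linear function of the state \<open>A\<^sup>\<omega> c\<close>, that is,
  \<open>b'\<^sup>* A\<^sup>\<omega> c\<close> for some \<open>b'\<close> (\<open>outer_factor_realization\<close>). The constant coefficient \<open>f\<^sub>0\<close> of an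
  outer series does not vanish, so \<open>\<Theta>\<close> is the quotient of \<open>r\<close> by \<open>f\<close>; dividing by \<open>f\<close> amounts to a
  feedback which replaces \<open>A\<^sub>j\<close> by \<open>A\<^sub>j - c b'\<^sup>* A\<^sub>j / f\<^sub>0\<close> and keeps the number \<open>N\<close> of states
  (\<open>inner_factor_realization\<close>).

  Passing between coefficients and rational functions takes two facts about expressions. The
  coefficients of a realization depend only on the rational function, since they can be read off
  its values at nilpotent tuples (\<open>nc_realization_coeffs_unique\<close>). Conversely every triple
  realizes some rational function (\<open>nc_realization_exists\<close>): near each tuple where the linear
  pencil is invertible, the pencil can be inverted by an expression, and all these expressions are
  equivalent, because the domain of an expression meets a complex line either not at all or in all
  but finitely many points (\<open>nc_expr_eval_line\<close>).

  For the Blaschke property, write \<open>y\<^sup>* h(Z) x\<close> as an inner product of \<open>h\<close> with a kernel series.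
  The kernels belonging to a fixed point \<open>(Z, y)\<close> are closed under taking tails, so a zero of \<open>\<Theta>\<close>
  is a zero of all elements of the range of \<open>T\<close> (\<open>null_inf_range\<close>, \<open>null_fin_range\<close>). Conversely,
  let \<open>h\<close> vanish on the singularity locus of \<open>\<Theta>\<close>; it has to be orthogonal to the kernel of \<open>S\<close>,
  the orthogonal complement of the range. If the coefficients of some \<open>g\<close> in this kernel decay
  geometrically, then the left shifts scaled by some \<open>s < 1\<close>, together with \<open>g\<close>, its coefficients
  divided by matching powers of \<open>s\<close>, form a point of level \<open>\<infinity>\<close> of the locus, and the condition on
  \<open>h\<close> there says that \<open>h\<close> is orthogonal to \<open>g\<close> (\<open>decaying_orthogonal\<close>).

  It remains to see that such \<open>g\<close> are dense in the kernel of \<open>S\<close>, which is where rationality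
  enters again. The projections of the tails of \<open>r\<close> to the kernel of \<open>S\<close> span a finite-dimensional
  space \<open>M\<close>. Because \<open>f\<close> is outer, the orthogonal complement of \<open>M\<close> in the kernel of \<open>S\<close> is mapped
  into itself by the right shifts (\<open>perp_right_shift\<close>), and hence \<open>M\<close> is invariant under their
  adjoints. Series in a finite-dimensional space with this invariance decay geometrically, at a
  common rate (\<open>finite_dimensional_decay\<close>). Replacing the tails of \<open>g\<close> at all words of length \<open>n\<close>
  by their projections to \<open>M\<close> gives an element of the kernel of \<open>S\<close> that decays, and the
  squared norm of the error is at most the energy of \<open>g\<close> from degree \<open>n\<close> on
  (\<open>orthogonal_to_kernel\<close>).
\<close>

section \<open>Expressions along complex lines\<close>

lemma mat_inverse_eq_SomeI:
  assumes A: "A \<in> carrier_mat n n" and B: "B \<in> carrier_mat n n" and AB: "A * B = 1\<^sub>m n"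
  shows "mat_inverse A = Some (B :: complex mat)"
proof (cases "mat_inverse A")
  case None
  have "B * A = 1\<^sub>m n" by (rule mat_mult_left_right_inverse[OF A B AB])
  then have "A \<in> Units (ring_mat TYPE(complex) n ())"
    using A B AB unfolding Units_def ring_mat_def by auto
  with mat_inverse(1)[OF A None, where b = "()"] show ?thesis by blast
next
  case (Some C)
  from mat_inverse(2)[OF A Some] have C: "C * A = 1\<^sub>m n" "C \<in> carrier_mat n n" by auto
  have "C = C * (A * B)" using C AB by simp
  also have "\<dots> = B" using C A B by (simp add: assoc_mult_mat[symmetric, of C n n A n B n])
  finally show ?thesis using Some by simp
qed

lemma mat_inverse_iff_det:
  assumes A: "(A :: complex mat) \<in> carrier_mat n n"
  shows "mat_inverse A \<noteq> None \<longleftrightarrow> det A \<noteq> 0"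
proof
  assume "mat_inverse A \<noteq> None"
  then obtain B where "mat_inverse A = Some B" by auto
  from mat_inverse(2)[OF A this] have "A * B = 1\<^sub>m n" "B \<in> carrier_mat n n" by auto
  then have "det A * det B = 1" using det_mult[OF A] by (metis det_one)
  then show "det A \<noteq> 0" by auto
next
  assume "det A \<noteq> 0"
  then show "mat_inverse A \<noteq> None"
    using mat_inverse(1)[OF A, of "()"] det_non_zero_imp_unit[OF A \<open>det A \<noteq> 0\<close>, of "()"] by blast
qed

lemma mat_inverse_if_injective:
  assumes A: "(A :: complex mat) \<in> carrier_mat n n"
    and "\<And>v. v \<in> carrier_vec n \<Longrightarrow> A *\<^sub>v v = 0\<^sub>v n \<Longrightarrow> v = 0\<^sub>v n"
  obtains K where "mat_inverse A = Some K"
  using assms(2) mat_inverse_iff_det[OF A] det_0_iff_vec_prod_zero_field[OF A] by blast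

lemma nc_expr_eval_carrier:
  assumes X: "\<forall>j. X j \<in> carrier_mat m m"
  shows "nc_expr_eval m X e = Some E \<Longrightarrow> E \<in> carrier_mat m m"
proof (induction e arbitrary: E)
  case (NC_Inv e)
  then show ?case
    by (auto simp: bind_eq_Some_conv dest!: mat_inverse(2))
qed (use X in \<open>auto simp: bind_eq_Some_conv\<close>)

text \<open>The entries are collected by \<^const>\<open>mat\<close>, so that every point of the line has size \<open>m\<close>, whatever
  \<open>X\<close> and \<open>Y\<close> are.\<close>

definition mat_line ::
  "nat \<Rightarrow> ('d \<Rightarrow> complex mat) \<Rightarrow> ('d \<Rightarrow> complex mat) \<Rightarrow> complex \<Rightarrow> 'd \<Rightarrow> complex mat" where
  "mat_line m X Y t j = mat m m (\<lambda>p. X j $$ p + t * (Y j $$ p - X j $$ p))"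

lemma mat_line_carrier: "mat_line m X Y t j \<in> carrier_mat m m"
  by (simp add: mat_line_def)

lemma mat_line_0: "\<forall>j. X j \<in> carrier_mat m m \<Longrightarrow> mat_line m X Y 0 = X"
  and mat_line_1: "\<forall>j. Y j \<in> carrier_mat m m \<Longrightarrow> mat_line m X Y 1 = Y"
  by (rule ext, rule eq_matI; metis (no_types, lifting) mat_line_carrier carrier_matD mat_line_def index_mat(1) add_0_right mult_zero_left mult_1 add_diff_cancel_left' diff_add_cancel add.commute)+

text \<open>Along a line an expression is a matrix \<open>P / q\<close> of rational functions of the parameter: sums
  and products multiply the denominators, and inversion replaces \<open>P / q\<close> by \<open>q adj P / det P\<close>. A
  point is lost only where a determinant vanishes, and a nonzero polynomial has finitely many
  roots.\<close>

lemma nc_expr_eval_line: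
  fixes e :: "'d nc_expr" and X Y :: "'d \<Rightarrow> complex mat" and m :: nat
  defines "ev \<equiv> \<lambda>e t. nc_expr_eval m (mat_line m X Y t) e"
  shows "(\<exists>P\<in>carrier_mat m m. \<exists>q. \<forall>t E. ev e t = Some E \<longrightarrow>
      poly q t \<noteq> 0 \<and> map_mat (\<lambda>p. poly p t) P = poly q t \<cdot>\<^sub>m E) \<and>
    ((\<exists>t. ev e t \<noteq> None) \<longrightarrow> finite {t. ev e t = None})"
proof (induction e)
  case (NC_Var j)
  show ?case
  proof (intro conjI impI bexI exI allI)
    fix t E assume "ev (NC_Var j) t = Some E"
    then have "E = mat_line m X Y t j" by (simp add: ev_def)
    then show "map_mat (\<lambda>p. poly p t) (mat m m (\<lambda>p. [:X j $$ p, Y j $$ p - X j $$ p:])) = poly 1 t \<cdot>\<^sub>m E"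
      by (auto simp: mat_line_def)
  qed (auto simp: ev_def)
next
  case (NC_Const a)
  show ?case
  proof (intro conjI impI bexI exI allI)
    fix t E assume "ev (NC_Const a) t = Some E"
    then have "E = a \<cdot>\<^sub>m 1\<^sub>m m" by (simp add: ev_def)
    then show "map_mat (\<lambda>p. poly p t) (mat m m (\<lambda>(i,j). if i = j then [:a:] else 0)) = poly 1 t \<cdot>\<^sub>m E"
      by auto
  qed (auto simp: ev_def)
next
  case (NC_Add e1 e2)
  then obtain P1 q1 P2 q2 where P: "P1 \<in> carrier_mat m m" "P2 \<in> carrier_mat m m"
    and 1: "\<And>t E. ev e1 t = Some E \<Longrightarrow> poly q1 t \<noteq> 0 \<and> map_mat (\<lambda>p. poly p t) P1 = poly q1 t \<cdot>\<^sub>m E"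
    and 2: "\<And>t E. ev e2 t = Some E \<Longrightarrow> poly q2 t \<noteq> 0 \<and> map_mat (\<lambda>p. poly p t) P2 = poly q2 t \<cdot>\<^sub>m E"
    and f1: "(\<exists>t. ev e1 t \<noteq> None) \<Longrightarrow> finite {t. ev e1 t = None}"
    and f2: "(\<exists>t. ev e2 t \<noteq> None) \<Longrightarrow> finite {t. ev e2 t = None}"
    by blast
  have none: "ev (NC_Add e1 e2) t = None \<longleftrightarrow> ev e1 t = None \<or> ev e2 t = None" for t
    by (auto simp: ev_def bind_eq_None_conv)
  show ?case
  proof (intro conjI impI bexI[of _ "q2 \<cdot>\<^sub>m P1 + q1 \<cdot>\<^sub>m P2"] exI[of _ "q1 * q2"] allI)
    fix t E assume "ev (NC_Add e1 e2) t = Some E"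
    then obtain E1 E2 where E: "ev e1 t = Some E1" "ev e2 t = Some E2" "E = E1 + E2"
      by (auto simp: ev_def bind_eq_Some_conv)
    have c: "E1 \<in> carrier_mat m m" "E2 \<in> carrier_mat m m"
      using E nc_expr_eval_carrier[OF allI[OF mat_line_carrier]] by (auto simp: ev_def)
    note h = 1[OF E(1)] 2[OF E(2)]
    then have hh: "poly (P1 $$ (i,j)) t = poly q1 t * E1 $$ (i,j)"
      "poly (P2 $$ (i,j)) t = poly q2 t * E2 $$ (i,j)" if "i < m" "j < m" for i j
      using that P c by (auto simp: mat_eq_iff)
    show "poly (q1 * q2) t \<noteq> 0" using h by simp
    show "map_mat (\<lambda>p. poly p t) (q2 \<cdot>\<^sub>m P1 + q1 \<cdot>\<^sub>m P2) = poly (q1 * q2) t \<cdot>\<^sub>m E"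
      using P c by (auto simp: E mat_eq_iff hh algebra_simps)
  next
    assume "\<exists>t. ev (NC_Add e1 e2) t \<noteq> None"
    then show "finite {t. ev (NC_Add e1 e2) t = None}"
      unfolding none Collect_disj_eq using f1 f2 by auto
  qed (use P in auto)
next
  case (NC_Mult e1 e2)
  then obtain P1 q1 P2 q2 where P: "P1 \<in> carrier_mat m m" "P2 \<in> carrier_mat m m"
    and 1: "\<And>t E. ev e1 t = Some E \<Longrightarrow> poly q1 t \<noteq> 0 \<and> map_mat (\<lambda>p. poly p t) P1 = poly q1 t \<cdot>\<^sub>m E"
    and 2: "\<And>t E. ev e2 t = Some E \<Longrightarrow> poly q2 t \<noteq> 0 \<and> map_mat (\<lambda>p. poly p t) P2 = poly q2 t \<cdot>\<^sub>m E"
    and f1: "(\<exists>t. ev e1 t \<noteq> None) \<Longrightarrow> finite {t. ev e1 t = None}"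
    and f2: "(\<exists>t. ev e2 t \<noteq> None) \<Longrightarrow> finite {t. ev e2 t = None}"
    by blast
  have none: "ev (NC_Mult e1 e2) t = None \<longleftrightarrow> ev e1 t = None \<or> ev e2 t = None" for t
    by (auto simp: ev_def bind_eq_None_conv)
  show ?case
  proof (intro conjI impI bexI[of _ "P1 * P2"] exI[of _ "q1 * q2"] allI)
    fix t E assume "ev (NC_Mult e1 e2) t = Some E"
    then obtain E1 E2 where E: "ev e1 t = Some E1" "ev e2 t = Some E2" "E = E1 * E2"
      by (auto simp: ev_def bind_eq_Some_conv)
    have c: "E1 \<in> carrier_mat m m" "E2 \<in> carrier_mat m m"
      using E nc_expr_eval_carrier[OF allI[OF mat_line_carrier]] by (auto simp: ev_def)
    note h = 1[OF E(1)] 2[OF E(2)]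
    show "poly (q1 * q2) t \<noteq> 0" using h by simp
    have "map_mat (\<lambda>p. poly p t) (P1 * P2) = (poly q1 t \<cdot>\<^sub>m E1) * (poly q2 t \<cdot>\<^sub>m E2)"
      using h semiring_hom.mat_hom_mult[OF poly_hom.semiring_hom_axioms,OF P] by simp
    also have "\<dots> = poly (q1 * q2) t \<cdot>\<^sub>m E"
      using c by (simp add: E mult_smult_assoc_mat[of _ m m _ m] mult_smult_distrib[of _ m m _ m])
        (auto simp: mat_eq_iff)
    finally show "map_mat (\<lambda>p. poly p t) (P1 * P2) = poly (q1 * q2) t \<cdot>\<^sub>m E" .
  next
    assume "\<exists>t. ev (NC_Mult e1 e2) t \<noteq> None"
    then show "finite {t. ev (NC_Mult e1 e2) t = None}"
      unfolding none Collect_disj_eq using f1 f2 by auto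
  qed (use P in auto)
next
  case (NC_Inv e)
  then obtain P q where P: "P \<in> carrier_mat m m"
    and 1: "\<And>t E. ev e t = Some E \<Longrightarrow> poly q t \<noteq> 0 \<and> map_mat (\<lambda>p. poly p t) P = poly q t \<cdot>\<^sub>m E"
    and f1: "(\<exists>t. ev e t \<noteq> None) \<Longrightarrow> finite {t. ev e t = None}"
    by blast
  have c: "E \<in> carrier_mat m m" if "ev e t = Some E" for E t
    using that nc_expr_eval_carrier[OF allI[OF mat_line_carrier]] by (auto simp: ev_def)
  have d: "poly (det P) t = poly q t ^ m * det E" if "ev e t = Some E" for t E
    using arg_cong[OF conjunct2[OF 1[OF that]], of det] c[OF that]
    by (simp add: comm_ring_hom.hom_det[OF poly_hom.comm_ring_hom_axioms])
  have none: "ev (NC_Inv e) t = None \<longleftrightarrow> ev e t = None \<or> poly (det P) t = 0" for t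
  proof (cases "ev e t")
    case (Some E)
    then have "ev (NC_Inv e) t = mat_inverse E" by (simp add: ev_def)
    then show ?thesis using mat_inverse_iff_det[OF c[OF Some]] d[OF Some] 1[OF Some] Some by auto
  qed (simp add: ev_def)
  show ?case
  proof (intro conjI impI bexI[of _ "q \<cdot>\<^sub>m adj_mat P"] exI[of _ "det P"] allI)
    fix t F assume F: "ev (NC_Inv e) t = Some F"
    then obtain E where E: "ev e t = Some E" "mat_inverse E = Some F"
      by (auto simp: ev_def bind_eq_Some_conv)
    from F none[of t] show nz: "poly (det P) t \<noteq> 0" by auto
    note cE = c[OF E(1)]
    from mat_inverse(2)[OF cE E(2)] have EF: "E * F = 1\<^sub>m m" and cF: "F \<in> carrier_mat m m" by auto
    let ?M = "map_mat (\<lambda>p. poly p t)"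
    have aM: "?M (adj_mat P) \<in> carrier_mat m m" using adj_mat(1)[OF P] by simp
    have "?M (adj_mat P) * ?M P = ?M (det P \<cdot>\<^sub>m 1\<^sub>m m)"
      using semiring_hom.mat_hom_mult[OF poly_hom.semiring_hom_axioms,OF adj_mat(1)[OF P] P, of t] adj_mat(3)[OF P] by simp
    also have "\<dots> = poly (det P) t \<cdot>\<^sub>m 1\<^sub>m m" by auto
    finally have "poly (det P) t \<cdot>\<^sub>m 1\<^sub>m m = ?M (adj_mat P) * (poly q t \<cdot>\<^sub>m E)"
      using 1[OF E(1)] by simp
    also have "\<dots> = poly q t \<cdot>\<^sub>m (?M (adj_mat P) * E)"
      using aM cE by (simp add: mult_smult_distrib[of _ m m _ m])
    finally have "(poly q t \<cdot>\<^sub>m (?M (adj_mat P) * E)) * F = (poly (det P) t \<cdot>\<^sub>m 1\<^sub>m m) * F" by simp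
    moreover have "(poly (det P) t \<cdot>\<^sub>m 1\<^sub>m m) * F = poly (det P) t \<cdot>\<^sub>m F"
      using cF by (simp add: mult_smult_assoc_mat[of _ m m _ m])
    moreover have "(poly q t \<cdot>\<^sub>m (?M (adj_mat P) * E)) * F = poly q t \<cdot>\<^sub>m ?M (adj_mat P)"
      using aM cE cF EF by (simp add: mult_smult_assoc_mat[of _ m m _ m] assoc_mult_mat[of _ m m _ m _ m])
    ultimately show "?M (q \<cdot>\<^sub>m adj_mat P) = poly (det P) t \<cdot>\<^sub>m F"
      by (auto simp: mat_eq_iff)
  next
    assume "\<exists>t. ev (NC_Inv e) t \<noteq> None"
    then obtain t where "ev e t \<noteq> None" "poly (det P) t \<noteq> 0" unfolding none by auto
    then show "finite {t. ev (NC_Inv e) t = None}"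
      unfolding none Collect_disj_eq using f1 by (auto intro!: poly_roots_finite)
  qed (use P adj_mat(1)[OF P] in auto)
qed

section \<open>Block matrices\<close>

lemma block_index:
  assumes "i < k" "p < (m::nat)"
  shows "i * m + p < k * m" "(i * m + p) div m = i" "(i * m + p) mod m = p"
proof -
  have "i * m + p < Suc i * m" using assms by simp
  also have "\<dots> \<le> k * m" using assms by (intro mult_le_mono1) simp
  finally show "i * m + p < k * m" .
qed (use assms in auto)

lemma block_cases:
  assumes "a < k * (m::nat)"
  obtains i p where "i < k" "p < m" "a = i * m + p"
proof
  show "a div m < k" using assms by (simp add: less_mult_imp_div_less)
  show "a mod m < m" using assms by (cases m) auto
qed simp

lemma sum_blocks: "(\<Sum>a<k * m. f a) = (\<Sum>i<k. \<Sum>p<m. f (i * m + p))" for f :: "nat \<Rightarrow> 'a::comm_monoid_add"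
proof -
  have "(\<Sum>p<m. f (i * m + p)) = sum f {i * m..<i * m + m}" for i
    by (subst sum.atLeastLessThan_shift_0) (simp add: atLeast0LessThan o_def)
  then show ?thesis by (simp add: sum.nat_group)
qed

lemma block_eq_matI:
  assumes "A \<in> carrier_mat (k * m) (l * n)" "B \<in> carrier_mat (k * m) (l * n)"
    and "\<And>i p j q. i < k \<Longrightarrow> p < m \<Longrightarrow> j < l \<Longrightarrow> q < n \<Longrightarrow>
      A $$ (i * m + p, j * n + q) = B $$ (i * m + p, j * n + q)"
  shows "A = B"
proof (rule eq_matI)
  fix a b assume "a < dim_row B" "b < dim_col B"
  then have "a < k * m" "b < l * n" using assms by auto
  then show "A $$ (a, b) = B $$ (a, b)" by (elim block_cases) (simp add: assms(3))
qed (use assms in auto)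

lemma mat_mult_entry:
  assumes "A \<in> carrier_mat n k" "B \<in> carrier_mat k l" "i < n" "j < l"
  shows "(A * B) $$ (i, j) = (\<Sum>p<k. A $$ (i, p) * B $$ (p, j))"
  using assms by (simp add: scalar_prod_def atLeast0LessThan)

lemma kronecker_carrier:
  "A \<in> carrier_mat r c \<Longrightarrow> B \<in> carrier_mat r' c' \<Longrightarrow> A \<otimes>\<^sub>m B \<in> carrier_mat (r * r') (c * c')"
  by (auto simp: kronecker_def)

lemma kronecker_entry:
  assumes "A \<in> carrier_mat r c" "B \<in> carrier_mat r' c'" "i < r" "p < r'" "j < c" "q < c'"
  shows "(A \<otimes>\<^sub>m B) $$ (i * r' + p, j * c' + q) = A $$ (i, j) * B $$ (p, q)"
proof -
  note I = block_index[OF assms(3,4)] and J = block_index[OF assms(5,6)]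
  have "(A \<otimes>\<^sub>m B) $$ (i * r' + p, j * c' + q) =
    (case (i * r' + p, j * c' + q) of (i, j) \<Rightarrow> A $$ (i div r', j div c') * B $$ (i mod r', j mod c'))"
    unfolding kronecker_def carrier_matD[OF assms(1)] carrier_matD[OF assms(2)]
    by (rule index_mat(1)[OF I(1) J(1)])
  then show ?thesis by (simp only: I J prod.case)
qed

lemma column_carrier: "mat_of_cols n [c] \<in> carrier_mat n 1"
  using mat_of_cols_carrier(1)[of n "[c]"] by simp

lemma block_index_eq_iff:
  assumes "i < k" "p < (m::nat)" "j < l" "q < m"
  shows "i * m + p = j * m + q \<longleftrightarrow> i = j \<and> p = q"
proof
  assume e: "i * m + p = j * m + q"
  show "i = j \<and> p = q"
    using arg_cong[OF e, of "\<lambda>x. x div m"] arg_cong[OF e, of "\<lambda>x. x mod m"]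
    unfolding block_index(2,3)[OF assms(1,2)] block_index(2,3)[OF assms(3,4)] by simp
qed simp

lemma kronecker_mult:
  assumes A: "A \<in> carrier_mat r s" and B: "B \<in> carrier_mat r' s'"
    and C: "C \<in> carrier_mat s t" and D: "D \<in> carrier_mat s' t'"
  shows "(A \<otimes>\<^sub>m B) * (C \<otimes>\<^sub>m D) = (A * C) \<otimes>\<^sub>m (B * D)"
proof (rule block_eq_matI[of _ r r' t t'])
  note AB = kronecker_carrier[OF A B] and CD = kronecker_carrier[OF C D]
  show "(A \<otimes>\<^sub>m B) * (C \<otimes>\<^sub>m D) \<in> carrier_mat (r * r') (t * t')" using AB CD by auto
  show "(A * C) \<otimes>\<^sub>m (B * D) \<in> carrier_mat (r * r') (t * t')"
    using A B C D by (intro kronecker_carrier mult_carrier_mat)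
  fix i p j q assume i: "i < r" "p < r'" "j < t" "q < t'"
  have "((A \<otimes>\<^sub>m B) * (C \<otimes>\<^sub>m D)) $$ (i * r' + p, j * t' + q) =
    (\<Sum>k<s. \<Sum>l<s'. (A \<otimes>\<^sub>m B) $$ (i * r' + p, k * s' + l) * (C \<otimes>\<^sub>m D) $$ (k * s' + l, j * t' + q))"
    using i block_index by (subst mat_mult_entry[OF AB CD]) (auto simp: sum_blocks)
  also have "\<dots> = (\<Sum>k<s. \<Sum>l<s'. (A $$ (i, k) * C $$ (k, j)) * (B $$ (p, l) * D $$ (l, q)))"
    using i by (intro sum.cong refl) (simp add: kronecker_entry[OF A B] kronecker_entry[OF C D])
  also have "\<dots> = (A * C) $$ (i, j) * (B * D) $$ (p, q)"
    by (simp add: mat_mult_entry[OF A C i(1) i(3)] mat_mult_entry[OF B D i(2) i(4)] sum_product)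
  also have "\<dots> = ((A * C) \<otimes>\<^sub>m (B * D)) $$ (i * r' + p, j * t' + q)"
    using A B C D i by (intro kronecker_entry[symmetric] mult_carrier_mat)
  finally show "((A \<otimes>\<^sub>m B) * (C \<otimes>\<^sub>m D)) $$ (i * r' + p, j * t' + q) =
    ((A * C) \<otimes>\<^sub>m (B * D)) $$ (i * r' + p, j * t' + q)" .
qed

lemma kronecker_one: "1\<^sub>m k \<otimes>\<^sub>m (a \<cdot>\<^sub>m 1\<^sub>m m) = a \<cdot>\<^sub>m 1\<^sub>m (k * m)"
proof (rule block_eq_matI[of _ k m k m])
  fix i p j q assume i: "i < k" "p < m" "j < k" "q < m"
  show "(1\<^sub>m k \<otimes>\<^sub>m (a \<cdot>\<^sub>m 1\<^sub>m m)) $$ (i * m + p, j * m + q) = (a \<cdot>\<^sub>m 1\<^sub>m (k * m)) $$ (i * m + p, j * m + q)"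
    using i block_index[OF i(1,2)] block_index[OF i(3,4)]
    by (subst kronecker_entry[of _ k k _ m m]) (auto simp: block_index_eq_iff[OF i])
qed (simp_all add: kronecker_carrier)

lemma kronecker_one_one: "1\<^sub>m k \<otimes>\<^sub>m 1\<^sub>m m = 1\<^sub>m (k * m)"
proof -
  have "1 \<cdot>\<^sub>m 1\<^sub>m m = (1\<^sub>m m :: complex mat)" by (rule eq_matI) auto
  moreover have "1 \<cdot>\<^sub>m 1\<^sub>m (k * m) = (1\<^sub>m (k * m) :: complex mat)" by (rule eq_matI) auto
  ultimately show ?thesis using kronecker_one[of k 1 m] by simp
qed

lemma kronecker_add:
  assumes "A \<in> carrier_mat m m" "B \<in> carrier_mat m m"
  shows "1\<^sub>m k \<otimes>\<^sub>m (A + B) = 1\<^sub>m k \<otimes>\<^sub>m A + 1\<^sub>m k \<otimes>\<^sub>m B"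
proof (rule block_eq_matI[of _ k m k m])
  note c = kronecker_carrier[OF one_carrier_mat[of k] assms(1)] kronecker_carrier[OF one_carrier_mat[of k] assms(2)]
  show "1\<^sub>m k \<otimes>\<^sub>m A + 1\<^sub>m k \<otimes>\<^sub>m B \<in> carrier_mat (k * m) (k * m)" using c by simp
  show "1\<^sub>m k \<otimes>\<^sub>m (A + B) \<in> carrier_mat (k * m) (k * m)"
    using assms by (intro kronecker_carrier) auto
  fix i p j q assume i: "i < k" "p < m" "j < k" "q < m"
  then show "(1\<^sub>m k \<otimes>\<^sub>m (A + B)) $$ (i * m + p, j * m + q) = (1\<^sub>m k \<otimes>\<^sub>m A + 1\<^sub>m k \<otimes>\<^sub>m B) $$ (i * m + p, j * m + q)"
    using assms c block_index[OF i(1,2)] block_index[OF i(3,4)]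
    by (simp add: kronecker_entry[of _ k k _ m m] distrib_left)
qed

lemma kronecker_one_inject:
  assumes "A \<in> carrier_mat m m" "B \<in> carrier_mat m m" "0 < k" "1\<^sub>m k \<otimes>\<^sub>m A = 1\<^sub>m k \<otimes>\<^sub>m B"
  shows "A = B"
proof (rule eq_matI)
  fix i j assume "i < dim_row B" "j < dim_col B"
  then have "i < m" "j < m" using assms by auto
  then show "A $$ (i, j) = B $$ (i, j)"
    using assms kronecker_entry[of "1\<^sub>m k" k k A m m 0 i 0 j] kronecker_entry[of "1\<^sub>m k" k k B m m 0 i 0 j]
    by simp
qed (use assms in auto)

section \<open>Equivalent expressions have equal values\<close>

text \<open>Tensoring with an identity moves a tuple of level \<open>m\<close> to level \<open>k m\<close>. In this way tuples of
  two levels can be brought to the same level and joined by a line.\<close>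

lemma nc_expr_eval_ampliation:
  assumes X: "\<forall>j. X j \<in> carrier_mat m m"
  shows "nc_expr_eval m X e = Some E \<Longrightarrow>
    nc_expr_eval (k * m) (\<lambda>j. 1\<^sub>m k \<otimes>\<^sub>m X j) e = Some (1\<^sub>m k \<otimes>\<^sub>m E)"
proof (induction e arbitrary: E)
  case (NC_Add e1 e2)
  then obtain E1 E2 where E: "nc_expr_eval m X e1 = Some E1" "nc_expr_eval m X e2 = Some E2" "E = E1 + E2"
    by (auto simp: bind_eq_Some_conv)
  show ?case
    using NC_Add.IH E
      kronecker_add[OF nc_expr_eval_carrier[OF X E(1)] nc_expr_eval_carrier[OF X E(2)], of k] by simp
next
  case (NC_Mult e1 e2)
  then obtain E1 E2 where E: "nc_expr_eval m X e1 = Some E1" "nc_expr_eval m X e2 = Some E2" "E = E1 * E2"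
    by (auto simp: bind_eq_Some_conv)
  note c = nc_expr_eval_carrier[OF X E(1)] nc_expr_eval_carrier[OF X E(2)]
  show ?case
    using NC_Mult.IH E kronecker_mult[OF one_carrier_mat c(1) one_carrier_mat c(2), of k] by simp
next
  case (NC_Inv e)
  then obtain F where F: "nc_expr_eval m X e = Some F" "mat_inverse F = Some E"
    by (auto simp: bind_eq_Some_conv)
  note c = nc_expr_eval_carrier[OF X F(1)]
  from mat_inverse(2)[OF c F(2)] have E: "F * E = 1\<^sub>m m" "E \<in> carrier_mat m m" by auto
  have "(1\<^sub>m k \<otimes>\<^sub>m F) * (1\<^sub>m k \<otimes>\<^sub>m E) = 1\<^sub>m (k * m)"
    using kronecker_mult[OF one_carrier_mat c one_carrier_mat E(2), of k] E(1)
    by (simp add: kronecker_one_one)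
  from mat_inverse_eq_SomeI[OF kronecker_carrier[OF one_carrier_mat c] kronecker_carrier[OF one_carrier_mat E(2)] this]
  show ?case using NC_Inv.IH[OF F(1)] by simp
qed (simp_all add: kronecker_one)

text \<open>Equivalence is a condition on the common domain only, so the domains of \<open>e1\<close> and \<open>e2\<close> may
  meet that of \<open>e0\<close> in different places. Join an ampliation of \<open>X\<close> with an ampliation of a point
  in the domain of \<open>e0\<close>: off finitely many parameters all three expressions are defined on this
  line, where \<open>e1\<close> and \<open>e2\<close> agree with \<open>e0\<close>. Two rational functions of the parameter which agree
  at infinitely many places agree at the endpoint.\<close>

lemma nc_expr_equiv_eval_eq:
  fixes e0 e1 e2 :: "'d nc_expr"
  assumes 1: "(e0, e1) \<in> nc_expr_equiv" and 2: "(e0, e2) \<in> nc_expr_equiv"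
    and X: "(m, X) \<in> mat_tuples"
    and E1: "nc_expr_eval m X e1 = Some E1" and E2: "nc_expr_eval m X e2 = Some E2"
  shows "E1 = E2"
proof -
  obtain m0 Y E0 where Y: "(m0, Y) \<in> mat_tuples" and E0: "nc_expr_eval m0 Y e0 = Some E0"
    using 1 unfolding nc_expr_equiv_def nc_expr_dom_def by auto
  have mX: "0 < m" "\<forall>j. X j \<in> carrier_mat m m" and mY: "0 < m0" "\<forall>j. Y j \<in> carrier_mat m0 m0"
    using X Y by (auto simp: mat_tuples_def)
  define n where "n = m0 * m"
  define X' where "X' = (\<lambda>j. 1\<^sub>m m0 \<otimes>\<^sub>m X j)"
  define Y' where "Y' = (\<lambda>j. 1\<^sub>m m \<otimes>\<^sub>m Y j)"
  have X'c: "\<forall>j. X' j \<in> carrier_mat n n"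
    unfolding X'_def n_def using mX by (intro allI kronecker_carrier) auto
  have Y'c: "\<forall>j. Y' j \<in> carrier_mat n n"
    unfolding Y'_def n_def mult.commute[of m0 m] using mY by (intro allI kronecker_carrier) auto
  define ev where "ev = (\<lambda>e t. nc_expr_eval n (mat_line n X' Y' t) e)"
  have ev0: "ev e1 0 = Some (1\<^sub>m m0 \<otimes>\<^sub>m E1)" "ev e2 0 = Some (1\<^sub>m m0 \<otimes>\<^sub>m E2)"
    using nc_expr_eval_ampliation[OF mX(2) E1, of m0] nc_expr_eval_ampliation[OF mX(2) E2, of m0]
    unfolding ev_def mat_line_0[OF X'c] by (simp_all add: n_def X'_def)
  have ev1: "ev e0 1 = Some (1\<^sub>m m \<otimes>\<^sub>m E0)"
    using nc_expr_eval_ampliation[OF mY(2) E0, of m]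
    unfolding ev_def mat_line_1[OF Y'c] by (simp add: n_def Y'_def mult.commute[of m0 m])
  have fin: "finite {t. ev e t = None}" if "ev e t \<noteq> None" for e t
    using nc_expr_eval_line[of n X' Y' e] that unfolding ev_def by blast
  have fin: "finite {t. ev e0 t = None}" "finite {t. ev e1 t = None}" "finite {t. ev e2 t = None}"
    using fin[of e0 1] fin[of e1 0] fin[of e2 0] ev0 ev1 by auto
  have dom: "(n, mat_line n X' Y' t) \<in> mat_tuples" for t
    using mX mY by (auto simp: mat_tuples_def mat_line_carrier n_def)
  have same: "ev e1 t = ev e2 t" if "ev e0 t \<noteq> None" "ev e1 t \<noteq> None" "ev e2 t \<noteq> None" for t
  proof -
    have "ev e0 t = ev e1 t" "ev e0 t = ev e2 t"
      using 1 2 that dom[of t] unfolding nc_expr_equiv_def nc_expr_dom_def ev_def by fastforce+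
    then show ?thesis by simp
  qed
  obtain P1 q1 where P1: "P1 \<in> carrier_mat n n"
    and e1: "\<And>t E. ev e1 t = Some E \<Longrightarrow> poly q1 t \<noteq> 0 \<and> map_mat (\<lambda>p. poly p t) P1 = poly q1 t \<cdot>\<^sub>m E"
    using nc_expr_eval_line[of n X' Y' e1] unfolding ev_def by blast
  obtain P2 q2 where P2: "P2 \<in> carrier_mat n n"
    and e2: "\<And>t E. ev e2 t = Some E \<Longrightarrow> poly q2 t \<noteq> 0 \<and> map_mat (\<lambda>p. poly p t) P2 = poly q2 t \<cdot>\<^sub>m E"
    using nc_expr_eval_line[of n X' Y' e2] unfolding ev_def by blast
  have c: "E \<in> carrier_mat n n" if "ev e t = Some E" for e t E
    using that nc_expr_eval_carrier[OF allI[OF mat_line_carrier]] by (auto simp: ev_def)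
  have en1: "poly (P1 $$ (i, j)) t = poly q1 t * E $$ (i, j)" if "ev e1 t = Some E" "i < n" "j < n" for t E i j
    using e1[OF that(1)] c[OF that(1)] P1 that by (auto simp: mat_eq_iff)
  have en2: "poly (P2 $$ (i, j)) t = poly q2 t * E $$ (i, j)" if "ev e2 t = Some E" "i < n" "j < n" for t E i j
    using e2[OF that(1)] c[OF that(1)] P2 that by (auto simp: mat_eq_iff)
  have "1\<^sub>m m0 \<otimes>\<^sub>m E1 = 1\<^sub>m m0 \<otimes>\<^sub>m E2"
  proof (rule eq_matI)
    fix i j assume "i < dim_row (1\<^sub>m m0 \<otimes>\<^sub>m E2)" "j < dim_col (1\<^sub>m m0 \<otimes>\<^sub>m E2)"
    then have ij: "i < n" "j < n" using c[OF ev0(2)] by auto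
    let ?p = "P1 $$ (i, j) * q2 - P2 $$ (i, j) * q1"
    have "- ({t. ev e0 t = None} \<union> {t. ev e1 t = None} \<union> {t. ev e2 t = None}) \<subseteq> {t. poly ?p t = 0}"
    proof
      fix t assume t: "t \<in> - ({t. ev e0 t = None} \<union> {t. ev e1 t = None} \<union> {t. ev e2 t = None})"
      then obtain E where "ev e1 t = Some E" by auto
      moreover with same[of t] t have "ev e2 t = Some E" by auto
      ultimately show "t \<in> {t. poly ?p t = 0}" using ij by (simp add: en1 en2)
    qed
    moreover have "infinite (- ({t. ev e0 t = None} \<union> {t. ev e1 t = None} \<union> {t. ev e2 t = None}))"
      using fin infinite_UNIV_char_0[where 'a = complex] by (metis Compl_eq_Diff_UNIV Diff_infinite_finite finite_UnI)
    ultimately have "?p = 0" using poly_roots_finite finite_subset by metis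
    then have "poly ?p 0 = 0" by simp
    then show "(1\<^sub>m m0 \<otimes>\<^sub>m E1) $$ (i, j) = (1\<^sub>m m0 \<otimes>\<^sub>m E2) $$ (i, j)"
      using en1[OF ev0(1) ij] en2[OF ev0(2) ij] e1[OF ev0(1)] e2[OF ev0(2)] by simp
  qed (simp_all only: carrier_matD[OF c[OF ev0(1)]] carrier_matD[OF c[OF ev0(2)]])
  then show ?thesis
    using kronecker_one_inject nc_expr_eval_carrier[OF mX(2)] E1 E2 mY(1) by blast
qed

lemma nc_value_unique:
  assumes "\<rr> \<in> nc_rational_functions" "(m, X) \<in> mat_tuples" "nc_value \<rr> m X M" "nc_value \<rr> m X M'"
  shows "M = M'"
proof -
  obtain e0 where "\<rr> = nc_expr_equiv `` {e0}"
    using assms(1) by (auto simp: nc_rational_functions_def elim: quotientE)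
  then show ?thesis
    using assms nc_expr_equiv_eval_eq[of e0] unfolding nc_value_def by blast
qed

section \<open>Coefficients of a realization\<close>

lemma linear_pencil_carrier:
  "linear_pencil n A m X \<in> carrier_mat (n * m) (n * m)"
  by (auto simp: linear_pencil_def kronecker_def)

lemma linear_pencil_entry:
  fixes A X :: "'d::finite \<Rightarrow> complex mat"
  assumes "\<forall>j. A j \<in> carrier_mat n n" "\<forall>j. X j \<in> carrier_mat m m" "i < n" "p < m" "j < n" "q < m"
  shows "linear_pencil n A m X $$ (i * m + p, j * m + q) =
    (if i = j \<and> p = q then 1 else 0) - (\<Sum>k\<in>UNIV. A k $$ (i, j) * X k $$ (p, q))"
  using assms block_index[of i n p m] block_index[of j n q m]
  by (simp add: linear_pencil_def kronecker_one_one kronecker_entry[of _ n n _ m m]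
      block_index_eq_iff[of i n p m j n q])

text \<open>Inverses of pencils are never computed: it is enough to guess a solution \<open>V\<close> of the linear
  system.\<close>

lemma realization_value:
  assumes K: "mat_inverse (linear_pencil n A m X) = Some K"
    and b: "b \<in> carrier_vec n" and c: "c \<in> carrier_vec n"
    and V: "V \<in> carrier_mat (n * m) m"
    and PV: "linear_pencil n A m X * V = mat_of_cols n [c] \<otimes>\<^sub>m 1\<^sub>m m"
  shows "(mat_adjoint (mat_of_cols n [b]) \<otimes>\<^sub>m 1\<^sub>m m) * K * (mat_of_cols n [c] \<otimes>\<^sub>m 1\<^sub>m m) =
    mat m m (\<lambda>(p, q). \<Sum>i<n. cnj (b $ i) * V $$ (i * m + p, q))"
proof -
  let ?P = "linear_pencil n A m X" and ?B = "mat_adjoint (mat_of_cols n [b]) \<otimes>\<^sub>m 1\<^sub>m m"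
  let ?C = "mat_of_cols n [c] \<otimes>\<^sub>m 1\<^sub>m m"
  have P: "?P \<in> carrier_mat (n * m) (n * m)" by (rule linear_pencil_carrier)
  from mat_inverse(2)[OF P K] have KP: "K * ?P = 1\<^sub>m (n * m)" "K \<in> carrier_mat (n * m) (n * m)" by auto
  have Bc: "mat_adjoint (mat_of_cols n [b]) \<in> carrier_mat 1 n"
    using mat_of_rows_carrier(1)[of n "map conjugate (cols (mat_of_cols n [b]))"]
    by (simp add: mat_adjoint_def)
  have Be: "mat_adjoint (mat_of_cols n [b]) $$ (0, i) = cnj (b $ i)" if "i < n" for i
    using that b by (simp add: mat_adjoint_def mat_of_rows_def cols_def mat_of_cols_def)
  have B: "?B \<in> carrier_mat m (n * m)" using kronecker_carrier[OF Bc one_carrier_mat[of m]] by simp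
  have C: "?C \<in> carrier_mat (n * m) m"
    using kronecker_carrier[OF column_carrier one_carrier_mat[of m]] by simp
  have "?B * K * ?C = ?B * (K * ?C)" by (rule assoc_mult_mat[OF B KP(2) C])
  also have "K * ?C = V"
    unfolding PV[symmetric] using assoc_mult_mat[OF KP(2) P V] KP V by simp
  finally have *: "?B * K * ?C = ?B * V" .
  show ?thesis unfolding *
  proof (rule eq_matI)
    fix p q assume "p < dim_row (mat m m (\<lambda>(p, q). \<Sum>i<n. cnj (b $ i) * V $$ (i * m + p, q)))"
      "q < dim_col (mat m m (\<lambda>(p, q). \<Sum>i<n. cnj (b $ i) * V $$ (i * m + p, q)))"
    then have pq: "p < m" "q < m" by auto
    have "(?B * V) $$ (p, q) = (\<Sum>i<n. \<Sum>l<m. ?B $$ (0 * m + p, i * m + l) * V $$ (i * m + l, q))"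
      by (simp add: mat_mult_entry[OF B V pq] sum_blocks)
    also have "\<dots> = (\<Sum>i<n. \<Sum>l<m. if l = p then cnj (b $ i) * V $$ (i * m + l, q) else 0)"
      using pq by (intro sum.cong refl)
        (subst kronecker_entry[OF Bc one_carrier_mat], auto simp: Be)
    finally show "(?B * V) $$ (p, q) = mat m m (\<lambda>(p, q). \<Sum>i<n. cnj (b $ i) * V $$ (i * m + p, q)) $$ (p, q)"
      using pq by simp
  qed (simp_all add: carrier_matD[OF B] carrier_matD[OF V])
qed

lemma mat_word_carrier: "\<forall>j. A j \<in> carrier_mat n n \<Longrightarrow> mat_word n A \<alpha> \<in> carrier_mat n n"
proof (induction \<alpha>)
  case (Cons k \<alpha>)
  then have "A k \<in> carrier_mat n n" "mat_word n A \<alpha> \<in> carrier_mat n n" by auto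
  then show ?case by (simp add: mat_word_def mult_carrier_mat)
qed (simp add: mat_word_def)

lemma mat_word_Cons: "mat_word n A (k # \<alpha>) = A k * mat_word n A \<alpha>"
  by (simp add: mat_word_def)

text \<open>The shift along the word \<open>\<omega>\<close>: among all words \<open>\<alpha>\<close>, only \<open>\<alpha> = \<omega>\<close> gives a product with a
  nonzero entry at \<open>(0, length \<omega>)\<close>. Evaluating a power series at this nilpotent tuple puts its
  coefficient at \<open>\<omega>\<close> into that corner.\<close>

definition path_tuple :: "'d list \<Rightarrow> 'd \<Rightarrow> complex mat" where
  "path_tuple \<omega> j = mat (Suc (length \<omega>)) (Suc (length \<omega>))
    (\<lambda>(p, q). if p < length \<omega> \<and> q = Suc p \<and> \<omega> ! p = j then 1 else 0)"

text \<open>In blocks indexed by the positions \<open>p\<close> of the word, the pencil is upper bidiagonal with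
  identities on the diagonal. Solving from the last block backwards multiplies by one letter of
  \<open>A\<close> at each step and runs through the states of the suffixes of \<open>\<omega>\<close>.\<close>

lemma path_pencil_solution:
  fixes A :: "'d::finite \<Rightarrow> complex mat"
  assumes A: "\<forall>j. A j \<in> carrier_mat n n" and m: "m = Suc (length \<omega>)"
    and v: "v \<in> carrier_vec (n * m)" and c: "c \<in> carrier_vec n"
    and eq: "\<And>i p. i < n \<Longrightarrow> p < m \<Longrightarrow>
      (linear_pencil n A m (path_tuple \<omega>) *\<^sub>v v) $ (i * m + p) = (if p = length \<omega> then c $ i else 0)"
  shows "p < m \<Longrightarrow> vec n (\<lambda>i. v $ (i * m + p)) = mat_word n A (drop p \<omega>) *\<^sub>v c"
proof -
  have X: "\<forall>j. path_tuple \<omega> j \<in> carrier_mat m m" by (simp add: path_tuple_def m)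
  note P = linear_pencil_carrier[of n A m "path_tuple \<omega>"]
  have rec: "v $ (i * m + p) - (\<Sum>j<n. if p < length \<omega> then A (\<omega> ! p) $$ (i, j) * v $ (j * m + Suc p) else 0) =
      (if p = length \<omega> then c $ i else 0)" if i: "i < n" and p: "p < m" for i p
  proof -
    have inner: "(\<Sum>q<m. linear_pencil n A m (path_tuple \<omega>) $$ (i * m + p, j * m + q) * v $ (j * m + q)) =
      (if i = j then v $ (j * m + p) else 0) -
      (if p < length \<omega> then A (\<omega> ! p) $$ (i, j) * v $ (j * m + Suc p) else 0)" if j: "j < n" for j
    proof -
      have Sm: "(\<Sum>k\<in>UNIV. A k $$ (i, j) * path_tuple \<omega> k $$ (p, q)) =
          (if p < length \<omega> \<and> q = Suc p then A (\<omega> ! p) $$ (i, j) else 0)" if "q < m" for q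
      proof (cases "p < length \<omega> \<and> q = Suc p")
        case True
        then have "path_tuple \<omega> k $$ (p, q) = (if k = \<omega> ! p then 1 else 0)" for k
          using that p by (auto simp: path_tuple_def m)
        then show ?thesis using True by (simp add: if_distrib[of "\<lambda>x. _ * x"] cong: if_cong)
      next
        case False
        then have "path_tuple \<omega> k $$ (p, q) = 0" for k
          using that p by (auto simp: path_tuple_def m)
        then show ?thesis using False by auto
      qed
      have "(\<Sum>q<m. linear_pencil n A m (path_tuple \<omega>) $$ (i * m + p, j * m + q) * v $ (j * m + q)) =
        (\<Sum>q<m. (if q = p then (if i = j then v $ (j * m + p) else 0) else 0) -
          (if q = Suc p then (if p < length \<omega> then A (\<omega> ! p) $$ (i, j) * v $ (j * m + Suc p) else 0) else 0))"
      proof (intro sum.cong refl)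
        fix q assume "q \<in> {..<m}"
        then have q: "q < m" by simp
        show "linear_pencil n A m (path_tuple \<omega>) $$ (i * m + p, j * m + q) * v $ (j * m + q) =
          (if q = p then (if i = j then v $ (j * m + p) else 0) else 0) -
          (if q = Suc p then (if p < length \<omega> then A (\<omega> ! p) $$ (i, j) * v $ (j * m + Suc p) else 0) else 0)"
          unfolding linear_pencil_entry[OF A X i p j q] Sm[OF q] by auto
      qed
      then show ?thesis using p by (simp add: sum_subtractf m)
    qed
    have "(linear_pencil n A m (path_tuple \<omega>) *\<^sub>v v) $ (i * m + p) =
        (\<Sum>j<n. \<Sum>q<m. linear_pencil n A m (path_tuple \<omega>) $$ (i * m + p, j * m + q) * v $ (j * m + q))"
      using P v block_index[OF i p] by (simp add: scalar_prod_def atLeast0LessThan sum_blocks)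
    also have "\<dots> = v $ (i * m + p) -
        (\<Sum>j<n. if p < length \<omega> then A (\<omega> ! p) $$ (i, j) * v $ (j * m + Suc p) else 0)"
      using i by (simp add: inner sum_subtractf)
    finally show ?thesis using eq[OF i p] by simp
  qed
  show "vec n (\<lambda>i. v $ (i * m + p)) = mat_word n A (drop p \<omega>) *\<^sub>v c" if "p < m" for p
    using that
  proof (induction "length \<omega> - p" arbitrary: p)
    case 0
    then have p: "p = length \<omega>" using m by simp
    have "vec n (\<lambda>i. v $ (i * m + p)) = c"
      using rec[of _ p] 0 p c by (intro eq_vecI) auto
    then show ?case using p c by (simp add: mat_word_def)
  next
    case (Suc k)
    then have p: "p < length \<omega>" by simp
    then have IH: "vec n (\<lambda>i. v $ (i * m + Suc p)) = mat_word n A (drop (Suc p) \<omega>) *\<^sub>v c"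
      using Suc.hyps(1)[of "Suc p"] Suc.hyps(2) m by simp
    have "vec n (\<lambda>i. v $ (i * m + p)) = A (\<omega> ! p) *\<^sub>v vec n (\<lambda>i. v $ (i * m + Suc p))"
    proof (rule eq_vecI)
      have B: "A (\<omega> ! p) \<in> carrier_mat n n" using A by blast
      fix i assume "i < dim_vec (A (\<omega> ! p) *\<^sub>v vec n (\<lambda>i. v $ (i * m + Suc p)))"
      then have i: "i < n" using B by simp
      show "vec n (\<lambda>i. v $ (i * m + p)) $ i = (A (\<omega> ! p) *\<^sub>v vec n (\<lambda>i. v $ (i * m + Suc p))) $ i"
        using rec[OF i, of p] Suc.prems p i B by (simp add: scalar_prod_def atLeast0LessThan)
    qed (use carrier_matD(1)[OF A[rule_format, of "\<omega> ! p"]] in simp)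
    also have "\<dots> = mat_word n A (drop p \<omega>) *\<^sub>v c"
      unfolding IH Cons_nth_drop_Suc[OF p, symmetric] mat_word_Cons
      by (rule assoc_mult_mat_vec[OF A[rule_format] mat_word_carrier[OF A] c, symmetric])
    finally show ?case .
  qed
qed

text \<open>For the right-hand side zero the backward recursion starts with zero.\<close>

lemma path_pencil_invertible:
  fixes A :: "'d::finite \<Rightarrow> complex mat"
  assumes A: "\<forall>j. A j \<in> carrier_mat n n" and m: "m = Suc (length \<omega>)"
  obtains K where "mat_inverse (linear_pencil n A m (path_tuple \<omega>)) = Some K"
proof (rule mat_inverse_if_injective[OF linear_pencil_carrier])
  fix v assume v: "v \<in> carrier_vec (n * m)" and 0: "linear_pencil n A m (path_tuple \<omega>) *\<^sub>v v = 0\<^sub>v (n * m)"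
  have "vec n (\<lambda>i. v $ (i * m + p)) = mat_word n A (drop p \<omega>) *\<^sub>v 0\<^sub>v n" if "p < m" for p
    using that block_index[of _ n _ m] by (intro path_pencil_solution[OF A m v]) (auto simp: 0)
  moreover have "mat_word n A (drop p \<omega>) *\<^sub>v 0\<^sub>v n = 0\<^sub>v n" for p
    using mat_word_carrier[OF A, of "drop p \<omega>"] by auto
  ultimately have "v $ (i * m + p) = 0" if "i < n" "p < m" for i p
    using that by (metis index_vec index_zero_vec(1))
  then show "v = 0\<^sub>v (n * m)"
    using v by (intro eq_vecI) (auto elim!: block_cases)
qed (use that in blast)

lemma realization_value_path:
  fixes A :: "'d::finite \<Rightarrow> complex mat"
  assumes A: "\<forall>j. A j \<in> carrier_mat n n" and b: "b \<in> carrier_vec n" and c: "c \<in> carrier_vec n"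
    and m: "m = Suc (length \<omega>)" and K: "mat_inverse (linear_pencil n A m (path_tuple \<omega>)) = Some K"
  shows "((mat_adjoint (mat_of_cols n [b]) \<otimes>\<^sub>m 1\<^sub>m m) * K * (mat_of_cols n [c] \<otimes>\<^sub>m 1\<^sub>m m)) $$ (0, length \<omega>) =
    (mat_word n A \<omega> *\<^sub>v c) \<bullet>c b"
proof -
  let ?P = "linear_pencil n A m (path_tuple \<omega>)" and ?C = "mat_of_cols n [c] \<otimes>\<^sub>m 1\<^sub>m m"
  have P: "?P \<in> carrier_mat (n * m) (n * m)" by (rule linear_pencil_carrier)
  from mat_inverse(2)[OF P K] have PK: "?P * K = 1\<^sub>m (n * m)" and Kc: "K \<in> carrier_mat (n * m) (n * m)" by auto
  have C: "?C \<in> carrier_mat (n * m) m"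
    using kronecker_carrier[OF column_carrier one_carrier_mat[of m]] by simp
  define V where "V = K * ?C"
  have V: "V \<in> carrier_mat (n * m) m" using Kc C by (simp add: V_def)
  have PV: "?P * V = ?C"
    using assoc_mult_mat[OF P Kc C] PK C by (simp add: V_def)
  have l: "length \<omega> < m" by (simp add: m)
  have state: "vec n (\<lambda>i. col V (length \<omega>) $ (i * m + 0)) = mat_word n A (drop 0 \<omega>) *\<^sub>v c"
  proof (rule path_pencil_solution[OF A m _ c])
    show "col V (length \<omega>) \<in> carrier_vec (n * m)" by (rule carrier_vecI) (use V in simp)
    fix i p assume ip: "i < n" "p < m"
    have "(?P *\<^sub>v col V (length \<omega>)) $ (i * m + p) = (?P * V) $$ (i * m + p, length \<omega>)"
      using P V l block_index[OF ip] by simp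
    also have "\<dots> = (if p = length \<omega> then c $ i else 0)"
    proof -
      have "mat_of_cols n [c] $$ (i, 0) = c $ i" using ip by (simp add: mat_of_cols_def)
      then show ?thesis
        using kronecker_entry[OF column_carrier one_carrier_mat, of i n p m 0 "length \<omega>" c] ip l
        by (simp add: PV)
    qed
    finally show "(?P *\<^sub>v col V (length \<omega>)) $ (i * m + p) = (if p = length \<omega> then c $ i else 0)" .
  qed (use m in auto)
  have "V $$ (i * m, length \<omega>) = (mat_word n A \<omega> *\<^sub>v c) $ i" if "i < n" for i
  proof -
    have "i * m < n * m" using that m by (intro mult_strict_right_mono) simp_all
    then show ?thesis
      using arg_cong[OF state, of "\<lambda>x. x $ i"] that V l by (simp del: index_mult_mat_vec)
  qed
  then show ?thesis
    unfolding realization_value[OF K b c V PV]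
    using b c l m mat_word_carrier[OF A] by (simp add: scalar_prod_def atLeast0LessThan mult.commute)
qed

text \<open>Both formulas describe the value of the same function at the path tuple of \<open>\<omega>\<close>, where the
  corner entry is the coefficient.\<close>

lemma nc_realization_coeffs_unique:
  assumes \<rr>: "\<rr> \<in> nc_rational_functions"
    and 1: "nc_realization \<rr> n A b c" and 2: "nc_realization \<rr> n' A' b' c'"
  shows "(mat_word n A \<omega> *\<^sub>v c) \<bullet>c b = (mat_word n' A' \<omega> *\<^sub>v c') \<bullet>c b'"
proof -
  define m where "m = Suc (length \<omega>)"
  have t: "(m, path_tuple \<omega>) \<in> mat_tuples" by (simp add: mat_tuples_def path_tuple_def m_def)
  have A: "\<forall>j. A j \<in> carrier_mat n n" "b \<in> carrier_vec n" "c \<in> carrier_vec n"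
    and A': "\<forall>j. A' j \<in> carrier_mat n' n'" "b' \<in> carrier_vec n'" "c' \<in> carrier_vec n'"
    using 1 2 by (auto simp: nc_realization_def)
  obtain K where K: "mat_inverse (linear_pencil n A m (path_tuple \<omega>)) = Some K"
    using path_pencil_invertible[OF A(1) m_def] .
  obtain K' where K': "mat_inverse (linear_pencil n' A' m (path_tuple \<omega>)) = Some K'"
    using path_pencil_invertible[OF A'(1) m_def] .
  have "(mat_adjoint (mat_of_cols n [b]) \<otimes>\<^sub>m 1\<^sub>m m) * K * (mat_of_cols n [c] \<otimes>\<^sub>m 1\<^sub>m m) =
    (mat_adjoint (mat_of_cols n' [b']) \<otimes>\<^sub>m 1\<^sub>m m) * K' * (mat_of_cols n' [c'] \<otimes>\<^sub>m 1\<^sub>m m)"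
    using 1 2 K K' t by (intro nc_value_unique[OF \<rr> t]) (auto simp: nc_realization_def)
  then show ?thesis
    using realization_value_path[OF A m_def K] realization_value_path[OF A' m_def K'] by simp
qed

section \<open>Linear dependence in finite-dimensional spaces\<close>

lemma ell2_nth_sum: "ell2_nth (\<Sum>i\<in>F. g i) j = (\<Sum>i\<in>F. ell2_nth (g i) j)"
  by (induction F rule: infinite_finite_induct) (simp_all add: zero_ell2.rep_eq plus_ell2.rep_eq)

lemma cspan_image_lessThan:
  assumes "v \<in> cspan (x ` {..<k::nat})"
  shows "\<exists>a. v = (\<Sum>i<k. a i *\<^sub>C x i)"
  using assms
proof (induction k arbitrary: v)
  case (Suc k)
  then have "v \<in> cspan (insert (x k) (x ` {..<k}))" by (simp add: lessThan_Suc)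
  then obtain t where "v - t *\<^sub>C x k \<in> cspan (x ` {..<k})" using ell2.span_breakdown_eq by blast
  then obtain a where "v - t *\<^sub>C x k = (\<Sum>i<k. a i *\<^sub>C x i)" using Suc.IH by blast
  then have "v = (\<Sum>i<Suc k. (a(k := t)) i *\<^sub>C x i)" by (simp add: algebra_simps)
  then show ?case by blast
qed simp

text \<open>Otherwise every \<open>x k\<close> would be new, and the first \<open>card S + 1\<close> of them would be
  independent.\<close>

lemma finite_dimensional_sequence_dependent:
  fixes x :: "nat \<Rightarrow> 'a ell2"
  assumes fin: "finite S" and x: "\<And>k. x k \<in> cspan S"
  obtains k a where "x k = (\<Sum>i<k. a i *\<^sub>C x i)"
proof -
  have "\<exists>k. x k \<in> cspan (x ` {..<k})"
  proof (rule ccontr)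
    assume "\<nexists>k. x k \<in> cspan (x ` {..<k})"
    then have new: "x k \<notin> cspan (x ` {..<k})" for k by blast
    have "ell2.independent (x ` {..<k}) \<and> card (x ` {..<k}) = k" for k
    proof (induction k)
      case (Suc k)
      have "x k \<notin> x ` {..<k}" using new[of k] ell2.span_base[of "x k"] by metis
      with Suc new[of k] show ?case
        by (simp add: lessThan_Suc ell2.independent_insert)
    qed (simp add: ell2.independent_empty)
    moreover have "x ` {..<Suc (card S)} \<subseteq> cspan S" using x by auto
    ultimately show False
      using ell2.independent_span_bound[OF fin, of "x ` {..<Suc (card S)}"] by simp
  qed
  then obtain k where "x k \<in> cspan (x ` {..<k})" ..
  from cspan_image_lessThan[OF this] show thesis using that by blast
qed

section \<open>The inverse of a matrix is a polynomial in the matrix\<close>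

text \<open>The polynomials in \<open>P\<close>, built by the Horner scheme.\<close>

inductive mat_polynomial :: "nat \<Rightarrow> complex mat \<Rightarrow> complex mat \<Rightarrow> bool" for n P where
  zero: "mat_polynomial n P (0\<^sub>m n n)"
| horner: "mat_polynomial n P Q \<Longrightarrow> mat_polynomial n P (P * Q + a \<cdot>\<^sub>m 1\<^sub>m n)"

primrec msum :: "nat \<Rightarrow> (nat \<Rightarrow> complex mat) \<Rightarrow> nat \<Rightarrow> complex mat" where
  "msum m F 0 = 0\<^sub>m m m"
| "msum m F (Suc k) = msum m F k + F k"

lemma msum_carrier: "(\<And>i. i < k \<Longrightarrow> F i \<in> carrier_mat m m) \<Longrightarrow> msum m F k \<in> carrier_mat m m"
  by (induction k) (simp_all add: add_carrier_mat)

lemma msum_entry: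
  assumes "\<And>i. i < k \<Longrightarrow> F i \<in> carrier_mat m m" "p < m" "q < m"
  shows "msum m F k $$ (p, q) = (\<Sum>i<k. F i $$ (p, q))"
  using assms(1)
proof (induction k)
  case (Suc k)
  then have "F k \<in> carrier_mat m m" "msum m F k \<in> carrier_mat m m" by (auto intro: msum_carrier)
  then show ?case using Suc assms(2,3) by (simp add: carrier_matD[OF \<open>F k \<in> carrier_mat m m\<close>])
qed (use assms in simp)

text \<open>The powers of \<open>Q = P\<^sup>-\<^sup>1\<close> are dependent, say \<open>Q\<^sup>k = (\<Sum>i<k. a\<^sub>i Q\<^sup>i)\<close>. Multiplied by \<open>P\<^sup>k\<close>,
  this exhibits the identity as \<open>P\<close> times the polynomial with coefficients \<open>a\<^sub>i\<close>. Its partial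
  Horner steps \<open>H\<close> satisfy \<open>P H = P\<^sup>j (\<Sum>i<j. a\<^sub>i Q\<^sup>i)\<close>, which is the induction below.\<close>

lemma mat_polynomial_inverse:
  assumes P: "P \<in> carrier_mat n n" and Q: "Q \<in> carrier_mat n n" and PQ: "P * Q = 1\<^sub>m n"
  shows "mat_polynomial n P Q"
proof -
  have QP: "Q * P = 1\<^sub>m n" by (rule mat_mult_left_right_inverse[OF P Q PQ])
  define R where "R k = ((\<lambda>M. Q * M) ^^ k) (1\<^sub>m n)" for k
  define L where "L k = (\<lambda>M. P * M) ^^ k" for k
  have R: "R k \<in> carrier_mat n n" for k
    unfolding R_def by (induction k) (use Q in auto)
  have L: "L k M \<in> carrier_mat n n" if "M \<in> carrier_mat n n" for k M
    unfolding L_def by (induction k) (use P that in auto)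
  have Ladd: "L k (M + M') = L k M + L k M'" if "M \<in> carrier_mat n n" "M' \<in> carrier_mat n n" for k M M'
    using mult_add_distrib_mat[OF P L L] that by (induction k) (simp_all add: L_def)
  have Lsmult: "L k (a \<cdot>\<^sub>m M) = a \<cdot>\<^sub>m L k M" if "M \<in> carrier_mat n n" for k M a
    using mult_smult_distrib[OF P L] that by (induction k) (simp_all add: L_def)
  have LR: "L k (R k) = 1\<^sub>m n" for k
  proof (induction k)
    case (Suc k)
    have "P * (Q * R k) = R k"
      using assoc_mult_mat[OF P Q R] PQ R by (metis left_mult_one_mat)
    then show ?case using Suc by (simp add: L_def R_def funpow_swap1)
  qed (simp add: L_def R_def)
  \<comment> \<open>Matrices are read as square-summable families, so that the dimension count for such families
    applies.\<close>
  define emb where "emb M = (\<Sum>ij\<in>{..<n} \<times> {..<n}. M $$ ij *\<^sub>C ell2_unit ij)" for M :: "complex mat"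
  have nth_emb: "ell2_nth (emb M) (i, j) = M $$ (i, j)" if "i < n" "j < n" for M i j
  proof -
    have "ell2_nth (emb M) (i, j) = (\<Sum>ij\<in>{..<n} \<times> {..<n}. if ij = (i, j) then M $$ ij else 0)"
      unfolding emb_def ell2_nth_sum by (intro sum.cong) (auto simp: scaleC.rep_eq ell2_unit.rep_eq)
    then show ?thesis using that by simp
  qed
  have "emb M \<in> cspan (ell2_unit ` ({..<n} \<times> {..<n}))" for M
    unfolding emb_def by (intro ell2.span_sum ell2.span_scale ell2.span_base) auto
  then obtain k a where k: "emb (R k) = (\<Sum>i<k. a i *\<^sub>C emb (R i))"
    by (rule finite_dimensional_sequence_dependent[of "ell2_unit ` ({..<n} \<times> {..<n})" "\<lambda>i. emb (R i)", rotated]) auto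
  define S where "S j = msum n (\<lambda>i. a i \<cdot>\<^sub>m R i) j" for j
  have S: "S j \<in> carrier_mat n n" for j unfolding S_def using R by (intro msum_carrier) auto
  have Sk: "S k = R k"
  proof (rule eq_matI)
    fix i j assume "i < dim_row (R k)" "j < dim_col (R k)"
    then have ij: "i < n" "j < n" using R[of k] by auto
    have "S k $$ (i, j) = (\<Sum>l<k. a l * R l $$ (i, j))"
      unfolding S_def using R ij by (subst msum_entry) (auto intro!: sum.cong simp: carrier_matD[OF R])
    also have "\<dots> = R k $$ (i, j)"
      using arg_cong[OF k, of "\<lambda>x. ell2_nth x (i, j)"] ij
      by (simp add: nth_emb ell2_nth_sum scaleC.rep_eq)
    finally show "S k $$ (i, j) = R k $$ (i, j)" .
  qed (use R[of k] S[of k] in auto)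
  have "\<exists>H. H \<in> carrier_mat n n \<and> mat_polynomial n P H \<and> P * H = L j (S j)" for j
  proof (induction j)
    case 0
    show ?case
      using P by (intro exI[of _ "0\<^sub>m n n"]) (auto simp: S_def L_def intro: zero)
  next
    case (Suc j)
    then obtain H where H: "H \<in> carrier_mat n n" "mat_polynomial n P H" "P * H = L j (S j)" by blast
    have PLc: "P * L j (S j) \<in> carrier_mat n n" using P L[OF S] by auto
    have "P * (P * H + a j \<cdot>\<^sub>m 1\<^sub>m n) = P * (P * H) + P * (a j \<cdot>\<^sub>m 1\<^sub>m n)"
      using P H(1) by (intro mult_add_distrib_mat[of P n n]) auto
    also have "P * (a j \<cdot>\<^sub>m 1\<^sub>m n) = a j \<cdot>\<^sub>m P"
      using mult_smult_distrib[OF P one_carrier_mat] P by simp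
    also have "\<dots> = a j \<cdot>\<^sub>m L (Suc j) (R j)"
      using LR[of j] P by (simp add: L_def)
    also have "P * (P * H) = L (Suc j) (S j)" using H by (simp add: L_def)
    also have "L (Suc j) (S j) + a j \<cdot>\<^sub>m L (Suc j) (R j) = L (Suc j) (S (Suc j))"
      using S[of j] R[of j] by (simp add: Lsmult[symmetric] Ladd[symmetric] S_def)
    finally show ?case
      using horner[OF H(2), of "a j"] H(1) P by (intro exI[of _ "P * H + a j \<cdot>\<^sub>m 1\<^sub>m n"] conjI) simp_all
  qed
  then obtain H where H: "H \<in> carrier_mat n n" "mat_polynomial n P H" "P * H = 1\<^sub>m n"
    using LR Sk by metis
  have "H = Q * (P * H)" using assoc_mult_mat[OF Q P H(1)] QP H by simp
  then have "H = Q" using H Q by simp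
  then show ?thesis using H by simp
qed

section \<open>Linear systems over expressions\<close>

definition nc_defined :: "nat \<Rightarrow> ('d \<Rightarrow> complex mat) \<Rightarrow> 'd nc_expr \<Rightarrow> bool" where
  "nc_defined m X e \<longleftrightarrow> nc_expr_eval m X e \<noteq> None"

definition nc_val :: "nat \<Rightarrow> ('d \<Rightarrow> complex mat) \<Rightarrow> 'd nc_expr \<Rightarrow> complex mat" where
  "nc_val m X e = the (nc_expr_eval m X e)"

primrec nc_sum :: "(nat \<Rightarrow> 'd nc_expr) \<Rightarrow> nat \<Rightarrow> 'd nc_expr" where
  "nc_sum f 0 = NC_Const 0"
| "nc_sum f (Suc k) = NC_Add (nc_sum f k) (f k)"

lemma nc_defined_simps [simp]:
  "nc_defined m X (NC_Const a)"
  "nc_defined m X (NC_Var j)"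
  "nc_defined m X (NC_Add e1 e2) \<longleftrightarrow> nc_defined m X e1 \<and> nc_defined m X e2"
  "nc_defined m X (NC_Mult e1 e2) \<longleftrightarrow> nc_defined m X e1 \<and> nc_defined m X e2"
  by (auto simp: nc_defined_def bind_eq_None_conv)

lemma nc_defined_sum [simp]: "nc_defined m X (nc_sum f k) \<longleftrightarrow> (\<forall>i<k. nc_defined m X (f i))"
  by (induction k) (auto simp: less_Suc_eq)

lemma nc_val_simps [simp]:
  "nc_val m X (NC_Const a) = a \<cdot>\<^sub>m 1\<^sub>m m"
  "nc_val m X (NC_Var j) = X j"
  "nc_defined m X e1 \<Longrightarrow> nc_defined m X e2 \<Longrightarrow> nc_val m X (NC_Add e1 e2) = nc_val m X e1 + nc_val m X e2"
  "nc_defined m X e1 \<Longrightarrow> nc_defined m X e2 \<Longrightarrow> nc_val m X (NC_Mult e1 e2) = nc_val m X e1 * nc_val m X e2"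
  by (auto simp: nc_defined_def nc_val_def)

lemma nc_val_sum [simp]:
  "(\<And>i. i < k \<Longrightarrow> nc_defined m X (f i)) \<Longrightarrow> nc_val m X (nc_sum f k) = msum m (\<lambda>i. nc_val m X (f i)) k"
  by (induction k) auto

lemma nc_val_carrier: "(m, X) \<in> mat_tuples \<Longrightarrow> nc_defined m X e \<Longrightarrow> nc_val m X e \<in> carrier_mat m m"
proof -
  assume X: "(m, X) \<in> mat_tuples" and "nc_defined m X e"
  then obtain E where E: "nc_expr_eval m X e = Some E" by (auto simp: nc_defined_def)
  moreover have "\<forall>j. X j \<in> carrier_mat m m" using X by (simp add: mat_tuples_def)
  ultimately show ?thesis using nc_expr_eval_carrier[of X m e E] by (simp add: nc_val_def)
qed

lemma nc_inv_defined:
  assumes "(m, X) \<in> mat_tuples" "nc_defined m X (NC_Inv e)"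
  shows "nc_defined m X e" "nc_val m X e * nc_val m X (NC_Inv e) = 1\<^sub>m m"
    "nc_val m X (NC_Inv e) * nc_val m X e = 1\<^sub>m m"
proof -
  obtain E F where E: "nc_expr_eval m X e = Some E" "mat_inverse E = Some F"
    using assms(2) by (auto simp: nc_defined_def bind_eq_None_conv)
  have "E \<in> carrier_mat m m" using assms(1) nc_expr_eval_carrier[OF _ E(1)] by (auto simp: mat_tuples_def)
  from mat_inverse(2)[OF this E(2)] E show "nc_defined m X e" "nc_val m X e * nc_val m X (NC_Inv e) = 1\<^sub>m m"
    "nc_val m X (NC_Inv e) * nc_val m X e = 1\<^sub>m m"
    by (auto simp: nc_val_def nc_defined_def)
qed

lemma nc_inv_defined_one:
  assumes "nc_defined m X e" "nc_val m X e = 1\<^sub>m m"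
  shows "nc_defined m X (NC_Inv e)" "nc_val m X (NC_Inv e) = 1\<^sub>m m"
proof -
  have "nc_expr_eval m X e = Some (1\<^sub>m m)" using assms by (auto simp: nc_defined_def nc_val_def)
  moreover have "mat_inverse (1\<^sub>m m) = Some (1\<^sub>m m :: complex mat)"
    by (rule mat_inverse_eq_SomeI[of _ m]) simp_all
  ultimately show "nc_defined m X (NC_Inv e)" "nc_val m X (NC_Inv e) = 1\<^sub>m m"
    by (simp_all add: nc_defined_def nc_val_def)
qed

lemma msum_cong: "(\<And>i. i < k \<Longrightarrow> F i = G i) \<Longrightarrow> msum m F k = msum m G k"
  by (induction k) auto

lemma msum_eliminate:
  assumes "\<And>j. j < k \<Longrightarrow> A j \<in> carrier_mat m m" "\<And>j. j < k \<Longrightarrow> D j \<in> carrier_mat m m"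
    "\<And>j. j < k \<Longrightarrow> U j \<in> carrier_mat m m" and B: "B \<in> carrier_mat m m"
  shows "msum m (\<lambda>j. (A j + B * D j) * U j) k = msum m (\<lambda>j. A j * U j) k + B * msum m (\<lambda>j. D j * U j) k"
  using assms(1-3)
proof (induction k)
  case (Suc k)
  then have c: "A k \<in> carrier_mat m m" "D k \<in> carrier_mat m m" "U k \<in> carrier_mat m m"
    and s: "msum m (\<lambda>j. A j * U j) k \<in> carrier_mat m m" "msum m (\<lambda>j. D j * U j) k \<in> carrier_mat m m"
    by (auto intro!: msum_carrier mult_carrier_mat[of _ m m _ m])
  have "(A k + B * D k) * U k = A k * U k + B * (D k * U k)"
    using c B by (subst add_mult_distrib_mat[of _ m m]) (auto simp: assoc_mult_mat[of _ m m _ m _ m])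
  moreover have "B * (msum m (\<lambda>j. D j * U j) k + D k * U k) = B * msum m (\<lambda>j. D j * U j) k + B * (D k * U k)"
    using c s B by (intro mult_add_distrib_mat) auto
  moreover have "(a + b') + (a' + b) = (a + a') + (b' + b)"
    if "a \<in> carrier_mat m m" "b \<in> carrier_mat m m" "a' \<in> carrier_mat m m" "b' \<in> carrier_mat m m"
    for a b a' b' :: "complex mat"
    using that by (intro eq_matI) auto
  ultimately show ?case
    using Suc c s B by (simp add: mult_carrier_mat[of _ m m _ m])
qed (use B in simp)

lemma mat_transpose_term:
  fixes a x y c :: "complex mat"
  assumes "a \<in> carrier_mat m m" "x \<in> carrier_mat m m" "y \<in> carrier_mat m m" "c \<in> carrier_mat m m"
  shows "a + (x + (- 1) \<cdot>\<^sub>m y) = c \<longleftrightarrow> a + (- 1) \<cdot>\<^sub>m y = c + (- 1) \<cdot>\<^sub>m x"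
proof -
  have *: "(p + (q - r) = s) = (p - r = s - q)" for p q r s :: complex by (auto simp: algebra_simps)
  show ?thesis
    by (simp add: mat_eq_iff carrier_matD[OF assms(1)] carrier_matD[OF assms(2)]
        carrier_matD[OF assms(3)] carrier_matD[OF assms(4)] *)
qed

text \<open>Gaussian elimination carried out on expressions, with the last diagonal entry as pivot and
  without any exchange of rows. The solution is defined only where all pivots can be inverted, and
  there the system has no other solution. If the matrix evaluates to the identity, all pivots do
  so as well; hence the solution is defined at such a point.\<close>

lemma nc_linear_system:
  fixes W :: "nat \<Rightarrow> nat \<Rightarrow> 'd nc_expr" and c :: "nat \<Rightarrow> 'd nc_expr"
  shows "\<exists>x. \<forall>m X. (m, X) \<in> mat_tuples \<longrightarrow>
    ((\<forall>i<N. nc_defined m X (x i)) \<longrightarrow>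
      (\<forall>i<N. nc_defined m X (c i) \<and> (\<forall>j<N. nc_defined m X (W i j))) \<and>
      (\<forall>u. (\<forall>i<N. u i \<in> carrier_mat m m) \<longrightarrow>
        (\<forall>i<N. msum m (\<lambda>j. nc_val m X (W i j) * u j) N = nc_val m X (c i)) \<longleftrightarrow>
        (\<forall>i<N. u i = nc_val m X (x i)))) \<and>
    ((\<forall>i<N. nc_defined m X (c i) \<and>
        (\<forall>j<N. nc_defined m X (W i j) \<and> nc_val m X (W i j) = (if i = j then 1\<^sub>m m else 0\<^sub>m m m))) \<longrightarrow>
      (\<forall>i<N. nc_defined m X (x i)))"
proof (induction N arbitrary: W c)
  case (Suc N)
  define w where "w = NC_Inv (W N N)"
  \<comment> \<open>Adding \<open>r i\<close> times the last row to row \<open>i\<close> removes the last unknown.\<close>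
  define r where "r i = NC_Mult (NC_Const (- 1)) (NC_Mult (W i N) w)" for i
  define W' where "W' i j = NC_Add (W i j) (NC_Mult (r i) (W N j))" for i j
  define c' where "c' i = NC_Add (c i) (NC_Mult (r i) (c N))" for i
  obtain x where x: "\<And>m X. (m, X) \<in> mat_tuples \<Longrightarrow>
    ((\<forall>i<N. nc_defined m X (x i)) \<longrightarrow>
      (\<forall>i<N. nc_defined m X (c' i) \<and> (\<forall>j<N. nc_defined m X (W' i j))) \<and>
      (\<forall>u. (\<forall>i<N. u i \<in> carrier_mat m m) \<longrightarrow>
        (\<forall>i<N. msum m (\<lambda>j. nc_val m X (W' i j) * u j) N = nc_val m X (c' i)) \<longleftrightarrow>
        (\<forall>i<N. u i = nc_val m X (x i)))) \<and>
    ((\<forall>i<N. nc_defined m X (c' i) \<and>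
        (\<forall>j<N. nc_defined m X (W' i j) \<and> nc_val m X (W' i j) = (if i = j then 1\<^sub>m m else 0\<^sub>m m m))) \<longrightarrow>
      (\<forall>i<N. nc_defined m X (x i)))"
    using Suc.IH[of c' W'] by blast
  define last where "last = NC_Mult w (NC_Add (c N)
    (NC_Mult (NC_Const (- 1)) (nc_sum (\<lambda>j. NC_Mult (W N j) (x j)) N)))"
  define y where "y = x(N := last)"
  show ?case
  proof (intro exI[of _ y] allI impI conjI)
    fix m X assume mX: "(m, X) \<in> (mat_tuples :: (nat \<times> ('d \<Rightarrow> complex mat)) set)"
      and def: "\<forall>i<Suc N. nc_defined m X (y i)"
    have dl: "nc_defined m X last" using def[rule_format, of N] by (simp add: y_def)
    have defx: "\<forall>i<N. nc_defined m X (x i)"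
    proof (intro allI impI)
      fix i assume "i < N"
      then show "nc_defined m X (x i)" using def[rule_format, of i] by (simp add: y_def)
    qed
    from dl have dw: "nc_defined m X w" and dcN: "nc_defined m X (c N)" and dWN: "\<forall>j<N. nc_defined m X (W N j)"
      by (auto simp: last_def)
    have dNN: "nc_defined m X (W N N)" using nc_inv_defined(1)[OF mX] dw by (auto simp: w_def)
    have defW': "\<forall>i<N. nc_defined m X (c' i) \<and> (\<forall>j<N. nc_defined m X (W' i j))"
      using x[OF mX] defx by blast
    then have dc: "\<forall>i<N. nc_defined m X (c i)" and dr: "\<forall>i<N. nc_defined m X (r i)"
      and dW: "\<forall>i<N. \<forall>j<N. nc_defined m X (W i j)"
      by (auto simp: c'_def W'_def)
    from dr have dWi: "\<forall>i<N. nc_defined m X (W i N)" by (auto simp: r_def)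
    show "nc_defined m X (c i)" if "i < Suc N" for i using that dc dcN by (auto simp: less_Suc_eq)
    show dWall: "nc_defined m X (W i j)" if "i < Suc N" "j < Suc N" for i j
      using that dW dWi dWN dNN by (auto simp: less_Suc_eq)
    note car = nc_val_carrier[OF mX]
    fix u :: "nat \<Rightarrow> complex mat" assume u: "\<forall>i<Suc N. u i \<in> carrier_mat m m"
    let ?v = "nc_val m X"
    define S where "S i = msum m (\<lambda>j. ?v (W i j) * u j) N" for i
    have S: "S i \<in> carrier_mat m m" if "i < Suc N" for i
      unfolding S_def using that u dWall by (intro msum_carrier mult_carrier_mat[of _ m m _ m] car) auto
    have w: "?v w \<in> carrier_mat m m" "?v w * ?v (W N N) = 1\<^sub>m m" "?v (W N N) * ?v w = 1\<^sub>m m"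
      using nc_inv_defined[OF mX] dw car[OF dw] by (auto simp: w_def)
    have cN: "?v (c N) \<in> carrier_mat m m" and WNN: "?v (W N N) \<in> carrier_mat m m"
      and uN: "u N \<in> carrier_mat m m" using car dcN dNN u by auto
    have lastrow: "S N + ?v (W N N) * u N = ?v (c N) \<longleftrightarrow> u N = ?v w * (?v (c N) + (- 1) \<cdot>\<^sub>m S N)"
    proof
      assume *: "S N + ?v (W N N) * u N = ?v (c N)"
      have "?v (c N) + (- 1) \<cdot>\<^sub>m S N = ?v (W N N) * u N"
        unfolding *[symmetric] using S[of N] WNN uN by (intro eq_matI) auto
      then have "?v w * (?v (c N) + (- 1) \<cdot>\<^sub>m S N) = (?v w * ?v (W N N)) * u N"
        using assoc_mult_mat[OF w(1) WNN uN] by simp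
      then show "u N = ?v w * (?v (c N) + (- 1) \<cdot>\<^sub>m S N)" using w uN by simp
    next
      assume *: "u N = ?v w * (?v (c N) + (- 1) \<cdot>\<^sub>m S N)"
      have cS: "?v (c N) + (- 1) \<cdot>\<^sub>m S N \<in> carrier_mat m m" using cN S by auto
      have "?v (W N N) * u N = ?v (c N) + (- 1) \<cdot>\<^sub>m S N"
        unfolding * by (metis assoc_mult_mat[OF WNN w(1) cS] w(3) left_mult_one_mat[OF cS])
      then show "S N + ?v (W N N) * u N = ?v (c N)"
        using cN S[of N] by (intro eq_matI) auto
    qed
    have row: "S i + ?v (W i N) * u N = ?v (c i) \<longleftrightarrow> msum m (\<lambda>j. ?v (W' i j) * u j) N = ?v (c' i)"
      if i: "i < N" and uN_eq: "u N = ?v w * (?v (c N) + (- 1) \<cdot>\<^sub>m S N)" for i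
    proof -
      have WiN: "?v (W i N) \<in> carrier_mat m m" and ci: "?v (c i) \<in> carrier_mat m m"
        using i car dWi dc by auto
      have ri: "?v (r i) = (- 1) \<cdot>\<^sub>m (?v (W i N) * ?v w)"
        using i dWi dw WiN w by (simp add: r_def mult_smult_assoc_mat[of _ m m _ m])
      then have ric: "?v (r i) \<in> carrier_mat m m" using WiN w by auto
      have "msum m (\<lambda>j. ?v (W' i j) * u j) N = msum m (\<lambda>j. (?v (W i j) + ?v (r i) * ?v (W N j)) * u j) N"
        using i dW dr dWN by (intro msum_cong) (simp add: W'_def)
      also have "\<dots> = S i + ?v (r i) * S N"
        unfolding S_def using i u dWall by (intro msum_eliminate ric car) auto
      finally have l: "msum m (\<lambda>j. ?v (W' i j) * u j) N = S i + ?v (r i) * S N" .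
      have r: "?v (c' i) = ?v (c i) + ?v (r i) * ?v (c N)"
        using i dc dr dcN by (simp add: c'_def)
      define B where "B = ?v (W i N) * ?v w"
      have B: "B \<in> carrier_mat m m" using WiN w by (simp add: B_def)
      have wSc: "?v (W i N) * u N = B * ?v (c N) + (- 1) \<cdot>\<^sub>m (B * S N)"
      proof -
        have "?v (W i N) * u N = B * (?v (c N) + (- 1) \<cdot>\<^sub>m S N)"
          unfolding uN_eq B_def using cN S[of N] by (intro assoc_mult_mat[OF WiN w(1), symmetric]) auto
        also have "\<dots> = B * ?v (c N) + B * ((- 1) \<cdot>\<^sub>m S N)"
          using B cN S[of N] by (intro mult_add_distrib_mat) auto
        also have "B * ((- 1) \<cdot>\<^sub>m S N) = (- 1) \<cdot>\<^sub>m (B * S N)"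
          using B S[of N] by (intro mult_smult_distrib) auto
        finally show ?thesis .
      qed
      have rB: "?v (r i) * M = (- 1) \<cdot>\<^sub>m (B * M)" if "M \<in> carrier_mat m m" for M
        unfolding ri B_def[symmetric] using B that by (intro mult_smult_assoc_mat) auto
      have BS: "B * S N \<in> carrier_mat m m" "B * ?v (c N) \<in> carrier_mat m m" using B S[of N] cN by auto
      have Si: "S i \<in> carrier_mat m m" using S i by simp
      have "S i + ?v (W i N) * u N = ?v (c i) \<longleftrightarrow> S i + ?v (r i) * S N = ?v (c i) + ?v (r i) * ?v (c N)"
        unfolding wSc rB[OF S[OF lessI]] rB[OF cN]
        by (rule mat_transpose_term[OF Si BS(2,1) ci])
      then show ?thesis using l r by simp
    qed
    have sys: "(\<forall>i<N. msum m (\<lambda>j. ?v (W' i j) * u j) N = ?v (c' i)) \<longleftrightarrow> (\<forall>i<N. u i = ?v (x i))"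
      using x[OF mX] defx u by simp
    have last_val: "(\<forall>i<N. u i = ?v (x i)) \<Longrightarrow> ?v last = ?v w * (?v (c N) + (- 1) \<cdot>\<^sub>m S N)"
    proof -
      assume ux: "\<forall>i<N. u i = ?v (x i)"
      have "msum m (\<lambda>j. ?v (NC_Mult (W N j) (x j))) N = S N"
        unfolding S_def using dWN defx ux by (intro msum_cong) simp
      then show ?thesis
        using dw dcN dWN defx S[of N] by (simp add: last_def mult_smult_assoc_mat[of _ m m _ m])
    qed
    have "(\<forall>i<Suc N. msum m (\<lambda>j. ?v (W i j) * u j) (Suc N) = ?v (c i)) \<longleftrightarrow>
      S N + ?v (W N N) * u N = ?v (c N) \<and> (\<forall>i<N. S i + ?v (W i N) * u N = ?v (c i))"
      by (auto simp: less_Suc_eq S_def)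
    also have "\<dots> \<longleftrightarrow> u N = ?v w * (?v (c N) + (- 1) \<cdot>\<^sub>m S N) \<and> (\<forall>i<N. u i = ?v (x i))"
    proof (cases "u N = ?v w * (?v (c N) + (- 1) \<cdot>\<^sub>m S N)")
      case True
      have "(\<forall>i<N. S i + ?v (W i N) * u N = ?v (c i)) \<longleftrightarrow> (\<forall>i<N. u i = ?v (x i))"
        using row[OF _ True] sys by simp
      then show ?thesis using lastrow True by blast
    next
      case False
      then show ?thesis using lastrow by blast
    qed
    also have "\<dots> \<longleftrightarrow> (\<forall>i<Suc N. u i = ?v (y i))"
      using last_val by (auto simp: less_Suc_eq y_def)
    finally show "(\<forall>i<Suc N. msum m (\<lambda>j. ?v (W i j) * u j) (Suc N) = ?v (c i)) \<longleftrightarrow>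
      (\<forall>i<Suc N. u i = ?v (y i))" .
  next
    fix m X i assume mX: "(m, X) \<in> (mat_tuples :: (nat \<times> ('d \<Rightarrow> complex mat)) set)"
      and one: "\<forall>i<Suc N. nc_defined m X (c i) \<and>
        (\<forall>j<Suc N. nc_defined m X (W i j) \<and> nc_val m X (W i j) = (if i = j then 1\<^sub>m m else 0\<^sub>m m m))"
      and i: "i < Suc N"
    have w: "nc_defined m X w" "nc_val m X w = 1\<^sub>m m"
      using one nc_inv_defined_one[of m X "W N N"] by (auto simp: w_def)
    have dr: "nc_defined m X (r i)" if "i < N" for i using one w that by (simp add: r_def)
    have rv: "nc_val m X (r i) = 0\<^sub>m m m" if "i < N" for i
      using one w that by (simp add: r_def)
    have "\<forall>i<N. nc_defined m X (c' i) \<and>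
        (\<forall>j<N. nc_defined m X (W' i j) \<and> nc_val m X (W' i j) = (if i = j then 1\<^sub>m m else 0\<^sub>m m m))"
    proof (intro allI impI conjI)
      fix i assume i: "i < N"
      show "nc_defined m X (c' i)" using one dr[OF i] i by (simp add: c'_def)
      fix j assume j: "j < N"
      have d: "nc_defined m X (W i j)" "nc_defined m X (W N j)" using one i j by simp_all
      show "nc_defined m X (W' i j)" using d dr[OF i] by (simp add: W'_def)
      have "nc_val m X (W' i j) = nc_val m X (W i j) + 0\<^sub>m m m * nc_val m X (W N j)"
        using d dr[OF i] rv[OF i] by (simp add: W'_def)
      also have "\<dots> = nc_val m X (W i j)"
        using nc_val_carrier[OF mX d(1)] nc_val_carrier[OF mX d(2)] by simp
      finally show "nc_val m X (W' i j) = (if i = j then 1\<^sub>m m else 0\<^sub>m m m)"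
        using one i j by simp
    qed
    then have "\<forall>i<N. nc_defined m X (x i)" using x[OF mX] by blast
    then show "nc_defined m X (y i)" using i one w by (auto simp: y_def last_def less_Suc_eq)
  qed
qed simp

section \<open>Every realization defines a rational function\<close>

definition block_matrix :: "nat \<Rightarrow> nat \<Rightarrow> (nat \<Rightarrow> nat \<Rightarrow> complex mat) \<Rightarrow> complex mat" where
  "block_matrix N m F = mat (N * m) (N * m) (\<lambda>(a, b). F (a div m) (b div m) $$ (a mod m, b mod m))"

definition block_column :: "nat \<Rightarrow> nat \<Rightarrow> (nat \<Rightarrow> complex mat) \<Rightarrow> complex mat" where
  "block_column N m U = mat (N * m) m (\<lambda>(a, q). U (a div m) $$ (a mod m, q))"

lemma block_matrix_carrier [simp]: "block_matrix N m F \<in> carrier_mat (N * m) (N * m)"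
  by (simp add: block_matrix_def)

lemma block_column_carrier [simp]: "block_column N m U \<in> carrier_mat (N * m) m"
  by (simp add: block_column_def)

lemma block_matrix_entry:
  assumes "i < N" "p < m" "j < N" "q < m"
  shows "block_matrix N m F $$ (i * m + p, j * m + q) = F i j $$ (p, q)"
  unfolding block_matrix_def index_mat(1)[OF block_index(1)[OF assms(1,2)] block_index(1)[OF assms(3,4)]]
  by (simp only: prod.case block_index[OF assms(1,2)] block_index[OF assms(3,4)])

lemma block_column_entry:
  assumes "i < N" "p < m" "q < m"
  shows "block_column N m U $$ (i * m + p, q) = U i $$ (p, q)"
  unfolding block_column_def index_mat(1)[OF block_index(1)[OF assms(1,2)] assms(3)]
  by (simp only: prod.case block_index[OF assms(1,2)])

lemma block_column_eq_matI:
  assumes "A \<in> carrier_mat (N * m) m" "B \<in> carrier_mat (N * m) m"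
    and "\<And>i p q. i < N \<Longrightarrow> p < m \<Longrightarrow> q < m \<Longrightarrow> A $$ (i * m + p, q) = B $$ (i * m + p, q)"
  shows "A = B"
proof (rule eq_matI)
  fix a b assume "a < dim_row B" "b < dim_col B"
  then have "a < N * m" "b < m" using assms by auto
  then show "A $$ (a, b) = B $$ (a, b)" by (elim block_cases) (simp add: assms(3))
qed (use assms in auto)

lemma block_matrix_mult:
  assumes F: "\<And>i j. i < N \<Longrightarrow> j < N \<Longrightarrow> F i j \<in> carrier_mat m m"
    and H: "\<And>i j. i < N \<Longrightarrow> j < N \<Longrightarrow> H i j \<in> carrier_mat m m"
  shows "block_matrix N m F * block_matrix N m H = block_matrix N m (\<lambda>i j. msum m (\<lambda>k. F i k * H k j) N)"
proof (rule block_eq_matI[of _ N m N m])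
  fix i p j q assume i: "i < N" "p < m" "j < N" "q < m"
  have "(block_matrix N m F * block_matrix N m H) $$ (i * m + p, j * m + q) =
      (\<Sum>k<N. \<Sum>l<m. F i k $$ (p, l) * H k j $$ (l, q))"
    by (simp add: mat_mult_entry[OF block_matrix_carrier block_matrix_carrier block_index(1)[OF i(1,2)] block_index(1)[OF i(3,4)]]
        sum_blocks block_matrix_entry i)
  also have "\<dots> = (\<Sum>k<N. (F i k * H k j) $$ (p, q))"
    using i by (intro sum.cong refl) (simp add: mat_mult_entry[OF F H])
  also have "\<dots> = msum m (\<lambda>k. F i k * H k j) N $$ (p, q)"
    using i by (intro msum_entry[symmetric] mult_carrier_mat[OF F H]) auto
  finally show "(block_matrix N m F * block_matrix N m H) $$ (i * m + p, j * m + q) =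
      block_matrix N m (\<lambda>i j. msum m (\<lambda>k. F i k * H k j) N) $$ (i * m + p, j * m + q)"
    by (simp add: block_matrix_entry i)
qed (auto intro: mult_carrier_mat[OF block_matrix_carrier block_matrix_carrier])

lemma block_matrix_mult_colstack:
  assumes F: "\<And>i j. i < N \<Longrightarrow> j < N \<Longrightarrow> F i j \<in> carrier_mat m m"
    and U: "\<And>j. j < N \<Longrightarrow> U j \<in> carrier_mat m m"
  shows "block_matrix N m F * block_column N m U = block_column N m (\<lambda>i. msum m (\<lambda>k. F i k * U k) N)"
proof (rule block_column_eq_matI[of _ N m])
  fix i p q assume i: "i < N" "p < m" "q < m"
  have "(block_matrix N m F * block_column N m U) $$ (i * m + p, q) =
      (\<Sum>k<N. \<Sum>l<m. F i k $$ (p, l) * U k $$ (l, q))"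
    by (simp add: mat_mult_entry[OF block_matrix_carrier block_column_carrier block_index(1)[OF i(1,2)] i(3)]
        sum_blocks block_matrix_entry block_column_entry i)
  also have "\<dots> = (\<Sum>k<N. (F i k * U k) $$ (p, q))"
    using i by (intro sum.cong refl) (simp add: mat_mult_entry[OF F U])
  also have "\<dots> = msum m (\<lambda>k. F i k * U k) N $$ (p, q)"
    using i by (intro msum_entry[symmetric] mult_carrier_mat[OF F U]) auto
  finally show "(block_matrix N m F * block_column N m U) $$ (i * m + p, q) =
      block_column N m (\<lambda>i. msum m (\<lambda>k. F i k * U k) N) $$ (i * m + p, q)"
    by (simp add: block_column_entry i)
qed (auto intro: mult_carrier_mat[OF block_matrix_carrier block_column_carrier])

lemma block_column_inject:
  assumes "block_column N m U = block_column N m V"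
    and "\<And>j. j < N \<Longrightarrow> U j \<in> carrier_mat m m" "\<And>j. j < N \<Longrightarrow> V j \<in> carrier_mat m m" and j: "j < N"
  shows "U j = V j"
proof (rule eq_matI)
  fix p q assume "p < dim_row (V j)" "q < dim_col (V j)"
  then have "p < m" "q < m" using assms(3)[OF j] by auto
  then show "U j $$ (p, q) = V j $$ (p, q)"
    using block_column_entry[OF j, of p m q] arg_cong[OF assms(1), of "\<lambda>M. M $$ (j * m + p, q)"] by metis
qed (simp_all add: carrier_matD[OF assms(2)[OF j]] carrier_matD[OF assms(3)[OF j]])

lemma block_column_eq_iff:
  assumes "\<And>j. j < N \<Longrightarrow> U j \<in> carrier_mat m m" "\<And>j. j < N \<Longrightarrow> V j \<in> carrier_mat m m"
  shows "block_column N m U = block_column N m V \<longleftrightarrow> (\<forall>j<N. U j = V j)"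
proof
  assume "\<forall>j<N. U j = V j"
  then show "block_column N m U = block_column N m V"
    by (intro block_column_eq_matI[of _ N m] block_column_carrier) (simp only: block_column_entry)
next
  assume "block_column N m U = block_column N m V"
  from block_column_inject[OF this assms] show "\<forall>j<N. U j = V j" by simp
qed

lemma block_matrix_one: "block_matrix N m (\<lambda>i j. if i = j then 1\<^sub>m m else 0\<^sub>m m m) = 1\<^sub>m (N * m)"
proof (rule block_eq_matI[of _ N m N m])
  fix i p j q assume i: "i < N" "p < m" "j < N" "q < m"
  show "block_matrix N m (\<lambda>i j. if i = j then 1\<^sub>m m else 0\<^sub>m m m) $$ (i * m + p, j * m + q) =
      1\<^sub>m (N * m) $$ (i * m + p, j * m + q)"
    using i block_index(1)[OF i(1,2)] block_index(1)[OF i(3,4)]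
    by (simp add: block_matrix_entry block_index_eq_iff[OF i])
qed simp_all

lemma block_matrix_inject:
  assumes "block_matrix N m F = block_matrix N m H" "i < N" "j < N" "F i j \<in> carrier_mat m m" "H i j \<in> carrier_mat m m"
  shows "F i j = H i j"
proof (rule eq_matI)
  fix p q assume "p < dim_row (H i j)" "q < dim_col (H i j)"
  then have "p < m" "q < m" using assms by auto
  then show "F i j $$ (p, q) = H i j $$ (p, q)"
    using block_matrix_entry[OF assms(2) _ assms(3), of p m q] arg_cong[OF assms(1), of "\<lambda>M. M $$ (i * m + p, j * m + q)"] by metis
qed (simp_all add: carrier_matD[OF assms(4)] carrier_matD[OF assms(5)])

lemma linear_form_expression:
  fixes a :: "'d \<Rightarrow> complex"
  assumes "finite S"
  shows "\<exists>e. \<forall>m X. (m, X) \<in> mat_tuples \<longrightarrow>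
    nc_defined m X e \<and> nc_val m X e = mat m m (\<lambda>p. \<Sum>k\<in>S. a k * X k $$ p)"
  using assms
proof induction
  case empty
  show ?case by (intro exI[of _ "NC_Const 0"] allI impI conjI) (auto intro!: eq_matI)
next
  case (insert k S)
  then obtain e where e: "\<And>m X. (m, X) \<in> mat_tuples \<Longrightarrow>
    nc_defined m X e \<and> nc_val m X e = mat m m (\<lambda>p. \<Sum>k\<in>S. a k * X k $$ p)" by blast
  show ?case
  proof (intro exI[of _ "NC_Add (NC_Mult (NC_Const (a k)) (NC_Var k)) e"] allI impI)
    fix m and X :: "'d \<Rightarrow> complex mat" assume mX: "(m, X) \<in> mat_tuples"
    then have X: "X k \<in> carrier_mat m m" by (simp add: mat_tuples_def)
    then have "(a k \<cdot>\<^sub>m 1\<^sub>m m) * X k = a k \<cdot>\<^sub>m X k"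
      by (simp add: mult_smult_assoc_mat[of _ m m _ m])
    then show "nc_defined m X (NC_Add (NC_Mult (NC_Const (a k)) (NC_Var k)) e) \<and>
      nc_val m X (NC_Add (NC_Mult (NC_Const (a k)) (NC_Var k)) e) =
      mat m m (\<lambda>p. \<Sum>k\<in>insert k S. a k * X k $$ p)"
      using e[OF mX] insert.hyps X by (auto intro!: eq_matI)
  qed
qed

lemma pencil_expression:
  fixes A :: "'d::finite \<Rightarrow> complex mat"
  assumes A: "\<forall>j. A j \<in> carrier_mat n n"
  obtains M where "\<And>m X i j. (m, X) \<in> mat_tuples \<Longrightarrow> nc_defined m X (M i j)"
    and "\<And>m X. (m, X) \<in> mat_tuples \<Longrightarrow> linear_pencil n A m X = block_matrix n m (\<lambda>i j. nc_val m X (M i j))"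
proof -
  define E where "E i j = (SOME e. \<forall>m X. (m, X) \<in> mat_tuples \<longrightarrow>
    nc_defined m X e \<and> nc_val m X e = mat m m (\<lambda>p. \<Sum>k\<in>UNIV. (- A k $$ (i, j)) * X k $$ p))" for i j
  have E: "\<forall>m X. (m, X) \<in> mat_tuples \<longrightarrow>
    nc_defined m X (E i j) \<and> nc_val m X (E i j) = mat m m (\<lambda>p. \<Sum>k\<in>UNIV. (- A k $$ (i, j)) * X k $$ p)" for i j
    unfolding E_def by (rule someI_ex[OF linear_form_expression[OF finite_class.finite_UNIV]])
  define M where "M i j = NC_Add (NC_Const (if i = j then 1 else 0)) (E i j)" for i j
  show thesis
  proof
    fix m X i j assume "(m, X) \<in> (mat_tuples :: (nat \<times> ('d \<Rightarrow> complex mat)) set)"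
    then show "nc_defined m X (M i j)" using E by (simp add: M_def)
  next
    fix m X assume mX: "(m, X) \<in> (mat_tuples :: (nat \<times> ('d \<Rightarrow> complex mat)) set)"
    then have X: "\<forall>j. X j \<in> carrier_mat m m" by (simp add: mat_tuples_def)
    show "linear_pencil n A m X = block_matrix n m (\<lambda>i j. nc_val m X (M i j))"
    proof (rule block_eq_matI[of _ n m n m])
      fix i p j q assume i: "i < n" "p < m" "j < n" "q < m"
      show "linear_pencil n A m X $$ (i * m + p, j * m + q) =
          block_matrix n m (\<lambda>i j. nc_val m X (M i j)) $$ (i * m + p, j * m + q)"
        using E[of i j] mX i
        by (simp add: linear_pencil_entry[OF A X i] block_matrix_entry[OF i] M_def sum_negf)
    qed (simp_all add: linear_pencil_carrier)
  qed
qed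

text \<open>A polynomial in \<open>M(X)\<close> for one fixed \<open>X\<close> extends to a matrix of expressions without
  inverses, which are defined at all tuples.\<close>

lemma mat_polynomial_expression:
  fixes M :: "nat \<Rightarrow> nat \<Rightarrow> 'd nc_expr"
  assumes M: "\<And>m X i j. (m, X) \<in> mat_tuples \<Longrightarrow> nc_defined m X (M i j)"
    and X: "(m, X) \<in> mat_tuples"
    and Q: "mat_polynomial (N * m) (block_matrix N m (\<lambda>i j. nc_val m X (M i j))) Q"
  shows "\<exists>G. (\<forall>m X i j. (m, X) \<in> mat_tuples \<longrightarrow> nc_defined m X (G i j)) \<and>
    block_matrix N m (\<lambda>i j. nc_val m X (G i j)) = Q"
  using Q
proof induction
  case zero
  have "block_matrix N m (\<lambda>i j. nc_val m X (NC_Const 0)) = 0\<^sub>m (N * m) (N * m)"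
    by (rule block_eq_matI[of _ N m N m]) (simp_all add: block_matrix_entry block_index(1))
  then show ?case by (intro exI[of _ "\<lambda>_ _. NC_Const 0"]) simp
next
  case (horner Q a)
  then obtain G where G: "\<And>m X i j. (m, X) \<in> mat_tuples \<Longrightarrow> nc_defined m X (G i j)"
    and GQ: "block_matrix N m (\<lambda>i j. nc_val m X (G i j)) = Q" by blast
  define G' where "G' i j = NC_Add (nc_sum (\<lambda>k. NC_Mult (M i k) (G k j)) N) (NC_Const (if i = j then a else 0))" for i j
  have c: "nc_val m X (M i j) \<in> carrier_mat m m" "nc_val m X (G i j) \<in> carrier_mat m m" for i j
    using nc_val_carrier[OF X M[OF X]] nc_val_carrier[OF X G[OF X]] by auto
  have "block_matrix N m (\<lambda>i j. nc_val m X (G' i j)) = block_matrix N m (\<lambda>i j. nc_val m X (M i j)) * Q + a \<cdot>\<^sub>m 1\<^sub>m (N * m)"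
    unfolding GQ[symmetric] block_matrix_mult[OF c(1) c(2)]
  proof (rule block_eq_matI[of _ N m N m])
    fix i p j q assume i: "i < N" "p < m" "j < N" "q < m"
    have mc: "msum m (\<lambda>k. nc_val m X (M i k) * nc_val m X (G k j)) N \<in> carrier_mat m m"
      using c by (intro msum_carrier mult_carrier_mat) auto
    have v: "nc_val m X (G' i j) = msum m (\<lambda>k. nc_val m X (M i k) * nc_val m X (G k j)) N +
        (if i = j then a else 0) \<cdot>\<^sub>m 1\<^sub>m m"
      using M[OF X] G[OF X] by (simp add: G'_def)
    show "block_matrix N m (\<lambda>i j. nc_val m X (G' i j)) $$ (i * m + p, j * m + q) =
      (block_matrix N m (\<lambda>i j. msum m (\<lambda>k. nc_val m X (M i k) * nc_val m X (G k j)) N) + a \<cdot>\<^sub>m 1\<^sub>m (N * m)) $$ (i * m + p, j * m + q)"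
      using mc i block_index(1)[OF i(1,2)] block_index(1)[OF i(3,4)] carrier_matD[OF block_matrix_carrier]
      by (simp add: block_matrix_entry[OF i] v block_index_eq_iff[OF i])
  qed simp_all
  moreover have "\<forall>m X i j. (m, X) \<in> mat_tuples \<longrightarrow> nc_defined m X (G' i j)"
    using M G by (simp add: G'_def)
  ultimately show ?case by blast
qed

text \<open>Elimination applied to the pencil itself could break down at \<open>X\<close>. Let \<open>P\<close> be the pencil and
  let \<open>G\<close> be a matrix of expressions defined everywhere with \<open>G(X) = P(X)\<^sup>-\<^sup>1\<close>; it exists since
  the inverse is a polynomial in \<open>P(X)\<close>. The system with matrix \<open>G P\<close> and right-hand side \<open>G c\<close> is
  the identity at \<open>X\<close>, and so its solution by elimination is defined there. Wherever it is
  defined, unique solvability makes \<open>P\<close> injective, and the solution must be \<open>P\<^sup>-\<^sup>1 c\<close>.\<close>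

lemma realization_expression:
  fixes A :: "'d::finite \<Rightarrow> complex mat"
  assumes A: "\<forall>j. A j \<in> carrier_mat n n" and b: "b \<in> carrier_vec n" and c: "c \<in> carrier_vec n"
    and X: "(m, X) \<in> mat_tuples" and K: "mat_inverse (linear_pencil n A m X) = Some K"
  shows "\<exists>e. nc_defined m X e \<and> (\<forall>l Y. (l, Y) \<in> mat_tuples \<longrightarrow> nc_defined l Y e \<longrightarrow>
    (\<exists>K'. mat_inverse (linear_pencil n A l Y) = Some K' \<and>
      nc_val l Y e = (mat_adjoint (mat_of_cols n [b]) \<otimes>\<^sub>m 1\<^sub>m l) * K' * (mat_of_cols n [c] \<otimes>\<^sub>m 1\<^sub>m l)))"
proof -
  obtain M where Md: "\<And>m X i j. (m, X) \<in> mat_tuples \<Longrightarrow> nc_defined m X (M i j)"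
    and Mv: "\<And>m X. (m, X) \<in> mat_tuples \<Longrightarrow> linear_pencil n A m X = block_matrix n m (\<lambda>i j. nc_val m X (M i j))"
    using pencil_expression[OF A] by blast
  from mat_inverse(2)[OF linear_pencil_carrier K]
  have PK: "linear_pencil n A m X * K = 1\<^sub>m (n * m)" and KP: "K * linear_pencil n A m X = 1\<^sub>m (n * m)"
    and Kc: "K \<in> carrier_mat (n * m) (n * m)" by auto
  have "mat_polynomial (n * m) (block_matrix n m (\<lambda>i j. nc_val m X (M i j))) K"
    using mat_polynomial_inverse[OF linear_pencil_carrier Kc PK] Mv[OF X] by simp
  then obtain G where Gd: "\<And>m X i j. (m, X) \<in> mat_tuples \<Longrightarrow> nc_defined m X (G i j)"
    and GK: "block_matrix n m (\<lambda>i j. nc_val m X (G i j)) = K"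
    using mat_polynomial_expression[of M m X n K, OF Md X] by blast
  define W where "W i j = nc_sum (\<lambda>k. NC_Mult (G i k) (M k j)) n" for i j
  define C where "C i = nc_sum (\<lambda>k. NC_Mult (G i k) (NC_Const (c $ k))) n" for i
  have Wd: "nc_defined l Y (W i j)" and Cd: "nc_defined l Y (C i)"
    and Wv: "nc_val l Y (W i j) = msum l (\<lambda>k. nc_val l Y (G i k) * nc_val l Y (M k j)) n"
    and Cv: "nc_val l Y (C i) = msum l (\<lambda>k. nc_val l Y (G i k) * (c $ k \<cdot>\<^sub>m 1\<^sub>m l)) n"
    if "(l, Y) \<in> mat_tuples" for l Y i j
    using Gd[OF that] Md[OF that] by (simp_all add: W_def C_def)
  have Mc: "nc_val l Y (M i j) \<in> carrier_mat l l" and Gc: "nc_val l Y (G i j) \<in> carrier_mat l l"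
    and Wc: "nc_val l Y (W i j) \<in> carrier_mat l l" and Cc: "nc_val l Y (C i) \<in> carrier_mat l l"
    if "(l, Y) \<in> mat_tuples" for l Y i j
    using nc_val_carrier[OF that] Md[OF that] Gd[OF that] Wd[OF that] Cd[OF that] by blast+
  have WGP: "block_matrix n l (\<lambda>i j. nc_val l Y (W i j)) = block_matrix n l (\<lambda>i j. nc_val l Y (G i j)) * linear_pencil n A l Y"
    if "(l, Y) \<in> mat_tuples" for l Y
    unfolding Mv[OF that] block_matrix_mult[OF Gc[OF that] Mc[OF that]] by (simp add: Wv[OF that])
  obtain x where x: "\<And>m X. (m, X) \<in> mat_tuples \<Longrightarrow>
    ((\<forall>i<n. nc_defined m X (x i)) \<longrightarrow>
      (\<forall>i<n. nc_defined m X (C i) \<and> (\<forall>j<n. nc_defined m X (W i j))) \<and>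
      (\<forall>u. (\<forall>i<n. u i \<in> carrier_mat m m) \<longrightarrow>
        (\<forall>i<n. msum m (\<lambda>j. nc_val m X (W i j) * u j) n = nc_val m X (C i)) \<longleftrightarrow>
        (\<forall>i<n. u i = nc_val m X (x i)))) \<and>
    ((\<forall>i<n. nc_defined m X (C i) \<and>
        (\<forall>j<n. nc_defined m X (W i j) \<and> nc_val m X (W i j) = (if i = j then 1\<^sub>m m else 0\<^sub>m m m))) \<longrightarrow>
      (\<forall>i<n. nc_defined m X (x i)))"
    using nc_linear_system[of n C W] by blast
  define e where "e = nc_sum (\<lambda>i. NC_Mult (NC_Const (cnj (b $ i))) (x i)) n"
  show ?thesis
  proof (intro exI[of _ e] conjI allI impI)
    have "block_matrix n m (\<lambda>i j. nc_val m X (W i j)) = block_matrix n m (\<lambda>i j. if i = j then 1\<^sub>m m else 0\<^sub>m m m)"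
      unfolding WGP[OF X] GK KP block_matrix_one ..
    then have "nc_val m X (W i j) = (if i = j then 1\<^sub>m m else 0\<^sub>m m m)" if "i < n" "j < n" for i j
      using block_matrix_inject[of n m "\<lambda>i j. nc_val m X (W i j)" "\<lambda>i j. if i = j then 1\<^sub>m m else 0\<^sub>m m m" i j]
        that Wc[OF X] by simp
    then have "\<forall>i<n. nc_defined m X (x i)" using x[OF X] Wd[OF X] Cd[OF X] by blast
    then show "nc_defined m X e" by (simp add: e_def)
  next
    fix l Y assume Y: "(l, Y) \<in> (mat_tuples :: (nat \<times> ('d \<Rightarrow> complex mat)) set)" and e: "nc_defined l Y e"
    have dx: "\<forall>i<n. nc_defined l Y (x i)" using e by (simp add: e_def)
    have l: "0 < l" using Y by (simp add: mat_tuples_def)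
    let ?P = "linear_pencil n A l Y" and ?G = "block_matrix n l (\<lambda>i j. nc_val l Y (G i j))"
    let ?C0 = "mat_of_cols n [c] \<otimes>\<^sub>m 1\<^sub>m l"
    let ?x = "\<lambda>i. nc_val l Y (x i)"
    have P: "?P \<in> carrier_mat (n * l) (n * l)" by (rule linear_pencil_carrier)
    have xc: "?x i \<in> carrier_mat l l" if "i < n" for i using nc_val_carrier[OF Y] dx that by blast
    have C0: "?C0 = block_column n l (\<lambda>k. c $ k \<cdot>\<^sub>m 1\<^sub>m l)"
    proof (rule block_column_eq_matI[of _ n l])
      show "?C0 \<in> carrier_mat (n * l) l" using kronecker_carrier[OF column_carrier one_carrier_mat[of l], of n c] by simp
      fix i p q assume i: "i < n" "p < l" "q < l"
      have "mat_of_cols n [c] $$ (i, 0) = c $ i" using i by (simp add: mat_of_cols_def)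
      then show "?C0 $$ (i * l + p, q) = block_column n l (\<lambda>k. c $ k \<cdot>\<^sub>m 1\<^sub>m l) $$ (i * l + p, q)"
        using kronecker_entry[OF column_carrier one_carrier_mat, of i n p l 0 q c] i
        by (simp add: block_column_entry[OF i])
    qed simp
    have C0c: "?C0 \<in> carrier_mat (n * l) l" unfolding C0 by simp
    have GC0: "?G * ?C0 = block_column n l (\<lambda>i. nc_val l Y (C i))"
      unfolding C0 using Gc[OF Y] by (subst block_matrix_mult_colstack) (auto simp: Cv[OF Y])
    have uniq: "?G * (?P * V) = ?G * ?C0 \<longleftrightarrow> V = block_column n l ?x" if V: "V \<in> carrier_mat (n * l) l" for V
    proof -
      define u where "u i = mat l l (\<lambda>(p, q). V $$ (i * l + p, q))" for i
      have uc: "u i \<in> carrier_mat l l" for i by (simp add: u_def)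
      have Vu: "V = block_column n l u"
        by (rule block_column_eq_matI[of _ n l]) (simp_all add: V block_column_entry u_def)
      have "?G * (?P * V) = block_matrix n l (\<lambda>i j. nc_val l Y (W i j)) * V"
        unfolding WGP[OF Y] by (rule assoc_mult_mat[OF block_matrix_carrier P V, symmetric])
      also have "\<dots> = block_column n l (\<lambda>i. msum l (\<lambda>j. nc_val l Y (W i j) * u j) n)"
        unfolding Vu using Wc[OF Y] uc by (intro block_matrix_mult_colstack) auto
      finally have 1: "?G * (?P * V) = block_column n l (\<lambda>i. msum l (\<lambda>j. nc_val l Y (W i j) * u j) n)" .
      have mc: "msum l (\<lambda>j. nc_val l Y (W i j) * u j) n \<in> carrier_mat l l" for i
        using Wc[OF Y] uc by (intro msum_carrier mult_carrier_mat) auto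
      have "?G * (?P * V) = ?G * ?C0 \<longleftrightarrow> (\<forall>i<n. msum l (\<lambda>j. nc_val l Y (W i j) * u j) n = nc_val l Y (C i))"
        unfolding 1 GC0 by (rule block_column_eq_iff[OF mc Cc[OF Y]])
      also have "\<dots> \<longleftrightarrow> (\<forall>i<n. u i = ?x i)" using x[OF Y] dx uc by blast
      also have "\<dots> \<longleftrightarrow> V = block_column n l ?x"
        unfolding Vu by (rule block_column_eq_iff[OF uc xc, symmetric])
      finally show ?thesis .
    qed
    obtain K' where K': "mat_inverse ?P = Some K'"
    proof (rule mat_inverse_if_injective[OF P])
      fix v assume v: "v \<in> carrier_vec (n * l)" and Pv: "?P *\<^sub>v v = 0\<^sub>v (n * l)"
      \<comment> \<open>A vector in the kernel of the pencil, repeated in all columns, could be added to the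
        solution.\<close>
      define D where "D = mat (n * l) l (\<lambda>(a, q). v $ a)"
      have D: "D \<in> carrier_mat (n * l) l" by (simp add: D_def)
      have "?P * D = 0\<^sub>m (n * l) l"
      proof (rule eq_matI)
        fix a q assume aq: "a < dim_row (0\<^sub>m (n * l) l :: complex mat)" "q < dim_col (0\<^sub>m (n * l) l :: complex mat)"
        have "(?P * D) $$ (a, q) = (?P *\<^sub>v v) $ a"
          using aq P D v by (simp add: scalar_prod_def) (simp add: D_def)
        then show "(?P * D) $$ (a, q) = 0\<^sub>m (n * l) l $$ (a, q)" using aq by (simp add: Pv)
      qed (use P D in auto)
      moreover have "?P * (block_column n l ?x + D) = ?P * block_column n l ?x + ?P * D"
        using P D by (intro mult_add_distrib_mat) auto
      ultimately have "?P * (block_column n l ?x + D) = ?P * block_column n l ?x"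
        using mult_carrier_mat[OF P block_column_carrier[of n l ?x]] by simp
      moreover have "?G * (?P * block_column n l ?x) = ?G * ?C0" using uniq by simp
      ultimately have "block_column n l ?x + D = block_column n l ?x" using uniq[of "block_column n l ?x + D"] D by simp
      then have eq: "(block_column n l ?x + D) $$ (a, 0) = block_column n l ?x $$ (a, 0)" for a by simp
      have "v $ a = 0" if a: "a < n * l" for a
      proof -
        have "(block_column n l ?x + D) $$ (a, 0) = block_column n l ?x $$ (a, 0) + D $$ (a, 0)"
          using a l D by (intro index_add_mat(1)) auto
        moreover have "D $$ (a, 0) = v $ a" using a l by (simp add: D_def)
        ultimately show ?thesis using eq by simp
      qed
      then show "v = 0\<^sub>v (n * l)" using v by (intro eq_vecI) auto
    qed
    from mat_inverse(2)[OF P K'] have PK': "?P * K' = 1\<^sub>m (n * l)" and K'c: "K' \<in> carrier_mat (n * l) (n * l)" by auto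
    have PV: "?P * (K' * ?C0) = ?C0"
      using assoc_mult_mat[OF P K'c C0c] PK' left_mult_one_mat[OF C0c] by simp
    then have V: "K' * ?C0 = block_column n l ?x"
      using uniq[of "K' * ?C0"] mult_carrier_mat[OF K'c C0c] by simp
    have "nc_val l Y e = msum l (\<lambda>i. nc_val l Y (NC_Mult (NC_Const (cnj (b $ i))) (x i))) n"
      unfolding e_def using dx by (intro nc_val_sum) simp
    also have "\<dots> = msum l (\<lambda>i. cnj (b $ i) \<cdot>\<^sub>m ?x i) n"
    proof (rule msum_cong)
      fix i assume i: "i < n"
      then show "nc_val l Y (NC_Mult (NC_Const (cnj (b $ i))) (x i)) = cnj (b $ i) \<cdot>\<^sub>m ?x i"
        using dx xc[OF i] by (simp add: mult_smult_assoc_mat[of _ l l _ l])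
    qed
    also have "\<dots> = mat l l (\<lambda>(p, q). \<Sum>i<n. cnj (b $ i) * block_column n l ?x $$ (i * l + p, q))"
    proof (rule eq_matI)
      fix p q assume "p < dim_row (mat l l (\<lambda>(p, q). \<Sum>i<n. cnj (b $ i) * block_column n l ?x $$ (i * l + p, q)))"
        "q < dim_col (mat l l (\<lambda>(p, q). \<Sum>i<n. cnj (b $ i) * block_column n l ?x $$ (i * l + p, q)))"
      then have pq: "p < l" "q < l" by auto
      have "msum l (\<lambda>i. cnj (b $ i) \<cdot>\<^sub>m ?x i) n $$ (p, q) = (\<Sum>i<n. (cnj (b $ i) \<cdot>\<^sub>m ?x i) $$ (p, q))"
        using pq xc by (intro msum_entry) auto
      also have "\<dots> = (\<Sum>i<n. cnj (b $ i) * block_column n l ?x $$ (i * l + p, q))"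
        using pq by (intro sum.cong refl) (simp add: block_column_entry carrier_matD[OF xc])
      finally show "msum l (\<lambda>i. cnj (b $ i) \<cdot>\<^sub>m ?x i) n $$ (p, q) =
        mat l l (\<lambda>(p, q). \<Sum>i<n. cnj (b $ i) * block_column n l ?x $$ (i * l + p, q)) $$ (p, q)"
        using pq by simp
    next
      have "msum l (\<lambda>i. cnj (b $ i) \<cdot>\<^sub>m ?x i) n \<in> carrier_mat l l"
        using xc by (intro msum_carrier) auto
      then show "dim_row (msum l (\<lambda>i. cnj (b $ i) \<cdot>\<^sub>m ?x i) n) =
          dim_row (mat l l (\<lambda>(p, q). \<Sum>i<n. cnj (b $ i) * block_column n l ?x $$ (i * l + p, q)))"
        "dim_col (msum l (\<lambda>i. cnj (b $ i) \<cdot>\<^sub>m ?x i) n) =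
          dim_col (mat l l (\<lambda>(p, q). \<Sum>i<n. cnj (b $ i) * block_column n l ?x $$ (i * l + p, q)))"
        by auto
    qed
    also have "\<dots> = (mat_adjoint (mat_of_cols n [b]) \<otimes>\<^sub>m 1\<^sub>m l) * K' * ?C0"
      using realization_value[OF K' b c block_column_carrier, of ?x] PV V by simp
    finally show "\<exists>K'. mat_inverse ?P = Some K' \<and>
      nc_val l Y e = (mat_adjoint (mat_of_cols n [b]) \<otimes>\<^sub>m 1\<^sub>m l) * K' * ?C0"
      using K' by blast
  qed
qed

text \<open>The class of the expression found at the zero tuple contains the expressions found at all
  other tuples \<open>X\<close>. They agree wherever both are defined, since both compute the realization
  formula. That their domains meet is seen on the line from zero to \<open>X\<close>, where each of them is
  defined at one end.\<close>

lemma nc_realization_exists: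
  fixes A :: "'d::finite \<Rightarrow> complex mat"
  assumes A: "\<forall>j. A j \<in> carrier_mat n n" and b: "b \<in> carrier_vec n" and c: "c \<in> carrier_vec n"
  obtains \<rr> where "\<rr> \<in> nc_rational_functions" "nc_realization \<rr> n A b c" "(1, \<lambda>_. 0\<^sub>m 1 1) \<in> nc_dom \<rr>"
proof -
  let ?Z = "\<lambda>_::'d. 0\<^sub>m 1 1 :: complex mat"
  \<comment> \<open>Expressions that compute the realization formula wherever they are defined.\<close>
  define good where "good e \<longleftrightarrow> (\<forall>l Y. (l, Y) \<in> mat_tuples \<longrightarrow> nc_defined l Y e \<longrightarrow>
    (\<exists>K'. mat_inverse (linear_pencil n A l Y) = Some K' \<and>
      nc_val l Y e = (mat_adjoint (mat_of_cols n [b]) \<otimes>\<^sub>m 1\<^sub>m l) * K' * (mat_of_cols n [c] \<otimes>\<^sub>m 1\<^sub>m l)))" for e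
  have Z: "(1, ?Z) \<in> mat_tuples" by (simp add: mat_tuples_def)
  have "linear_pencil n A 1 ?Z = 1\<^sub>m (n * 1)"
  proof (rule block_eq_matI[of _ n 1 n 1])
    fix i p j q :: nat assume i: "i < n" "p < 1" "j < n" "q < 1"
    then show "linear_pencil n A 1 ?Z $$ (i * 1 + p, j * 1 + q) = 1\<^sub>m (n * 1) $$ (i * 1 + p, j * 1 + q)"
      using linear_pencil_entry[OF A _ i, of ?Z] by simp
  qed (use linear_pencil_carrier[of n A 1 ?Z] in simp_all)
  then have "mat_inverse (linear_pencil n A 1 ?Z) = Some (1\<^sub>m n)"
    using mat_inverse_eq_SomeI[of "1\<^sub>m n" n "1\<^sub>m n"] by simp
  from realization_expression[OF A b c Z this]
  obtain e0 where e0: "nc_defined 1 ?Z e0" "good e0" unfolding good_def by blast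
  have same: "nc_val l Y e = nc_val l Y e'"
    if "good e" "good e'" "(l, Y) \<in> mat_tuples" "nc_defined l Y e" "nc_defined l Y e'" for l Y e e'
    using that unfolding good_def by fastforce
  have dom: "(l, Y) \<in> nc_expr_dom e \<longleftrightarrow> (l, Y) \<in> mat_tuples \<and> nc_defined l Y e" for l and Y :: "'d \<Rightarrow> complex mat" and e
    by (simp add: nc_expr_dom_def nc_defined_def)
  have ev: "nc_expr_eval l Y e = Some (nc_val l Y e)" if "nc_defined l Y e" for l and Y :: "'d \<Rightarrow> complex mat" and e
    using that by (auto simp: nc_defined_def nc_val_def)
  have equiv: "(e0, e) \<in> nc_expr_equiv" if e: "good e" "(m, X) \<in> mat_tuples" "nc_defined m X e" for e m X
  proof -
    have X: "0 < m" "\<forall>j. X j \<in> carrier_mat m m" using e(2) by (auto simp: mat_tuples_def)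
    define Z' where "Z' = (\<lambda>j. 1\<^sub>m m \<otimes>\<^sub>m ?Z j)"
    have Z'c: "\<forall>j. Z' j \<in> carrier_mat m m"
      using kronecker_carrier[OF one_carrier_mat[of m] zero_carrier_mat[of 1 1]] by (simp add: Z'_def)
    have "nc_expr_eval (m * 1) Z' e0 \<noteq> None"
      using nc_expr_eval_ampliation[of ?Z 1 e0 _ m] e0(1) unfolding nc_defined_def Z'_def by auto
    then have 0: "\<exists>t. nc_expr_eval m (mat_line m Z' X t) e0 \<noteq> None"
      by (intro exI[of _ 0]) (simp add: mat_line_0[OF Z'c])
    have 1: "\<exists>t. nc_expr_eval m (mat_line m Z' X t) e \<noteq> None"
      using e(3) by (intro exI[of _ 1]) (simp add: mat_line_1[OF X(2)] nc_defined_def)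
    have "finite ({t. nc_expr_eval m (mat_line m Z' X t) e0 = None} \<union> {t. nc_expr_eval m (mat_line m Z' X t) e = None})"
      using nc_expr_eval_line[of m Z' X e0] nc_expr_eval_line[of m Z' X e] 0 1 by blast
    then obtain t where "t \<notin> {t. nc_expr_eval m (mat_line m Z' X t) e0 = None} \<union> {t. nc_expr_eval m (mat_line m Z' X t) e = None}"
      using infinite_UNIV_char_0[where 'a = complex] by (metis ex_new_if_finite)
    then have "(m, mat_line m Z' X t) \<in> nc_expr_dom e0 \<inter> nc_expr_dom e"
      using X by (auto simp: dom nc_defined_def mat_tuples_def mat_line_carrier)
    moreover have "\<forall>(l, Y)\<in>nc_expr_dom e0 \<inter> nc_expr_dom e. nc_expr_eval l Y e0 = nc_expr_eval l Y e"
      using same[OF e0(2) e(1)] by (auto simp: dom ev)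
    ultimately show ?thesis unfolding nc_expr_equiv_def by blast
  qed
  define \<rr> where "\<rr> = nc_expr_equiv `` {e0}"
  show thesis
  proof (rule that[of \<rr>])
    have d0: "(1, ?Z) \<in> nc_expr_dom e0" using Z e0 dom by simp
    then show "\<rr> \<in> nc_rational_functions"
      unfolding nc_rational_functions_def \<rr>_def by (intro quotientI) auto
    have "e0 \<in> \<rr>" using equiv[OF e0(2) Z e0(1)] by (simp add: \<rr>_def)
    then show "(1, ?Z) \<in> nc_dom \<rr>" using d0 by (auto simp: nc_dom_def)
    show "nc_realization \<rr> n A b c"
      unfolding nc_realization_def
    proof (intro conjI ballI A b c, clarify)
      fix m X K assume X: "(m, X) \<in> (mat_tuples :: (nat \<times> ('d \<Rightarrow> complex mat)) set)"
        and K: "mat_inverse (linear_pencil n A m X) = Some K"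
      from realization_expression[OF A b c X K]
      obtain e where e: "nc_defined m X e" "good e" unfolding good_def by blast
      then have "nc_val m X e = (mat_adjoint (mat_of_cols n [b]) \<otimes>\<^sub>m 1\<^sub>m m) * K * (mat_of_cols n [c] \<otimes>\<^sub>m 1\<^sub>m m)"
        using X K unfolding good_def by fastforce
      then show "nc_value \<rr> m X ((mat_adjoint (mat_of_cols n [b]) \<otimes>\<^sub>m 1\<^sub>m m) * K * (mat_of_cols n [c] \<otimes>\<^sub>m 1\<^sub>m m))"
        unfolding nc_value_def using equiv[OF e(2) X e(1)] e(1) X ev[OF e(1)] dom
        by (intro bexI[of _ e]) (auto simp: \<rr>_def)
    qed
  qed
qed

section \<open>The Hilbert space of square-summable families\<close>

lemma ell2_nth_minus: "ell2_nth (x - y) i = ell2_nth x i - ell2_nth y i"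
  unfolding minus_ell2_def plus_ell2.rep_eq uminus_ell2.rep_eq by simp

lemmas ell2_nth_simps = ell2_nth_minus plus_ell2.rep_eq uminus_ell2.rep_eq zero_ell2.rep_eq scaleC.rep_eq

lemma norm_ell2_sq: "(norm x)\<^sup>2 = (\<Sum>\<^sub>\<infinity>i. (cmod (ell2_nth x i))\<^sup>2)"
  unfolding norm_ell2_def by (intro real_sqrt_pow2 infsum_nonneg) simp

lemma norm_ell2_has_sum: "((\<lambda>i. (cmod (ell2_nth x i))\<^sup>2) has_sum (norm x)\<^sup>2) UNIV"
  unfolding norm_ell2_sq by (rule has_sum_infsum[OF ell2_nth_summable])

lemma ell2_sum_le_norm:
  assumes "finite F" shows "(\<Sum>i\<in>F. (cmod (ell2_nth x i))\<^sup>2) \<le> (norm x)\<^sup>2"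
  unfolding norm_ell2_sq by (rule finite_sum_le_infsum[OF ell2_nth_summable assms]) auto

lemma ell2_nth_le_norm: "cmod (ell2_nth x i) \<le> norm x"
  using ell2_sum_le_norm[of "{i}" x] by (simp add: power2_le_iff_abs_le)

lemma ell2_of_bounded_sums:
  fixes f :: "'a \<Rightarrow> complex"
  assumes "\<And>F. finite F \<Longrightarrow> (\<Sum>i\<in>F. (cmod (f i))\<^sup>2) \<le> C\<^sup>2" "0 \<le> C"
  obtains x where "\<And>i. ell2_nth x i = f i" "norm x \<le> C"
proof -
  have s: "(\<lambda>i. (cmod (f i))\<^sup>2) summable_on UNIV"
  proof (rule nonneg_bdd_above_summable_on)
    show "bdd_above (sum (\<lambda>i. (cmod (f i))\<^sup>2) ` {F. F \<subseteq> UNIV \<and> finite F})"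
      using assms(1) by (auto intro!: bdd_aboveI[of _ "C\<^sup>2"])
  qed simp
  then have nth: "ell2_nth (Abs_ell2 f) i = f i" for i by (simp add: Abs_ell2_inverse)
  have "(norm (Abs_ell2 f))\<^sup>2 \<le> C\<^sup>2"
    unfolding norm_ell2_sq nth by (rule infsum_le_finite_sums[OF s]) (simp add: assms)
  then have "norm (Abs_ell2 f) \<le> C" using assms(2) by (rule power2_le_imp_le)
  with nth show thesis by (rule that)
qed

lemma cinner_commute: "cinner y x = cnj (cinner x y)"
  unfolding cinner_def infsum_cnj[symmetric] by (intro infsum_cong) simp

lemma cinner_add_left: "cinner (x + y) z = cinner x z + cinner y z"
  unfolding cinner_def plus_ell2.rep_eq distrib_right by (intro infsum_add cinner_summable)

lemma cinner_scaleC_left: "cinner (c *\<^sub>C x) y = c * cinner x y"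
  unfolding cinner_def scaleC.rep_eq mult.assoc by (rule infsum_cmult_right')

lemma cinner_add_right: "cinner z (x + y) = cinner z x + cinner z y"
  by (metis cinner_commute cinner_add_left complex_cnj_add)

lemma cinner_scaleC_right: "cinner y (c *\<^sub>C x) = cnj c * cinner y x"
  by (metis cinner_commute cinner_scaleC_left complex_cnj_mult)

lemma cinner_zero [simp]: "cinner 0 y = 0" "cinner x 0 = 0"
  by (simp_all add: cinner_def zero_ell2.rep_eq)

lemma cinner_minus_left: "cinner (- x) y = - cinner x y"
  using cinner_add_left[of x "- x" y] by (simp add: eq_neg_iff_add_eq_0 add.commute)

lemma cinner_diff_left: "cinner (x - y) z = cinner x z - cinner y z"
  using cinner_add_left[of x "- y" z] by (simp add: cinner_minus_left)

lemma cinner_diff_right: "cinner z (x - y) = cinner z x - cinner z y"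
  by (metis cinner_commute cinner_diff_left complex_cnj_diff)

lemma cinner_sum_left: "cinner (\<Sum>i\<in>F. g i) y = (\<Sum>i\<in>F. cinner (g i) y)"
  by (induction F rule: infinite_finite_induct) (simp_all add: cinner_add_left)

lemma cinner_sum_right: "cinner y (\<Sum>i\<in>F. g i) = (\<Sum>i\<in>F. cinner y (g i))"
  by (induction F rule: infinite_finite_induct) (simp_all add: cinner_add_right)

lemma cinner_self: "cinner x x = complex_of_real ((norm x)\<^sup>2)"
proof -
  have "Re (cinner x x) = (norm x)\<^sup>2"
    using dot_square_norm[of x] by (simp add: inner_ell2_def)
  moreover have "Im (cinner x x) = 0"
    using arg_cong[OF cinner_commute[of x x], of Im] by simp
  ultimately show ?thesis by (simp add: complex_eq_iff)
qed

lemma cinner_Cauchy_Schwarz: "cmod (cinner x y) \<le> norm x * norm y"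
proof (cases "cinner x y = 0")
  case False
  define u where "u = cnj (cinner x y) / complex_of_real (cmod (cinner x y))"
  have "u * cinner x y = (cinner x y * cnj (cinner x y)) / complex_of_real (cmod (cinner x y))"
    by (simp add: u_def mult.commute)
  also have "\<dots> = complex_of_real (cmod (cinner x y))"
    unfolding complex_norm_square[symmetric] using False by (simp add: power2_eq_square)
  finally have "Re (cinner (u *\<^sub>C x) y) = cmod (cinner x y)" by (simp add: cinner_scaleC_left)
  moreover have "Re (cinner (u *\<^sub>C x) y) \<le> norm (u *\<^sub>C x) * norm y"
    using norm_cauchy_schwarz[of "u *\<^sub>C x" y] by (simp add: inner_ell2_def)
  moreover have "cmod u = 1" using False by (simp add: u_def norm_divide)
  ultimately show ?thesis by (simp add: norm_scaleC)
qed simp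

lemma scaleR_scaleC: "r *\<^sub>R (x :: 'a ell2) = complex_of_real r *\<^sub>C x"
  by (simp add: scaleR_ell2_def)

lemma bounded_linear_cinner_left: "bounded_linear (\<lambda>x. cinner x y)"
  by (rule bounded_linear_intro[of _ "norm y"])
    (simp_all add: cinner_add_left scaleR_scaleC cinner_scaleC_left scaleR_conv_of_real cinner_Cauchy_Schwarz)

lemma bounded_linear_ell2_nth: "bounded_linear (\<lambda>x. ell2_nth x i)"
  using bounded_linear_cinner_left[of "ell2_unit i"] by (simp add: cinner_unit)

lemma cinner_unit_left: "cinner (ell2_unit i) x = cnj (ell2_nth x i)"
  by (metis cinner_commute cinner_unit)

lemma ell2_eqI_cinner:
  assumes "\<And>z. cinner z x = cinner z y"
  shows "x = y"
  by (rule ell2_eqI) (metis assms cinner_unit_left complex_cnj_cancel_iff)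

lemma cinner_has_sum: "((\<lambda>i. ell2_nth x i * cnj (ell2_nth y i)) has_sum cinner x y) UNIV"
  unfolding cinner_def by (rule has_sum_infsum[OF cinner_summable])

instance ell2 :: (type) banach
proof
  fix X :: "nat \<Rightarrow> 'a ell2" assume X: "Cauchy X"
  have "Cauchy (\<lambda>n. ell2_nth (X n) i)" for i
    by (rule bounded_linear.Cauchy[OF bounded_linear_ell2_nth X])
  then have "\<forall>i. \<exists>l. (\<lambda>n. ell2_nth (X n) i) \<longlonglongrightarrow> l"
    by (auto simp: Cauchy_convergent_iff convergent_def)
  then obtain l where l: "\<And>i. (\<lambda>n. ell2_nth (X n) i) \<longlonglongrightarrow> l i" by metis
  have tail: "\<exists>z. (\<forall>i. ell2_nth z i = l i - ell2_nth (X n) i) \<and> norm z \<le> e"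
    if M: "\<forall>m\<ge>M. \<forall>n\<ge>M. dist (X m) (X n) < e" and n: "n \<ge> M" and e: "e > 0" for M n e
  proof -
    have "(\<Sum>i\<in>F. (cmod (l i - ell2_nth (X n) i))\<^sup>2) \<le> e\<^sup>2" if "finite F" for F
    proof (rule LIMSEQ_le_const2)
      show "(\<lambda>m. \<Sum>i\<in>F. (cmod (ell2_nth (X m) i - ell2_nth (X n) i))\<^sup>2) \<longlonglongrightarrow>
          (\<Sum>i\<in>F. (cmod (l i - ell2_nth (X n) i))\<^sup>2)"
        by (intro tendsto_intros l)
      have "(\<Sum>i\<in>F. (cmod (ell2_nth (X m) i - ell2_nth (X n) i))\<^sup>2) \<le> e\<^sup>2" if "m \<ge> M" for m
      proof -
        have "(\<Sum>i\<in>F. (cmod (ell2_nth (X m - X n) i))\<^sup>2) \<le> (norm (X m - X n))\<^sup>2"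
          by (rule ell2_sum_le_norm[OF \<open>finite F\<close>])
        also have "\<dots> \<le> e\<^sup>2"
          using M that n by (intro power_mono) (auto simp: dist_norm intro: less_imp_le)
        finally show ?thesis by (simp add: ell2_nth_minus)
      qed
      then show "\<exists>N. \<forall>m\<ge>N. (\<Sum>i\<in>F. (cmod (ell2_nth (X m) i - ell2_nth (X n) i))\<^sup>2) \<le> e\<^sup>2" by blast
    qed
    then obtain z where "\<And>i. ell2_nth z i = l i - ell2_nth (X n) i" "norm z \<le> e"
      using ell2_of_bounded_sums[of "\<lambda>i. l i - ell2_nth (X n) i" e] e by auto
    then show ?thesis by blast
  qed
  have "\<exists>M. \<forall>m\<ge>M. \<forall>n\<ge>M. dist (X m) (X n) < 1"
    by (rule X[unfolded Cauchy_def, rule_format]) simp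
  then obtain M where M: "\<forall>m\<ge>M. \<forall>n\<ge>M. dist (X m) (X n) < 1" ..
  have "\<exists>z. (\<forall>i. ell2_nth z i = l i - ell2_nth (X M) i) \<and> norm z \<le> 1"
    by (rule tail[OF M order_refl]) simp
  then obtain z where z: "\<And>i. ell2_nth z i = l i - ell2_nth (X M) i" by blast
  have lim: "ell2_nth (z + X M) i = l i" for i by (simp add: plus_ell2.rep_eq z)
  have "X \<longlonglongrightarrow> z + X M"
  proof (rule LIMSEQ_I)
    fix e :: real assume e: "e > 0"
    then obtain M' where M': "\<forall>m\<ge>M'. \<forall>n\<ge>M'. dist (X m) (X n) < e / 2"
      using X[unfolded Cauchy_def, rule_format, OF half_gt_zero[OF e]] by blast
    have "norm (X n - (z + X M)) < e" if "n \<ge> M'" for n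
    proof -
      have "\<exists>w. (\<forall>i. ell2_nth w i = l i - ell2_nth (X n) i) \<and> norm w \<le> e / 2"
        by (rule tail[OF M' that half_gt_zero[OF e]])
      then obtain w where w: "\<And>i. ell2_nth w i = l i - ell2_nth (X n) i" "norm w \<le> e / 2" by blast
      have "w = - (X n - (z + X M))"
        by (rule ell2_eqI) (simp add: w(1) ell2_nth_minus uminus_ell2.rep_eq lim)
      then have "norm (X n - (z + X M)) = norm w" by (simp add: norm_minus_commute)
      then show ?thesis using w(2) e by simp
    qed
    then show "\<exists>no. \<forall>n\<ge>no. norm (X n - (z + X M)) < e" by blast
  qed
  then show "convergent X" by (auto simp: convergent_def)
qed

section \<open>Adjoints\<close>

lemma bounded_opsI: "(\<And>c x. blinfun_apply T (c *\<^sub>C x) = c *\<^sub>C blinfun_apply T x) \<Longrightarrow> T \<in> bounded_ops"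
  by (auto simp: bounded_ops_def blinfun_eq_iff scalar_op.rep_eq)

lemma ell2_functional_eqI:
  fixes \<phi> \<psi> :: "'a ell2 \<Rightarrow> complex"
  assumes "bounded_linear \<phi>" "bounded_linear \<psi>"
    and "\<And>c x. \<phi> (c *\<^sub>C x) = c * \<phi> x" "\<And>c x. \<psi> (c *\<^sub>C x) = c * \<psi> x"
    and eq: "\<And>i. \<phi> (ell2_unit i) = \<psi> (ell2_unit i)"
  shows "\<phi> x = \<psi> x"
proof -
  have "((\<lambda>i. \<phi> (ell2_nth x i *\<^sub>C ell2_unit i)) has_sum \<phi> x) UNIV"
    "((\<lambda>i. \<psi> (ell2_nth x i *\<^sub>C ell2_unit i)) has_sum \<psi> x) UNIV"
    using assms(1,2) by (auto intro: has_sum_bounded_linear ell2_unit_has_sum simp del: has_sum_bounded_linear)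
  then show ?thesis unfolding assms(3,4) eq by (rule has_sum_unique)
qed

text \<open>The coordinates of \<open>S y\<close> are prescribed. Their square sums are bounded by testing \<open>T\<close> on the
  vector made of finitely many of these coordinates.\<close>

lemma bounded_ops_adjoint:
  fixes T :: "'a ell2 \<Rightarrow>\<^sub>L 'a ell2"
  assumes T: "T \<in> bounded_ops"
  obtains S where "S \<in> bounded_ops"
    "\<And>x y. cinner (blinfun_apply T x) y = cinner x (blinfun_apply S y)"
proof -
  have "\<forall>y. \<exists>z. (\<forall>x. cinner (blinfun_apply T x) y = cinner x z) \<and> norm z \<le> norm y * norm T"
  proof
    fix y
    define f where "f i = cnj (cinner (blinfun_apply T (ell2_unit i)) y)" for i
    have "(\<Sum>i\<in>F. (cmod (f i))\<^sup>2) \<le> (norm y * norm T)\<^sup>2" if F: "finite F" for F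
    proof -
      define s where "s = (\<Sum>i\<in>F. (cmod (f i))\<^sup>2)"
      define z where "z = (\<Sum>i\<in>F. f i *\<^sub>C ell2_unit i)"
      have nth_z: "ell2_nth z i = f i" if "i \<in> F" for i
      proof -
        have "ell2_nth z i = (\<Sum>j\<in>F. if j = i then f j else 0)"
          unfolding z_def ell2_nth_sum by (intro sum.cong refl) (auto simp: scaleC.rep_eq ell2_unit.rep_eq)
        then show ?thesis using F that by simp
      qed
      have "cinner z z = (\<Sum>i\<in>F. cnj (f i) * ell2_nth z i)"
        by (subst (2) z_def) (simp add: cinner_sum_right cinner_scaleC_right cinner_unit)
      also have "\<dots> = (\<Sum>i\<in>F. f i * cnj (f i))"
        by (intro sum.cong refl) (simp add: nth_z mult.commute)
      also have "\<dots> = complex_of_real s"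
        by (simp add: s_def complex_norm_square flip: of_real_power)
      finally have nz: "(norm z)\<^sup>2 = s" by (simp add: cinner_self of_real_eq_iff flip: of_real_power)
      have "cinner (blinfun_apply T z) y = (\<Sum>i\<in>F. f i * cnj (f i))"
        by (simp add: z_def blinfun.sum_right bounded_ops_scaleC[OF T] cinner_sum_left cinner_scaleC_left f_def)
      also have "\<dots> = complex_of_real s"
        by (simp add: s_def complex_norm_square flip: of_real_power)
      finally have "\<bar>s\<bar> = cmod (cinner (blinfun_apply T z) y)" by simp
      also have "\<dots> \<le> norm (blinfun_apply T z) * norm y" by (rule cinner_Cauchy_Schwarz)
      also have "\<dots> \<le> (norm T * norm z) * norm y" by (intro mult_right_mono norm_blinfun) simp
      finally have "norm z * norm z \<le> norm z * (norm y * norm T)"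
        using nz by (simp add: power2_eq_square mult_ac)
      then have "norm z \<le> norm y * norm T"
        by (cases "norm z = 0") (auto simp: mult_le_cancel_left)
      then show ?thesis unfolding s_def[symmetric] nz[symmetric] by (intro power_mono) auto
    qed
    then obtain z where z: "\<And>i. ell2_nth z i = f i" "norm z \<le> norm y * norm T"
      using ell2_of_bounded_sums[of f "norm y * norm T"] by auto
    have "cinner (blinfun_apply T x) y = cinner x z" for x
    proof (rule ell2_functional_eqI[where \<phi> = "\<lambda>x. cinner (blinfun_apply T x) y"])
      show "bounded_linear (\<lambda>x. cinner (blinfun_apply T x) y)"
        by (rule bounded_linear_compose[OF bounded_linear_cinner_left blinfun.bounded_linear_right])
    qed (simp_all add: bounded_linear_cinner_left bounded_ops_scaleC[OF T] cinner_scaleC_left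
        cinner_unit_left z f_def)
    with z show "\<exists>z. (\<forall>x. cinner (blinfun_apply T x) y = cinner x z) \<and> norm z \<le> norm y * norm T" by blast
  qed
  from choice[OF this] obtain S where
    S: "\<And>x y. cinner (blinfun_apply T x) y = cinner x (S y)" "\<And>y. norm (S y) \<le> norm y * norm T"
    by blast
  have "S (x + y) = S x + S y" for x y
    by (rule ell2_eqI_cinner) (simp add: S(1)[symmetric] cinner_add_right)
  moreover have sc: "S (c *\<^sub>C x) = c *\<^sub>C S x" for c x
    by (rule ell2_eqI_cinner) (simp add: S(1)[symmetric] cinner_scaleC_right)
  ultimately have "bounded_linear S"
    using S(2) by (intro bounded_linear_intro[of _ "norm T"]) (auto simp: scaleR_scaleC)
  then have "blinfun_apply (Blinfun S) = S" by (rule bounded_linear_Blinfun_apply)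
  then show thesis using that[of "Blinfun S"] S(1) sc by (simp add: bounded_opsI)
qed

lemma adjoint_eq_cinner:
  assumes "\<And>x y. cinner (f x) y = cinner x (g y)"
  shows "adjoint f = g"
  by (rule adjoint_unique) (simp add: inner_ell2_def assms)

section \<open>Right shifts and their adjoints\<close>

lemma right_shift_apply: "blinfun_apply (right_shift k) f = right_shift_fun k f"
  by (simp add: right_shift.rep_eq)

text \<open>The adjoint of right multiplication by the word \<open>\<beta>\<close>, see \<open>cinner_right_append\<close>.\<close>

lift_definition right_tail :: "'d list \<Rightarrow> 'd list ell2 \<Rightarrow> 'd list ell2" is "\<lambda>\<beta> f \<alpha>. f (\<alpha> @ \<beta>)"
proof -
  fix \<beta> :: "'d list" and f :: "'d list \<Rightarrow> complex"
  assume "(\<lambda>i. (cmod (f i))\<^sup>2) summable_on UNIV"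
  then have "(\<lambda>i. (cmod (f i))\<^sup>2) summable_on range (\<lambda>\<alpha>. \<alpha> @ \<beta>)" by (rule summable_on_subset_banach) simp
  then show "(\<lambda>\<alpha>. (cmod (f (\<alpha> @ \<beta>)))\<^sup>2) summable_on UNIV"
    by (subst (asm) summable_on_reindex) (auto simp: inj_on_def o_def)
qed

text \<open>Right multiplication by the word \<open>\<beta>\<close>. The first letter of \<open>\<beta>\<close> is appended first.\<close>

primrec right_append :: "'d list \<Rightarrow> 'd list ell2 \<Rightarrow> 'd list ell2" where
  "right_append [] f = f"
| "right_append (k # \<beta>) f = right_append \<beta> (right_shift_fun k f)"

lemma right_tail_append: "right_tail \<beta> (right_tail \<gamma> f) = right_tail (\<beta> @ \<gamma>) f"
  by (rule ell2_eqI) (simp add: right_tail.rep_eq)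

lemma right_tail_add: "right_tail \<beta> (f + g) = right_tail \<beta> f + right_tail \<beta> g"
  and right_tail_diff: "right_tail \<beta> (f - g) = right_tail \<beta> f - right_tail \<beta> g"
  and right_tail_scaleC: "right_tail \<beta> (c *\<^sub>C f) = c *\<^sub>C right_tail \<beta> f"
  and right_tail_Nil: "right_tail [] f = f"
  by (rule ell2_eqI, simp add: right_tail.rep_eq ell2_nth_simps)+

lemma right_append_append: "right_append (\<beta> @ \<gamma>) f = right_append \<gamma> (right_append \<beta> f)"
  by (induction \<beta> arbitrary: f) simp_all

lemma right_append_nth_append: "ell2_nth (right_append \<beta> f) (\<alpha> @ \<beta>) = ell2_nth f \<alpha>"
proof (induction \<beta> arbitrary: f \<alpha>)
  case (Cons k \<beta>)
  show ?case using Cons[of "right_shift_fun k f" "\<alpha> @ [k]"] by (simp add: right_shift_fun.rep_eq)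
qed simp

lemma right_append_nth_other: "\<nexists>\<alpha>. \<omega> = \<alpha> @ \<beta> \<Longrightarrow> ell2_nth (right_append \<beta> f) \<omega> = 0"
proof (induction \<beta> arbitrary: f)
  case (Cons k \<beta>)
  show ?case
  proof (cases "\<exists>\<alpha>. \<omega> = \<alpha> @ \<beta>")
    case True
    then obtain \<alpha> where \<alpha>: "\<omega> = \<alpha> @ \<beta>" by blast
    have "\<not> (\<alpha> \<noteq> [] \<and> last \<alpha> = k)"
    proof
      assume "\<alpha> \<noteq> [] \<and> last \<alpha> = k"
      then have "\<omega> = butlast \<alpha> @ k # \<beta>" using \<alpha> append_butlast_last_id[of \<alpha>] by (metis append.assoc append_Cons append_Nil)
      then show False using Cons.prems by blast
    qed
    then show ?thesis by (auto simp: \<alpha> right_append_nth_append right_shift_fun.rep_eq)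
  qed (simp add: Cons.IH)
qed simp

lemma cinner_right_shift: "cinner (right_shift_fun k f) g = cinner f (right_tail [k] g)"
proof -
  have "((\<lambda>\<alpha>. ell2_nth (right_shift_fun k f) \<alpha> * cnj (ell2_nth g \<alpha>)) has_sum cinner f (right_tail [k] g)) (range (\<lambda>\<alpha>. \<alpha> @ [k]))"
    using cinner_has_sum[of f "right_tail [k] g"]
    by (subst has_sum_reindex) (auto simp: inj_on_def o_def right_shift_fun.rep_eq right_tail.rep_eq)
  then have "((\<lambda>\<alpha>. ell2_nth (right_shift_fun k f) \<alpha> * cnj (ell2_nth g \<alpha>)) has_sum cinner f (right_tail [k] g)) UNIV"
    by (rule has_sum_cong_neutral[THEN iffD1, rotated -1])
      (auto simp: right_shift_fun.rep_eq image_iff dest: append_butlast_last_id[symmetric])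
  then show ?thesis using cinner_has_sum has_sum_unique by blast
qed

lemma cinner_right_append: "cinner (right_append \<beta> f) g = cinner f (right_tail \<beta> g)"
  by (induction \<beta> arbitrary: f)
    (simp_all add: right_tail_Nil cinner_right_shift right_tail_append)

lemma op_word_right_shift: "blinfun_apply (op_word right_shift \<alpha>) f = right_append (rev \<alpha>) f"
  by (induction \<alpha>) (simp_all add: op_word_def right_append_append right_shift_apply)

lemma right_append_unit: "right_append \<beta> (ell2_unit []) = ell2_unit \<beta>"
proof (rule ell2_eqI)
  fix \<omega>
  show "ell2_nth (right_append \<beta> (ell2_unit [])) \<omega> = ell2_nth (ell2_unit \<beta>) \<omega>"
  proof (cases "\<exists>\<alpha>. \<omega> = \<alpha> @ \<beta>")
    case True
    then obtain \<alpha> where "\<omega> = \<alpha> @ \<beta>" by blast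
    then show ?thesis by (simp add: right_append_nth_append ell2_unit.rep_eq)
  next
    case False
    then have "\<omega> \<noteq> \<beta>" by (metis append_Nil)
    then show ?thesis using False by (simp add: right_append_nth_other ell2_unit.rep_eq)
  qed
qed

lemma finite_words: "finite {\<alpha> :: 'd::finite list. length \<alpha> = k}"
  using finite_lists_length_eq[of "UNIV :: 'd set" k] by simp

lemma words_Suc: "{\<alpha> :: 'd list. length \<alpha> = Suc k} = (\<Union>j. (#) j ` {\<alpha>. length \<alpha> = k})"
  by (auto simp: length_Suc_conv image_iff)

lemma sum_words_Suc:
  fixes g :: "'d::finite list \<Rightarrow> 'b::comm_monoid_add"
  shows "(\<Sum>\<alpha> | length \<alpha> = Suc k. g \<alpha>) = (\<Sum>j\<in>UNIV. \<Sum>\<alpha> | length \<alpha> = k. g (j # \<alpha>))"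
  unfolding words_Suc
  by (subst sum.UNION_disjoint) (auto simp: finite_words sum.reindex)

section \<open>Left multipliers and the inner-outer factorization\<close>

lemma hardy_op_right_append:
  assumes T: "T \<in> hardy_ops"
  shows "blinfun_apply T (right_append \<beta> f) = right_append \<beta> (blinfun_apply T f)"
proof (induction \<beta> arbitrary: f)
  case (Cons k \<beta>)
  have "blinfun_apply T (right_shift_fun k f) = right_shift_fun k (blinfun_apply T f)"
    using arg_cong[OF hardy_ops_commute(2)[OF T, of k], of "\<lambda>S. blinfun_apply S f"]
    by (simp add: right_shift_apply)
  then show ?case using Cons by simp
qed simp

lemma hardy_op_unit:
  assumes "T \<in> hardy_ops"
  shows "blinfun_apply T (ell2_unit \<beta>) = right_append \<beta> (blinfun_apply T (ell2_unit []))"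
  using hardy_op_right_append[OF assms, of \<beta> "ell2_unit []"] by (simp add: right_append_unit)

text \<open>Left multipliers commute with right shifts, so they are determined by the image of the unit
  word. Both sides are bounded linear in \<open>f\<close>, and on words the formula is clear.\<close>

lemma hardy_op_nth:
  assumes T: "T \<in> hardy_ops"
  shows "ell2_nth (blinfun_apply T f) \<omega> =
    (\<Sum>i\<le>length \<omega>. ell2_nth (blinfun_apply T (ell2_unit [])) (take i \<omega>) * ell2_nth f (drop i \<omega>))"
proof -
  define \<Theta> where "\<Theta> = blinfun_apply T (ell2_unit [])"
  show ?thesis unfolding \<Theta>_def[symmetric]
  proof (rule ell2_functional_eqI)
    show "bounded_linear (\<lambda>f. ell2_nth (blinfun_apply T f) \<omega>)"
      by (rule bounded_linear_compose[OF bounded_linear_ell2_nth blinfun.bounded_linear_right])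
    show "bounded_linear (\<lambda>f. \<Sum>i\<le>length \<omega>. ell2_nth \<Theta> (take i \<omega>) * ell2_nth f (drop i \<omega>))"
      by (intro bounded_linear_sum bounded_linear_compose[OF bounded_linear_mult_right bounded_linear_ell2_nth])
  next
    fix c f
    show "ell2_nth (blinfun_apply T (c *\<^sub>C f)) \<omega> = c * ell2_nth (blinfun_apply T f) \<omega>"
      by (simp add: bounded_ops_scaleC[OF hardy_ops_commute(1)[OF T]] scaleC.rep_eq)
    show "(\<Sum>i\<le>length \<omega>. ell2_nth \<Theta> (take i \<omega>) * ell2_nth (c *\<^sub>C f) (drop i \<omega>)) =
        c * (\<Sum>i\<le>length \<omega>. ell2_nth \<Theta> (take i \<omega>) * ell2_nth f (drop i \<omega>))"
      by (simp add: scaleC.rep_eq sum_distrib_left mult_ac)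
  next
    fix \<beta>
    have l: "ell2_nth (blinfun_apply T (ell2_unit \<beta>)) \<omega> = ell2_nth (right_append \<beta> \<Theta>) \<omega>"
      by (simp add: hardy_op_unit[OF T, of \<beta>] \<Theta>_def)
    show "ell2_nth (blinfun_apply T (ell2_unit \<beta>)) \<omega> =
        (\<Sum>i\<le>length \<omega>. ell2_nth \<Theta> (take i \<omega>) * ell2_nth (ell2_unit \<beta>) (drop i \<omega>))"
    proof (cases "\<exists>\<alpha>. \<omega> = \<alpha> @ \<beta>")
      case True
      then obtain \<alpha> where \<alpha>: "\<omega> = \<alpha> @ \<beta>" by blast
      have "drop i \<omega> = \<beta> \<longleftrightarrow> i = length \<alpha>" if "i \<le> length \<omega>" for i
      proof
        assume "drop i \<omega> = \<beta>"
        then have "length (drop i \<omega>) = length \<beta>" by simp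
        then show "i = length \<alpha>" using that by (simp add: \<alpha>)
      qed (simp add: \<alpha>)
      then have "(\<Sum>i\<le>length \<omega>. ell2_nth \<Theta> (take i \<omega>) * ell2_nth (ell2_unit \<beta>) (drop i \<omega>)) =
        (\<Sum>i\<le>length \<omega>. if i = length \<alpha> then ell2_nth \<Theta> (take i \<omega>) else 0)"
        by (intro sum.cong refl) (simp add: ell2_unit.rep_eq)
      then show ?thesis unfolding l by (simp add: \<alpha> right_append_nth_append)
    next
      case False
      then have "drop i \<omega> \<noteq> \<beta>" for i by (metis append_take_drop_id)
      then show ?thesis unfolding l using False
        by (simp add: right_append_nth_other ell2_unit.rep_eq)
    qed
  qed
qed

text \<open>Polarization; the imaginary part comes from multiplying the first argument by \<open>\<i>\<close>.\<close>

lemma isometry_cinner: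
  assumes T: "T \<in> bounded_ops" and iso: "\<And>h. norm (blinfun_apply T h) = norm h"
  shows "cinner (blinfun_apply T x) (blinfun_apply T y) = cinner x y"
proof -
  have re: "Re (cinner (blinfun_apply T x) (blinfun_apply T y)) = Re (cinner x y)" for x y
    unfolding inner_ell2_def[symmetric] dot_norm by (simp add: iso flip: blinfun.add_right)
  have "Re (cinner (\<i> *\<^sub>C blinfun_apply T x) (blinfun_apply T y)) = Re (cinner (\<i> *\<^sub>C x) y)"
    using re[of "\<i> *\<^sub>C x" y] by (simp add: bounded_ops_scaleC[OF T])
  then have "Im (cinner (blinfun_apply T x) (blinfun_apply T y)) = Im (cinner x y)"
    by (simp add: cinner_scaleC_left)
  with re[of x y] show ?thesis by (simp add: complex_eq_iff)
qed

lemma inner_outer_operators: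
  assumes "nc_inner_outer_factorization r \<Theta> f"
  obtains T S where "T \<in> hardy_ops" "S \<in> bounded_ops" "mult_op \<Theta> = T"
    "blinfun_apply T (ell2_unit []) = \<Theta>" "blinfun_apply T f = r" "nc_outer f" "nc_inner \<Theta>"
    "\<And>x y. cinner (blinfun_apply T x) y = cinner x (blinfun_apply S y)"
    "\<And>x. blinfun_apply S (blinfun_apply T x) = x"
proof -
  from assms have inn: "nc_inner \<Theta>" and out: "nc_outer f" and r: "r = blinfun_apply (mult_op \<Theta>) f"
    by (auto simp: nc_inner_outer_factorization_def)
  from inn obtain T where T: "T \<in> hardy_ops" "blinfun_apply T (ell2_unit []) = \<Theta>"
    by (auto simp: nc_inner_def hardy_def)
  from mult_op_eq[OF T(1)] T(2) have mT: "mult_op \<Theta> = T" by simp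
  note Tb = hardy_ops_commute(1)[OF T(1)]
  from bounded_ops_adjoint[OF Tb] obtain S where S: "S \<in> bounded_ops"
    "\<And>x y. cinner (blinfun_apply T x) y = cinner x (blinfun_apply S y)" by blast
  have iso: "cinner (blinfun_apply T x) (blinfun_apply T y) = cinner x y" for x y
    using inn mT by (intro isometry_cinner[OF Tb]) (simp add: nc_inner_def)
  have "blinfun_apply S (blinfun_apply T x) = x" for x
    by (rule ell2_eqI_cinner) (simp add: S(2)[symmetric] iso)
  then show thesis using that[of T S] T S mT r out inn by simp
qed

text \<open>The form in which outerness is used: the right translates of \<open>f\<close> are total.\<close>

lemma outer_functional_zero:
  fixes \<phi> :: "'d list ell2 \<Rightarrow> complex"
  assumes f: "nc_outer f" and \<phi>: "bounded_linear \<phi>" "\<And>c x. \<phi> (c *\<^sub>C x) = c * \<phi> x"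
    and 0: "\<And>\<beta>. \<phi> (right_append \<beta> f) = 0"
  shows "\<phi> x = 0"
proof -
  interpret bounded_linear \<phi> by fact
  have "ell2.subspace {x. \<phi> x = 0}"
    by (rule ell2.subspaceI) (auto simp: add \<phi>(2) zero)
  moreover have "range (\<lambda>\<alpha>. blinfun_apply (op_word right_shift \<alpha>) f) \<subseteq> {x. \<phi> x = 0}"
    using 0 by (auto simp: op_word_right_shift)
  ultimately have "cspan (range (\<lambda>\<alpha>. blinfun_apply (op_word right_shift \<alpha>) f)) \<subseteq> {x. \<phi> x = 0}"
    by (intro ell2.span_minimal)
  moreover have "closed {x. \<phi> x = 0}"
    by (intro closed_Collect_eq continuous_on_const linear_continuous_on \<phi>(1))
  ultimately have "closure (cspan (range (\<lambda>\<alpha>. blinfun_apply (op_word right_shift \<alpha>) f))) \<subseteq> {x. \<phi> x = 0}"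
    by (rule closure_minimal)
  then show ?thesis using f by (auto simp: nc_outer_def)
qed

text \<open>Otherwise all right translates of \<open>f\<close>, and with them all series, would have no constant
  coefficient.\<close>

lemma outer_nth_Nil:
  assumes "nc_outer f" shows "ell2_nth f [] \<noteq> 0"
proof
  assume 0: "ell2_nth f [] = 0"
  have "ell2_nth (right_append \<beta> f) [] = 0" for \<beta>
    by (cases "\<beta> = []") (simp_all add: 0 right_append_nth_other)
  from outer_functional_zero[OF assms bounded_linear_ell2_nth _ this, of "ell2_unit []"]
  show False by (simp add: scaleC.rep_eq ell2_unit.rep_eq)
qed

lemma outer_factor_nth:
  assumes T: "T \<in> hardy_ops" and S: "\<And>x y. cinner (blinfun_apply T x) y = cinner x (blinfun_apply S y)"
    and "blinfun_apply S r = f"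
  shows "ell2_nth f \<beta> = cinner (right_tail \<beta> r) (blinfun_apply T (ell2_unit []))"
proof -
  have "ell2_nth f \<beta> = cnj (cinner (ell2_unit \<beta>) (blinfun_apply S r))"
    by (simp add: assms cinner_unit_left)
  also have "\<dots> = cnj (cinner (right_append \<beta> (blinfun_apply T (ell2_unit []))) r)"
    by (simp add: S[symmetric] hardy_op_unit[OF T, of \<beta>])
  also have "\<dots> = cinner (right_tail \<beta> r) (blinfun_apply T (ell2_unit []))"
    by (simp add: cinner_right_append cinner_commute[of "right_tail \<beta> r"])
  finally show ?thesis .
qed

section \<open>Linear relations\<close>

text \<open>A basis is chosen among the members of the family and is indexed by a set \<open>W\<close> of indices, so
  that coefficients can be transported to another family with the same index type.\<close>

lemma spanning_subfamily:
  fixes x :: "'w \<Rightarrow> 'b ell2"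
  shows "\<exists>W. inj_on x W \<and> ell2.independent (x ` W) \<and>
    (\<forall>\<omega>. \<exists>F u. finite F \<and> F \<subseteq> W \<and> x \<omega> = (\<Sum>\<beta>\<in>F. u \<beta> *\<^sub>C x \<beta>))"
proof -
  obtain B where B: "B \<subseteq> range x" "ell2.independent B" "range x \<subseteq> cspan B"
    by (rule ell2.maximal_independent_subset)
  then obtain W where W: "inj_on x W" "x ` W = B"
    using subset_image_inj[of B x UNIV] by blast
  have comb: "\<exists>F u. finite F \<and> F \<subseteq> W \<and> x \<omega> = (\<Sum>\<beta>\<in>F. u \<beta> *\<^sub>C x \<beta>)" for \<omega>
  proof -
    have "x \<omega> \<in> cspan B" using B by blast
    then obtain t u where t: "finite t" "t \<subseteq> B" "x \<omega> = (\<Sum>a\<in>t. u a *\<^sub>C a)"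
      unfolding ell2.span_explicit by blast
    then obtain F where F: "F \<subseteq> W" "inj_on x F" "t = x ` F"
      using subset_image_inj[of t x W] W(2) by blast
    then have fin: "finite F" using t finite_imageD by blast
    have e: "x \<omega> = (\<Sum>\<beta>\<in>F. u (x \<beta>) *\<^sub>C x \<beta>)"
      using t(3) F by (simp add: sum.reindex)
    show ?thesis
      by (intro exI[of _ F] exI[of _ "\<lambda>\<beta>. u (x \<beta>)"] conjI fin F(1) e)
  qed
  have ind: "ell2.independent (x ` W)" using W(2) B(2) by simp
  show ?thesis by (rule exI[of _ W]) (intro conjI allI W(1) ind comb)
qed

lemma finite_spanning_subfamily:
  fixes x :: "'w \<Rightarrow> 'b ell2"
  assumes "finite S" "\<And>\<omega>. x \<omega> \<in> cspan S"
  obtains W where "finite W" "\<And>\<omega>. \<exists>u. x \<omega> = (\<Sum>\<beta>\<in>W. u \<beta> *\<^sub>C x \<beta>)"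
proof -
  obtain W where W0: "inj_on x W \<and> ell2.independent (x ` W) \<and>
    (\<forall>\<omega>. \<exists>F u. finite F \<and> F \<subseteq> W \<and> x \<omega> = (\<Sum>\<beta>\<in>F. u \<beta> *\<^sub>C x \<beta>))"
    using spanning_subfamily[of x] ..
  note W = W0[THEN conjunct1] W0[THEN conjunct2, THEN conjunct1] W0[THEN conjunct2, THEN conjunct2, rule_format]
  have "x ` W \<subseteq> cspan S" using assms(2) by blast
  then have "finite (x ` W)" using ell2.independent_span_bound[OF assms(1) W(2)] by blast
  then have fin: "finite W" using W(1) finite_imageD by blast
  have "\<exists>u. x \<omega> = (\<Sum>\<beta>\<in>W. u \<beta> *\<^sub>C x \<beta>)" for \<omega>
  proof -
    obtain F u where F: "finite F" "F \<subseteq> W" "x \<omega> = (\<Sum>\<beta>\<in>F. u \<beta> *\<^sub>C x \<beta>)" using W(3) by blast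
    have "(\<Sum>\<beta>\<in>F. u \<beta> *\<^sub>C x \<beta>) = (\<Sum>\<beta>\<in>W. (if \<beta> \<in> F then u \<beta> else 0) *\<^sub>C x \<beta>)"
      using F fin by (intro sum.mono_neutral_cong_left) auto
    then show ?thesis using F by metis
  qed
  then show thesis using that fin by blast
qed

lemma complex_vector_space: "vector_space ((*) :: complex \<Rightarrow> complex \<Rightarrow> complex)"
  unfolding vector_space_def
  by (intro conjI allI; rule distrib_left distrib_right mult.assoc[symmetric] mult_1_left)

lemma linear_extension:
  assumes "ell2.independent B"
  shows "\<exists>g. Vector_Spaces.linear scaleC ((*) :: complex \<Rightarrow> complex \<Rightarrow> complex) g \<and> (\<forall>b\<in>B. g b = f b)"
  by (rule vector_space_pair.linear_independent_extend
      [OF vector_space_pair.intro[OF ell2.vector_space_axioms complex_vector_space] assms])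

text \<open>A linear functional with prescribed values on a family exists as soon as these values
  satisfy the linear relations of the family.\<close>

lemma linear_functional_from_relations:
  fixes x :: "'w \<Rightarrow> 'b ell2" and \<phi> :: "'w \<Rightarrow> complex"
  assumes rel: "\<And>F u \<omega>. finite F \<Longrightarrow> x \<omega> = (\<Sum>\<beta>\<in>F. u \<beta> *\<^sub>C x \<beta>) \<Longrightarrow> \<phi> \<omega> = (\<Sum>\<beta>\<in>F. u \<beta> * \<phi> \<beta>)"
  obtains g where "\<And>a b. g (a + b) = g a + g b" "\<And>c a. g (c *\<^sub>C a) = c * g a" "\<And>\<omega>. g (x \<omega>) = \<phi> \<omega>"
proof -
  obtain W where W0: "inj_on x W \<and> ell2.independent (x ` W) \<and>
    (\<forall>\<omega>. \<exists>F u. finite F \<and> F \<subseteq> W \<and> x \<omega> = (\<Sum>\<beta>\<in>F. u \<beta> *\<^sub>C x \<beta>))"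
    using spanning_subfamily[of x] ..
  note W = W0[THEN conjunct1] W0[THEN conjunct2, THEN conjunct1] W0[THEN conjunct2, THEN conjunct2, rule_format]
  from linear_extension[OF W(2), of "\<lambda>b. \<phi> (the_inv_into W x b)"]
  obtain g where g: "Vector_Spaces.linear scaleC ((*) :: complex \<Rightarrow> complex \<Rightarrow> complex) g \<and>
    (\<forall>b\<in>x ` W. g b = \<phi> (the_inv_into W x b))" ..
  note g_linear = g[THEN conjunct1, unfolded Vector_Spaces.linear_iff, THEN conjunct2, THEN conjunct2]
  have g_add: "g (a + b) = g a + g b" for a b by (rule g_linear[THEN conjunct1, rule_format])
  have g_scale: "g (k *\<^sub>C a) = k * g a" for k a by (rule g_linear[THEN conjunct2, rule_format])
  have g0: "g 0 = 0" using g_scale[of 0 0] by simp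
  have g_sum: "g (\<Sum>\<beta>\<in>I. h \<beta>) = (\<Sum>\<beta>\<in>I. g (h \<beta>))" for h and I :: "'w set"
    by (induction I rule: infinite_finite_induct) (simp_all add: g0 g_add)
  have gW: "g (x \<beta>) = \<phi> \<beta>" if "\<beta> \<in> W" for \<beta>
    using g[THEN conjunct2] that by (simp add: the_inv_into_f_f[OF W(1)])
  have "g (x \<omega>) = \<phi> \<omega>" for \<omega>
  proof -
    obtain F u where F: "finite F" "F \<subseteq> W" "x \<omega> = (\<Sum>\<beta>\<in>F. u \<beta> *\<^sub>C x \<beta>)" using W(3) by blast
    have "g (x \<omega>) = (\<Sum>\<beta>\<in>F. u \<beta> * g (x \<beta>))"
      unfolding F(3) by (simp add: g_sum g_scale)
    also have "\<dots> = (\<Sum>\<beta>\<in>F. u \<beta> * \<phi> \<beta>)" using F(2) gW by (intro sum.cong) auto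
    finally show ?thesis using rel[OF F(1,3)] by simp
  qed
  then show thesis by (rule that[OF g_add g_scale])
qed

section \<open>Realizations of the two factors\<close>

lemma mat_word_append:
  assumes A: "\<forall>j. A j \<in> carrier_mat n n"
  shows "mat_word n A (\<alpha> @ \<beta>) = mat_word n A \<alpha> * mat_word n A \<beta>"
proof (induction \<alpha>)
  case Nil
  have "mat_word n A [] = 1\<^sub>m n" by (simp add: mat_word_def)
  then show ?case using mat_word_carrier[OF A, of \<beta>] by simp
next
  case (Cons k \<alpha>)
  have "A k \<in> carrier_mat n n" using A by blast
  from assoc_mult_mat[OF this mat_word_carrier[OF A, of \<alpha>] mat_word_carrier[OF A, of \<beta>]]
  show ?case using Cons.IH by (simp only: append_Cons mat_word_Cons)
qed

lemma mat_vec_entry: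
  assumes "M \<in> carrier_mat n k" "w \<in> carrier_vec k" "p < n"
  shows "(M *\<^sub>v w) $ p = (\<Sum>q<k. M $$ (p, q) * w $ q)"
  using assms by (simp add: scalar_prod_def atLeast0LessThan)

lemma state_coefficient:
  assumes A: "\<forall>j. A j \<in> carrier_mat n n" and b: "b \<in> carrier_vec n" and c: "c \<in> carrier_vec n"
  shows "(mat_word n A (\<alpha> @ \<omega>) *\<^sub>v c) \<bullet>c b =
    (\<Sum>i<n. (\<Sum>p<n. mat_word n A \<alpha> $$ (p, i) * cnj (b $ p)) * (mat_word n A \<omega> *\<^sub>v c) $ i)"
proof -
  define v where "v = mat_word n A \<omega> *\<^sub>v c"
  have v: "v \<in> carrier_vec n" unfolding v_def using mat_word_carrier[OF A, of \<omega>] c by simp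
  note M = mat_word_carrier[OF A, of \<alpha>]
  have "mat_word n A (\<alpha> @ \<omega>) *\<^sub>v c = mat_word n A \<alpha> *\<^sub>v v"
    unfolding mat_word_append[OF A] v_def by (rule assoc_mult_mat_vec[OF M mat_word_carrier[OF A] c])
  then have "(mat_word n A (\<alpha> @ \<omega>) *\<^sub>v c) \<bullet>c b = (\<Sum>p<n. (\<Sum>i<n. mat_word n A \<alpha> $$ (p, i) * v $ i) * cnj (b $ p))"
    using M v b by (simp add: scalar_prod_def atLeast0LessThan)
  also have "\<dots> = (\<Sum>p<n. \<Sum>i<n. (mat_word n A \<alpha> $$ (p, i) * cnj (b $ p)) * v $ i)"
    by (simp add: sum_distrib_right sum_distrib_left mult_ac)
  also have "\<dots> = (\<Sum>i<n. (\<Sum>p<n. mat_word n A \<alpha> $$ (p, i) * cnj (b $ p)) * v $ i)"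
    by (subst sum.swap) (simp add: sum_distrib_right)
  finally show ?thesis by (simp add: v_def)
qed

text \<open>The state \<open>A\<^sup>\<omega> c\<close>, padded by zeros to a square-summable family.\<close>

definition state_series :: "nat \<Rightarrow> ('d \<Rightarrow> complex mat) \<Rightarrow> complex Matrix.vec \<Rightarrow> 'd list \<Rightarrow> nat ell2" where
  "state_series n A c \<omega> = (\<Sum>i<n. (mat_word n A \<omega> *\<^sub>v c) $ i *\<^sub>C ell2_unit i)"

lemma state_series_nth: "i < n \<Longrightarrow> ell2_nth (state_series n A c \<omega>) i = (mat_word n A \<omega> *\<^sub>v c) $ i"
proof -
  assume i: "i < n"
  have "ell2_nth (state_series n A c \<omega>) i = (\<Sum>j<n. if j = i then (mat_word n A \<omega> *\<^sub>v c) $ j else 0)"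
    unfolding state_series_def ell2_nth_sum by (intro sum.cong refl) (auto simp: scaleC.rep_eq ell2_unit.rep_eq)
  then show ?thesis using i by simp
qed

text \<open>Each coefficient of the tail at \<open>\<omega>\<close> is a linear functional of the state at \<open>\<omega>\<close>, because
  \<open>A\<^bsup>\<alpha>\<omega>\<^esup> c = A\<^sup>\<alpha> A\<^sup>\<omega> c\<close>. Linear relations between states therefore hold between tails.\<close>

lemma right_tail_relation:
  assumes A: "\<forall>j. A j \<in> carrier_mat n n" and b: "b \<in> carrier_vec n" and c: "c \<in> carrier_vec n"
    and r: "\<And>\<omega>. ell2_nth r \<omega> = (mat_word n A \<omega> *\<^sub>v c) \<bullet>c b"
    and eq: "state_series n A c \<omega> = (\<Sum>\<beta>\<in>F. u \<beta> *\<^sub>C state_series n A c \<beta>)"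
  shows "right_tail \<omega> r = (\<Sum>\<beta>\<in>F. u \<beta> *\<^sub>C right_tail \<beta> r)"
proof (rule ell2_eqI)
  fix \<alpha>
  define g where "g i = (\<Sum>p<n. mat_word n A \<alpha> $$ (p, i) * cnj (b $ p))" for i
  have st: "ell2_nth (right_tail \<beta> r) \<alpha> = (\<Sum>i<n. g i * ell2_nth (state_series n A c \<beta>) i)" for \<beta>
    by (simp add: right_tail.rep_eq r state_coefficient[OF A b c] g_def state_series_nth)
  have "ell2_nth (right_tail \<omega> r) \<alpha> = (\<Sum>i<n. \<Sum>\<beta>\<in>F. u \<beta> * (g i * ell2_nth (state_series n A c \<beta>) i))"
    unfolding st eq ell2_nth_sum by (simp add: scaleC.rep_eq sum_distrib_left mult_ac)
  also have "\<dots> = (\<Sum>\<beta>\<in>F. u \<beta> * ell2_nth (right_tail \<beta> r) \<alpha>)"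
    unfolding st by (subst sum.swap) (simp add: sum_distrib_left)
  finally show "ell2_nth (right_tail \<omega> r) \<alpha> = ell2_nth (\<Sum>\<beta>\<in>F. u \<beta> *\<^sub>C right_tail \<beta> r) \<alpha>"
    by (simp add: ell2_nth_sum scaleC.rep_eq)
qed

text \<open>The coefficients of \<open>f\<close> are values of a linear functional on the tails of \<open>r\<close>, so they
  satisfy the relations between the states. A linear functional on the states then yields them,
  and \<open>b'\<close> represents it.\<close>

lemma outer_factor_realization:
  assumes A: "\<forall>j. A j \<in> carrier_mat n n" and b: "b \<in> carrier_vec n" and c: "c \<in> carrier_vec n"
    and r: "\<And>\<omega>. ell2_nth r \<omega> = (mat_word n A \<omega> *\<^sub>v c) \<bullet>c b"
    and f: "\<And>\<beta>. ell2_nth f \<beta> = cinner (right_tail \<beta> r) \<Theta>"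
  obtains b' where "b' \<in> carrier_vec n" "\<And>\<omega>. ell2_nth f \<omega> = (mat_word n A \<omega> *\<^sub>v c) \<bullet>c b'"
proof -
  have "ell2_nth f \<omega> = (\<Sum>\<beta>\<in>F. u \<beta> * ell2_nth f \<beta>)"
    if "state_series n A c \<omega> = (\<Sum>\<beta>\<in>F. u \<beta> *\<^sub>C state_series n A c \<beta>)" for F u \<omega>
    using right_tail_relation[OF A b c r that] by (simp add: f cinner_sum_left cinner_scaleC_left)
  then obtain g where g: "\<And>a b. g (a + b) = g a + g b" "\<And>k a. g (k *\<^sub>C a) = k * g a"
    "\<And>\<omega>. g (state_series n A c \<omega>) = ell2_nth f \<omega>"
    using linear_functional_from_relations[of "state_series n A c" "ell2_nth f"] by blast
  have g0: "g 0 = 0" using g(2)[of 0 0] by simp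
  have gsum: "g (\<Sum>i\<in>I. h i) = (\<Sum>i\<in>I. g (h i))" for h and I :: "nat set"
    by (induction I rule: infinite_finite_induct) (simp_all add: g0 g(1))
  define b' where "b' = vec n (\<lambda>i. cnj (g (ell2_unit i)))"
  have "ell2_nth f \<omega> = (mat_word n A \<omega> *\<^sub>v c) \<bullet>c b'" for \<omega>
    using c mat_word_carrier[OF A, of \<omega>]
    by (simp add: g(3)[symmetric] state_series_def gsum g(2) b'_def scalar_prod_def atLeast0LessThan)
  then show thesis using that[of b'] by (simp add: b'_def)
qed

text \<open>As \<open>y\<close> has an invertible constant coefficient, the convolution can be solved for \<open>x\<close> by
  recursion on the length of the word.\<close>

lemma convolution_cancel:
  fixes x y z :: "'d list \<Rightarrow> complex"
  assumes eq: "\<And>\<omega>. (\<Sum>i\<le>length \<omega>. x (take i \<omega>) * y (drop i \<omega>)) = (\<Sum>i\<le>length \<omega>. z (take i \<omega>) * y (drop i \<omega>))"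
    and y: "y [] \<noteq> 0"
  shows "x \<omega> = z \<omega>"
proof (induction \<omega> rule: length_induct)
  case (1 \<omega>)
  have split: "sum g {..length \<omega>} = g (length \<omega>) + sum g {..<length \<omega>}" for g :: "nat \<Rightarrow> complex"
    by (simp add: lessThan_Suc_atMost[symmetric] add.commute)
  have "(\<Sum>i<length \<omega>. x (take i \<omega>) * y (drop i \<omega>)) = (\<Sum>i<length \<omega>. z (take i \<omega>) * y (drop i \<omega>))"
    using 1 by (intro sum.cong refl) simp
  then show ?case using eq[of \<omega>] y unfolding split by simp
qed

text \<open>The triple \<open>(A', b, c')\<close> with \<open>A'\<^sub>j = A\<^sub>j - c b'\<^sup>* A\<^sub>j / f\<^sub>0\<close> and \<open>c' = c / f\<^sub>0\<close> is the
  realization of the quotient of \<open>r\<close> by \<open>f\<close>: its states \<open>U\<close>, convolved with the coefficients of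
  \<open>f\<close>, give the states \<open>X\<close> of \<open>A\<close>. The factor \<open>b'\<^sup>* A\<^sub>j\<close> feeds back the coefficient of \<open>f\<close> at the
  word prolonged by \<open>j\<close>, which cancels the contribution of the empty word.\<close>

lemma inner_factor_realization:
  fixes r \<Theta> f :: "'d list ell2"
  assumes A: "\<forall>j. A j \<in> carrier_mat n n" and b: "b \<in> carrier_vec n" and c: "c \<in> carrier_vec n"
    and b': "b' \<in> carrier_vec n"
    and r: "\<And>\<omega>. ell2_nth r \<omega> = (mat_word n A \<omega> *\<^sub>v c) \<bullet>c b"
    and f: "\<And>\<omega>. ell2_nth f \<omega> = (mat_word n A \<omega> *\<^sub>v c) \<bullet>c b'"
    and conv: "\<And>\<omega>. ell2_nth r \<omega> = (\<Sum>i\<le>length \<omega>. ell2_nth \<Theta> (take i \<omega>) * ell2_nth f (drop i \<omega>))"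
    and f0: "ell2_nth f [] \<noteq> 0"
  obtains A' c' where "\<forall>j. A' j \<in> carrier_mat n n" "c' \<in> carrier_vec n"
    "\<And>\<omega>. ell2_nth \<Theta> \<omega> = (mat_word n A' \<omega> *\<^sub>v c') \<bullet>c b"
proof -
  define d where "d = 1 / ell2_nth f []"
  define A' where "A' j = mat n n (\<lambda>(p, q). A j $$ (p, q) - d * c $ p * (\<Sum>s<n. cnj (b' $ s) * A j $$ (s, q)))" for j
  define c' where "c' = vec n (\<lambda>p. d * c $ p)"
  have A': "\<forall>j. A' j \<in> carrier_mat n n" and c': "c' \<in> carrier_vec n"
    by (simp_all add: A'_def c'_def)
  define X where "X \<omega> p = (mat_word n A \<omega> *\<^sub>v c) $ p" for \<omega> p
  define U where "U \<omega> p = (mat_word n A' \<omega> *\<^sub>v c') $ p" for \<omega> p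
  have cons: "(mat_word n B (j # \<omega>) *\<^sub>v v) $ p = (\<Sum>q<n. B j $$ (p, q) * (mat_word n B \<omega> *\<^sub>v v) $ q)"
    if B: "\<forall>j. B j \<in> carrier_mat n n" and v: "v \<in> carrier_vec n" and p: "p < n"
    for B :: "'d \<Rightarrow> complex mat" and v j \<omega> p
  proof -
    have w: "mat_word n B \<omega> *\<^sub>v v \<in> carrier_vec n" using mat_word_carrier[OF B, of \<omega>] v by simp
    have Bj: "B j \<in> carrier_mat n n" using B by blast
    have "mat_word n B (j # \<omega>) *\<^sub>v v = B j *\<^sub>v (mat_word n B \<omega> *\<^sub>v v)"
      unfolding mat_word_Cons by (rule assoc_mult_mat_vec[OF Bj mat_word_carrier[OF B] v])
    also have "\<dots> $ p = (\<Sum>q<n. B j $$ (p, q) * (mat_word n B \<omega> *\<^sub>v v) $ q)"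
      by (rule mat_vec_entry[OF Bj w p])
    finally show ?thesis .
  qed
  have XC: "X (j # \<omega>) p = (\<Sum>q<n. A j $$ (p, q) * X \<omega> q)" if "p < n" for j \<omega> p
    unfolding X_def by (rule cons[OF A c that])
  have UC: "U (j # \<omega>) p = (\<Sum>q<n. A' j $$ (p, q) * U \<omega> q)" if "p < n" for j \<omega> p
    unfolding U_def by (rule cons[OF A' c' that])
  have U0: "U [] p = d * c $ p" and X0: "X [] p = c $ p" if "p < n" for p
    using that c' c by (simp_all add: U_def X_def mat_word_def) (simp add: c'_def)
  have fX: "ell2_nth f \<omega> = (\<Sum>s<n. cnj (b' $ s) * X \<omega> s)" for \<omega>
    using b' mat_word_carrier[OF A, of \<omega>] c
    by (simp add: f X_def scalar_prod_def atLeast0LessThan mult.commute)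
  have key: "(\<Sum>i\<le>length \<omega>. U (take i \<omega>) p * ell2_nth f (drop i \<omega>)) = X \<omega> p" if "p < n" for \<omega> p
    using that
  proof (induction \<omega> arbitrary: p)
    case Nil
    then show ?case using f0 by (simp add: U0 X0 d_def)
  next
    case (Cons j \<omega>)
    have "(\<Sum>i\<le>length (j # \<omega>). U (take i (j # \<omega>)) p * ell2_nth f (drop i (j # \<omega>))) =
      U [] p * ell2_nth f (j # \<omega>) + (\<Sum>i\<le>length \<omega>. U (j # take i \<omega>) p * ell2_nth f (drop i \<omega>))"
      by (simp add: sum.atMost_Suc_shift del: sum.atMost_Suc)
    also have "(\<Sum>i\<le>length \<omega>. U (j # take i \<omega>) p * ell2_nth f (drop i \<omega>)) =
      (\<Sum>i\<le>length \<omega>. \<Sum>q<n. A' j $$ (p, q) * (U (take i \<omega>) q * ell2_nth f (drop i \<omega>)))"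
      using Cons.prems by (simp add: UC sum_distrib_right mult.assoc)
    also have "\<dots> = (\<Sum>q<n. A' j $$ (p, q) * (\<Sum>i\<le>length \<omega>. U (take i \<omega>) q * ell2_nth f (drop i \<omega>)))"
      by (subst sum.swap) (simp add: sum_distrib_left)
    also have "\<dots> = (\<Sum>q<n. A' j $$ (p, q) * X \<omega> q)"
      using Cons.IH by (intro sum.cong refl) simp
    also have "\<dots> = (\<Sum>q<n. A j $$ (p, q) * X \<omega> q -
        d * c $ p * (\<Sum>s<n. cnj (b' $ s) * (A j $$ (s, q) * X \<omega> q)))"
      using Cons.prems by (intro sum.cong refl) (simp add: A'_def left_diff_distrib sum_distrib_right mult.assoc)
    also have "\<dots> = X (j # \<omega>) p - d * c $ p * (\<Sum>q<n. \<Sum>s<n. cnj (b' $ s) * (A j $$ (s, q) * X \<omega> q))"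
      using Cons.prems by (simp add: sum_subtractf XC sum_distrib_left)
    also have "(\<Sum>q<n. \<Sum>s<n. cnj (b' $ s) * (A j $$ (s, q) * X \<omega> q)) = ell2_nth f (j # \<omega>)"
      unfolding fX by (subst sum.swap) (simp add: XC sum_distrib_left)
    finally show ?case using Cons.prems by (simp add: U0)
  qed
  have dot: "(mat_word n A' \<omega> *\<^sub>v c') \<bullet>c b = (\<Sum>p<n. cnj (b $ p) * U \<omega> p)" for \<omega>
    using b mat_word_carrier[OF A', of \<omega>] c'
    by (simp add: U_def scalar_prod_def atLeast0LessThan mult.commute)
  have "ell2_nth \<Theta> \<omega> = (mat_word n A' \<omega> *\<^sub>v c') \<bullet>c b" for \<omega>
  proof (rule convolution_cancel[where y = "ell2_nth f", OF _ f0])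
    fix \<omega>
    have "(\<Sum>i\<le>length \<omega>. (mat_word n A' (take i \<omega>) *\<^sub>v c') \<bullet>c b * ell2_nth f (drop i \<omega>)) =
      (\<Sum>i\<le>length \<omega>. \<Sum>p<n. cnj (b $ p) * (U (take i \<omega>) p * ell2_nth f (drop i \<omega>)))"
      by (simp add: dot sum_distrib_right mult.assoc)
    also have "\<dots> = (\<Sum>p<n. cnj (b $ p) * X \<omega> p)"
      by (subst sum.swap) (simp add: key flip: sum_distrib_left)
    also have "\<dots> = ell2_nth r \<omega>"
      using b mat_word_carrier[OF A, of \<omega>] c
      by (simp add: r X_def scalar_prod_def atLeast0LessThan mult.commute)
    finally show "(\<Sum>i\<le>length \<omega>. ell2_nth \<Theta> (take i \<omega>) * ell2_nth f (drop i \<omega>)) =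
      (\<Sum>i\<le>length \<omega>. (mat_word n A' (take i \<omega>) *\<^sub>v c') \<bullet>c b * ell2_nth f (drop i \<omega>))"
      using conv by simp
  qed
  then show thesis using that A' c' by blast
qed

section \<open>Evaluation functionals\<close>

lemma sum_words_less:
  fixes g :: "'d::finite list \<Rightarrow> 'b::comm_monoid_add"
  shows "(\<Sum>\<alpha> | length \<alpha> < n. g \<alpha>) = (\<Sum>k<n. \<Sum>\<alpha> | length \<alpha> = k. g \<alpha>)"
proof -
  have "{\<alpha> :: 'd list. length \<alpha> < n} = (\<Union>k\<in>{..<n}. {\<alpha>. length \<alpha> = k})" by auto
  then show ?thesis by (simp only:) (subst sum.UNION_disjoint; auto simp: finite_words)
qed

lemma finite_words_less: "finite {\<alpha> :: 'd::finite list. length \<alpha> < n}"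
proof -
  have "{\<alpha> :: 'd list. length \<alpha> < n} = (\<Union>k\<in>{..<n}. {\<alpha>. length \<alpha> = k})" by auto
  then show ?thesis by (simp add: finite_words)
qed

lemma finite_words_subset:
  assumes "finite F"
  obtains n where "F \<subseteq> {\<alpha> :: 'd list. length \<alpha> < n}"
proof
  have "length \<alpha> \<le> Max (length ` F)" if "\<alpha> \<in> F" for \<alpha>
    using assms that by (intro Max_ge) auto
  then show "F \<subseteq> {\<alpha>. length \<alpha> < Suc (Max (length ` F))}" by (auto simp: less_Suc_eq_le)
qed

text \<open>The words of length below \<open>n\<close> form an exhausting sequence of finite sets.\<close>

lemma has_sum_words_sums:
  fixes g :: "'d::finite list \<Rightarrow> 'b::{comm_monoid_add, topological_space}"
  assumes "(g has_sum S) UNIV"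
  shows "(\<lambda>k. \<Sum>\<alpha> | length \<alpha> = k. g \<alpha>) sums S"
proof -
  have "filterlim (\<lambda>n. {\<alpha> :: 'd list. length \<alpha> < n}) (finite_subsets_at_top UNIV) sequentially"
    unfolding filterlim_finite_subsets_at_top
  proof (intro allI impI)
    fix F :: "'d list set" assume "finite F \<and> F \<subseteq> UNIV"
    then have "finite F" by simp
    then obtain n where n: "F \<subseteq> {\<alpha>. length \<alpha> < n}" by (rule finite_words_subset)
    have "F \<subseteq> {\<alpha>. length \<alpha> < m}" if "m \<ge> n" for m
    proof
      fix \<alpha> assume "\<alpha> \<in> F"
      then have "length \<alpha> < n" using n by blast
      then show "\<alpha> \<in> {\<alpha>. length \<alpha> < m}" using that by simp
    qed
    then show "\<forall>\<^sub>F m in sequentially. finite {\<alpha> :: 'd list. length \<alpha> < m} \<and> F \<subseteq> {\<alpha>. length \<alpha> < m} \<and> {\<alpha>. length \<alpha> < m} \<subseteq> UNIV"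
      by (intro eventually_sequentiallyI[of n]) (simp add: finite_words_less)
  qed
  with assms have "(\<lambda>n. \<Sum>\<alpha> | length \<alpha> < n. g \<alpha>) \<longlonglongrightarrow> S"
    unfolding has_sum_def by (rule filterlim_compose)
  then show ?thesis unfolding sums_def sum_words_less .
qed

text \<open>Coefficients whose energy in degree \<open>k\<close> is dominated by a geometric sequence define a
  square-summable kernel, and pairing with it is summation over the degrees.\<close>

lemma word_kernel:
  fixes \<kappa> :: "'d::finite list \<Rightarrow> complex"
  assumes \<kappa>: "\<And>k. (\<Sum>\<alpha> | length \<alpha> = k. (cmod (\<kappa> \<alpha>))\<^sup>2) \<le> C * \<rho> ^ k"
    and \<rho>: "0 \<le> \<rho>" "\<rho> < 1" and C: "0 \<le> C"
  shows "\<exists>K. (\<forall>\<alpha>. ell2_nth K \<alpha> = cnj (\<kappa> \<alpha>)) \<and>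
    (\<forall>h. (\<lambda>k. \<Sum>\<alpha> | length \<alpha> = k. ell2_nth h \<alpha> * \<kappa> \<alpha>) sums cinner h K)"
proof -
  have bound: "(\<Sum>\<alpha>\<in>F. (cmod (cnj (\<kappa> \<alpha>)))\<^sup>2) \<le> (sqrt (C / (1 - \<rho>)))\<^sup>2" if "finite F" for F
  proof -
    obtain n where n: "F \<subseteq> {\<alpha>. length \<alpha> < n}" using \<open>finite F\<close> by (rule finite_words_subset)
    have "(\<Sum>\<alpha>\<in>F. (cmod (cnj (\<kappa> \<alpha>)))\<^sup>2) \<le> (\<Sum>\<alpha> | length \<alpha> < n. (cmod (cnj (\<kappa> \<alpha>)))\<^sup>2)"
      by (rule sum_mono2[OF finite_words_less n]) simp
    also have "\<dots> \<le> (\<Sum>k<n. C * \<rho> ^ k)"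
      unfolding sum_words_less by (rule sum_mono) (simp add: \<kappa>)
    also have "\<dots> = C * ((1 - \<rho> ^ n) / (1 - \<rho>))"
      using \<rho> by (simp add: sum_gp_strict flip: sum_distrib_left)
    also have "\<dots> \<le> C * (1 / (1 - \<rho>))"
      using \<rho> C by (intro mult_left_mono divide_right_mono) auto
    finally show ?thesis using \<rho> C by simp
  qed
  have "\<exists>K. \<forall>\<alpha>. ell2_nth K \<alpha> = cnj (\<kappa> \<alpha>)"
  proof (rule ell2_of_bounded_sums[OF bound])
    fix K assume "\<And>\<alpha>. ell2_nth K \<alpha> = cnj (\<kappa> \<alpha>)"
    then show "\<exists>K. \<forall>\<alpha>. ell2_nth K \<alpha> = cnj (\<kappa> \<alpha>)" by blast
  qed (use \<rho> C in simp_all)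
  then obtain K where K: "\<forall>\<alpha>. ell2_nth K \<alpha> = cnj (\<kappa> \<alpha>)" ..
  have "(\<lambda>k. \<Sum>\<alpha> | length \<alpha> = k. ell2_nth h \<alpha> * \<kappa> \<alpha>) sums cinner h K" for h
    using has_sum_words_sums[OF cinner_has_sum[of h K]] by (simp add: K)
  with K show ?thesis by blast
qed

text \<open>With the adjoints of a tuple in place of \<open>Zs\<close> this is the adjoint of the word \<open>\<alpha>\<close> in the
  tuple, hence the first letter is applied first.\<close>

primrec iterate_word :: "('d \<Rightarrow> 'v \<Rightarrow> 'v) \<Rightarrow> 'd list \<Rightarrow> 'v \<Rightarrow> 'v" where
  "iterate_word Zs [] y = y"
| "iterate_word Zs (j # \<alpha>) y = iterate_word Zs \<alpha> (Zs j y)"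

lemma iterate_word_contraction:
  fixes Zs :: "'d::finite \<Rightarrow> 'v::real_normed_vector \<Rightarrow> 'v"
  assumes Zs: "\<And>y. (\<Sum>j\<in>UNIV. (norm (Zs j y))\<^sup>2) \<le> \<rho> * (norm y)\<^sup>2" and "0 \<le> \<rho>"
  shows "(\<Sum>\<alpha> | length \<alpha> = k. (norm (iterate_word Zs \<alpha> y))\<^sup>2) \<le> \<rho> ^ k * (norm y)\<^sup>2"
proof (induction k arbitrary: y)
  case (Suc k)
  have "(\<Sum>\<alpha> | length \<alpha> = Suc k. (norm (iterate_word Zs \<alpha> y))\<^sup>2) \<le> (\<Sum>j\<in>UNIV. \<rho> ^ k * (norm (Zs j y))\<^sup>2)"
    unfolding sum_words_Suc by (rule sum_mono) (simp add: Suc.IH)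
  also have "\<dots> \<le> \<rho> ^ k * (\<rho> * (norm y)\<^sup>2)"
    unfolding sum_distrib_left[symmetric] by (intro mult_left_mono Zs) (simp add: \<open>0 \<le> \<rho>\<close>)
  finally show ?case by (simp add: mult_ac)
qed simp

subsection \<open>Operator points\<close>

lemma op_word_Cons: "blinfun_apply (op_word Z (j # \<alpha>)) x = blinfun_apply (Z j) (blinfun_apply (op_word Z \<alpha>) x)"
  by (simp add: op_word_def)

lemma op_word_Nil: "blinfun_apply (op_word Z []) x = x"
  by (simp add: op_word_def)

lemma op_word_append: "blinfun_apply (op_word Z (\<alpha> @ \<beta>)) x = blinfun_apply (op_word Z \<alpha>) (blinfun_apply (op_word Z \<beta>) x)"
  by (induction \<alpha>) (simp_all add: op_word_Cons op_word_Nil)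

text \<open>For \<open>G = (\<Sum>j. Z\<^sub>j Z\<^sub>j\<^sup>*)\<close> the inner product of \<open>G y\<close> with \<open>y\<close> is the sum of the squared
  norms of \<open>Z\<^sub>j\<^sup>* y\<close>, so a strict row contraction has a column of adjoints contracting squared
  norms by a factor \<open>\<rho> < 1\<close>.\<close>

lemma row_ball_inf_adjoints:
  fixes Z :: "'d::finite \<Rightarrow> nat ell2 \<Rightarrow>\<^sub>L nat ell2"
  assumes Z: "Z \<in> row_ball_inf"
  shows "\<exists>Zs \<rho>. (\<forall>j x y. cinner (blinfun_apply (Z j) x) y = cinner x (Zs j y)) \<and>
    (\<forall>y. (\<Sum>j\<in>UNIV. (norm (Zs j y))\<^sup>2) \<le> \<rho> * (norm y)\<^sup>2) \<and> 0 \<le> \<rho> \<and> \<rho> < 1"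
proof -
  define Zs where "Zs j = adjoint (blinfun_apply (Z j))" for j
  define G where "G y = (\<Sum>j\<in>UNIV. blinfun_apply (Z j) (Zs j y))" for y
  have adj: "cinner (blinfun_apply (Z j) x) y = cinner x (Zs j y) \<and> bounded_linear (Zs j)" for j x y
  proof -
    have "Z j \<in> bounded_ops" using Z by (simp add: row_ball_inf_def)
    from bounded_ops_adjoint[OF this] obtain S where
      S: "\<And>x y. cinner (blinfun_apply (Z j) x) y = cinner x (blinfun_apply S y)" by blast
    have "Zs j = blinfun_apply S" unfolding Zs_def by (rule adjoint_eq_cinner[OF S])
    then show ?thesis using S by (simp add: blinfun.bounded_linear_right)
  qed
  have G: "bounded_linear G"
    unfolding G_def using adj
    by (intro bounded_linear_sum bounded_linear_compose[OF blinfun.bounded_linear_right]) blast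
  have "sqrt (onorm G) < 1" using Z unfolding row_ball_inf_def G_def Zs_def by simp
  then have lt: "onorm G < 1" by simp
  have con: "(\<Sum>j\<in>UNIV. (norm (Zs j y))\<^sup>2) \<le> onorm G * (norm y)\<^sup>2" for y
  proof -
    have "cinner (G y) y = (\<Sum>j\<in>UNIV. complex_of_real ((norm (Zs j y))\<^sup>2))"
      unfolding G_def cinner_sum_left using adj by (simp add: cinner_self)
    then have "complex_of_real (\<Sum>j\<in>UNIV. (norm (Zs j y))\<^sup>2) = cinner (G y) y" by simp
    then have "\<bar>\<Sum>j\<in>UNIV. (norm (Zs j y))\<^sup>2\<bar> = cmod (cinner (G y) y)" by (metis norm_of_real)
    also have "\<dots> \<le> norm (G y) * norm y" by (rule cinner_Cauchy_Schwarz)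
    also have "\<dots> \<le> (onorm G * norm y) * norm y" by (intro mult_right_mono onorm[OF G]) simp
    finally show ?thesis by (simp add: power2_eq_square mult_ac)
  qed
  show ?thesis
    by (rule exI[of _ Zs], rule exI[of _ "onorm G"])
      (intro conjI allI adj[THEN conjunct1] con onorm_pos_le[OF G] lt)
qed

lemma cinner_op_word:
  assumes "\<And>j x y. cinner (blinfun_apply (Z j) x) y = cinner x (Zs j y)"
  shows "cinner (blinfun_apply (op_word Z \<alpha>) x) y = cinner x (iterate_word Zs \<alpha> y)"
  by (induction \<alpha> arbitrary: y) (simp_all add: op_word_Cons op_word_Nil assms)

text \<open>The kernel with coefficients conjugate to \<open>y\<^sup>* Z\<^sup>\<alpha> x\<close>. The series for \<open>h(Z)\<close> converges in
  operator norm: its term of degree \<open>k\<close> has norm at most \<open>norm h * sqrt \<rho> ^ k\<close> by the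
  Cauchy-Schwarz inequality.\<close>

lemma eval_inf_kernel:
  fixes Z :: "'d::finite \<Rightarrow> nat ell2 \<Rightarrow>\<^sub>L nat ell2"
  assumes Z: "Z \<in> row_ball_inf"
  shows "\<exists>K. (\<forall>\<alpha>. ell2_nth K \<alpha> = cnj (cinner (blinfun_apply (op_word Z \<alpha>) x) y)) \<and>
    (\<forall>h. cinner (blinfun_apply (eval_inf h Z) x) y = cinner h K)"
proof -
  obtain Zs \<rho> where *: "(\<forall>j x y. cinner (blinfun_apply (Z j) x) y = cinner x (Zs j y)) \<and>
    (\<forall>y. (\<Sum>j\<in>UNIV. (norm (Zs j y))\<^sup>2) \<le> \<rho> * (norm y)\<^sup>2) \<and> 0 \<le> \<rho> \<and> \<rho> < 1"
    using row_ball_inf_adjoints[OF Z] by (elim exE)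
  have Zs: "cinner (blinfun_apply (Z j) x) y = cinner x (Zs j y)" for j x y using * by simp
  have con: "(\<Sum>j\<in>UNIV. (norm (Zs j y))\<^sup>2) \<le> \<rho> * (norm y)\<^sup>2" for y using * by simp
  have \<rho>: "0 \<le> \<rho>" "\<rho> < 1" using * by simp_all
  have bound: "(\<Sum>\<alpha> | length \<alpha> = k. (cmod (cinner (blinfun_apply (op_word Z \<alpha>) x) y))\<^sup>2) \<le>
    ((norm x)\<^sup>2 * (norm y)\<^sup>2) * \<rho> ^ k" for k x y
  proof -
    have "(\<Sum>\<alpha> | length \<alpha> = k. (cmod (cinner (blinfun_apply (op_word Z \<alpha>) x) y))\<^sup>2) \<le>
      (\<Sum>\<alpha> | length \<alpha> = k. (norm x)\<^sup>2 * (norm (iterate_word Zs \<alpha> y))\<^sup>2)"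
    proof (rule sum_mono)
      fix \<alpha>
      have "cmod (cinner x (iterate_word Zs \<alpha> y)) \<le> norm x * norm (iterate_word Zs \<alpha> y)"
        by (rule cinner_Cauchy_Schwarz)
      then have "(cmod (cinner x (iterate_word Zs \<alpha> y)))\<^sup>2 \<le> (norm x * norm (iterate_word Zs \<alpha> y))\<^sup>2"
        by (rule power_mono) simp
      then show "(cmod (cinner (blinfun_apply (op_word Z \<alpha>) x) y))\<^sup>2 \<le> (norm x)\<^sup>2 * (norm (iterate_word Zs \<alpha> y))\<^sup>2"
        by (simp add: cinner_op_word[OF Zs] power_mult_distrib)
    qed
    also have "\<dots> \<le> (norm x)\<^sup>2 * (\<rho> ^ k * (norm y)\<^sup>2)"
      unfolding sum_distrib_left[symmetric]
      by (intro mult_left_mono iterate_word_contraction[OF con \<rho>(1)]) simp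
    finally show ?thesis by (simp add: mult_ac)
  qed
  obtain K where K: "\<forall>\<alpha>. ell2_nth K \<alpha> = cnj (cinner (blinfun_apply (op_word Z \<alpha>) x) y)"
    and Ks: "\<And>h. (\<lambda>k. \<Sum>\<alpha> | length \<alpha> = k. ell2_nth h \<alpha> * cinner (blinfun_apply (op_word Z \<alpha>) x) y) sums cinner h K"
    using word_kernel[OF bound \<rho>, of x y] by auto
  have "cinner (blinfun_apply (eval_inf h Z) x) y = cinner h K" for h
  proof -
    define D where "D k = (\<Sum>\<alpha> | length \<alpha> = k. scalar_op (ell2_nth h \<alpha>) o\<^sub>L op_word Z \<alpha>)" for k
    have Dxy: "cinner (blinfun_apply (D k) x) y =
        (\<Sum>\<alpha> | length \<alpha> = k. ell2_nth h \<alpha> * cinner (blinfun_apply (op_word Z \<alpha>) x) y)" for k x y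
      by (simp add: D_def blinfun.sum_left cinner_sum_left scalar_op.rep_eq cinner_scaleC_left)
    have Dn: "norm (D k) \<le> norm h * sqrt \<rho> ^ k" for k
    proof (rule norm_blinfun_bound)
      fix x
      define w where "w = blinfun_apply (D k) x"
      define A where "A = {\<alpha> :: 'd list. length \<alpha> = k}"
      define \<kappa> where "\<kappa> \<alpha> = cinner (blinfun_apply (op_word Z \<alpha>) x) w" for \<alpha>
      have "(norm w)\<^sup>2 = cmod (cinner w w)" by (simp add: cinner_self norm_power)
      also have "\<dots> = cmod (\<Sum>\<alpha>\<in>A. ell2_nth h \<alpha> * \<kappa> \<alpha>)"
        unfolding A_def \<kappa>_def by (subst (1) w_def) (simp add: Dxy)
      also have "\<dots> \<le> (\<Sum>\<alpha>\<in>A. \<bar>cmod (ell2_nth h \<alpha>)\<bar> * \<bar>cmod (\<kappa> \<alpha>)\<bar>)"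
        by (rule order_trans[OF norm_sum]) (simp add: norm_mult)
      also have "\<dots> \<le> L2_set (\<lambda>\<alpha>. cmod (ell2_nth h \<alpha>)) A * L2_set (\<lambda>\<alpha>. cmod (\<kappa> \<alpha>)) A"
        by (rule L2_set_mult_ineq)
      also have "\<dots> \<le> norm h * (norm x * norm w * sqrt \<rho> ^ k)"
      proof (intro mult_mono)
        have "(\<Sum>\<alpha>\<in>A. (cmod (ell2_nth h \<alpha>))\<^sup>2) \<le> (norm h)\<^sup>2"
          unfolding A_def by (rule ell2_sum_le_norm[OF finite_words])
        then show "L2_set (\<lambda>\<alpha>. cmod (ell2_nth h \<alpha>)) A \<le> norm h"
          unfolding L2_set_def using real_sqrt_le_mono[of "\<Sum>\<alpha>\<in>A. (cmod (ell2_nth h \<alpha>))\<^sup>2" "(norm h)\<^sup>2"] by simp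
        have "(\<Sum>\<alpha>\<in>A. (cmod (\<kappa> \<alpha>))\<^sup>2) \<le> ((norm x)\<^sup>2 * (norm w)\<^sup>2) * \<rho> ^ k"
          unfolding A_def \<kappa>_def by (rule bound)
        also have "\<dots> = (norm x * norm w * sqrt \<rho> ^ k)\<^sup>2"
          using \<rho> by (simp add: power_mult_distrib flip: power_mult power2_eq_square)
            (simp add: mult.commute[of k 2] power_mult)
        finally have "sqrt (\<Sum>\<alpha>\<in>A. (cmod (\<kappa> \<alpha>))\<^sup>2) \<le> sqrt ((norm x * norm w * sqrt \<rho> ^ k)\<^sup>2)"
          by (rule real_sqrt_le_mono)
        then show "L2_set (\<lambda>\<alpha>. cmod (\<kappa> \<alpha>)) A \<le> norm x * norm w * sqrt \<rho> ^ k"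
          unfolding L2_set_def using \<rho> by simp
      qed (simp_all add: L2_set_nonneg)
      finally have "norm w * norm w \<le> norm w * (norm h * sqrt \<rho> ^ k * norm x)"
        by (simp add: power2_eq_square mult_ac)
      then show "norm (blinfun_apply (D k) x) \<le> norm h * sqrt \<rho> ^ k * norm x"
        unfolding w_def[symmetric] using \<rho> by (cases "norm w = 0") (simp_all add: mult_le_cancel_left)
    qed (use \<rho> in simp)
    have "summable (\<lambda>k. norm h * sqrt \<rho> ^ k)"
      using \<rho> by (intro summable_mult summable_geometric) simp
    then have "summable D" by (rule summable_comparison_test'[where N = 0]) (rule Dn)
    then have "D sums eval_inf h Z"
      unfolding eval_inf_def D_def[symmetric] by (rule summable_sums)
    moreover have "bounded_linear (\<lambda>F. cinner (blinfun_apply F x) y)"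
      by (rule bounded_linear_compose[OF bounded_linear_cinner_left blinfun.bounded_linear_left])
    ultimately have "(\<lambda>k. cinner (blinfun_apply (D k) x) y) sums cinner (blinfun_apply (eval_inf h Z) x) y"
      by (rule bounded_linear.sums[rotated])
    then show ?thesis using Ks[of h] unfolding Dxy by (rule sums_unique2)
  qed
  with K show ?thesis by blast
qed

lemma range_orthogonal_kernel:
  assumes T: "T \<in> hardy_ops"
    and 0: "\<And>\<beta>. cinner (blinfun_apply T (ell2_unit [])) (right_tail \<beta> K) = 0"
  shows "cinner (blinfun_apply T f) K = 0"
proof (rule ell2_functional_eqI[where \<phi> = "\<lambda>f. cinner (blinfun_apply T f) K" and \<psi> = "\<lambda>_. 0"])
  show "bounded_linear (\<lambda>f. cinner (blinfun_apply T f) K)"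
    by (rule bounded_linear_compose[OF bounded_linear_cinner_left blinfun.bounded_linear_right])
  show "cinner (blinfun_apply T (c *\<^sub>C f)) K = c * cinner (blinfun_apply T f) K" for c f
    by (simp add: bounded_ops_scaleC[OF hardy_ops_commute(1)[OF T]] cinner_scaleC_left)
  show "cinner (blinfun_apply T (ell2_unit \<beta>)) K = 0" for \<beta>
    unfolding hardy_op_unit[OF T, of \<beta>] cinner_right_append by (rule 0)
qed simp_all

text \<open>A tail of the kernel for \<open>x\<close> is the kernel for \<open>Z\<^sup>\<beta> x\<close>. If \<open>\<Theta>\<close> is orthogonal to all these
  kernels, so are its right translates, which
  span a dense subspace of the range of \<open>T\<close>.\<close>

lemma null_inf_range:
  fixes Z :: "'d::finite \<Rightarrow> nat ell2 \<Rightarrow>\<^sub>L nat ell2"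
  assumes T: "T \<in> hardy_ops" and Z: "Z \<in> row_ball_inf"
    and null: "null_inf (blinfun_apply T (ell2_unit [])) Z y"
  shows "null_inf (blinfun_apply T f) Z y"
  unfolding null_inf_def
proof
  fix x
  obtain K where K: "\<forall>\<alpha>. ell2_nth K \<alpha> = cnj (cinner (blinfun_apply (op_word Z \<alpha>) x) y)"
    and Kv: "\<And>h. cinner (blinfun_apply (eval_inf h Z) x) y = cinner h K"
    using eval_inf_kernel[OF Z, of x y] by blast
  have "cinner (blinfun_apply T (ell2_unit [])) (right_tail \<beta> K) = 0" for \<beta>
  proof -
    obtain K' where K': "\<forall>\<alpha>. ell2_nth K' \<alpha> = cnj (cinner (blinfun_apply (op_word Z \<alpha>) (blinfun_apply (op_word Z \<beta>) x)) y)"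
      and K'v: "\<And>h. cinner (blinfun_apply (eval_inf h Z) (blinfun_apply (op_word Z \<beta>) x)) y = cinner h K'"
      using eval_inf_kernel[OF Z, of "blinfun_apply (op_word Z \<beta>) x" y] by blast
    have "right_tail \<beta> K = K'"
      by (rule ell2_eqI) (simp add: right_tail.rep_eq K K' op_word_append)
    then show ?thesis using null by (simp add: null_inf_def flip: K'v)
  qed
  then show "cinner (blinfun_apply (eval_inf (blinfun_apply T f) Z) x) y = 0"
    unfolding Kv by (rule range_orthogonal_kernel[OF T])
qed

subsection \<open>Matrix points\<close>

lemma vec_l2norm_smult: "vec_l2norm (a \<cdot>\<^sub>v v) = cmod a * vec_l2norm v"
proof -
  have "vec_l2norm (a \<cdot>\<^sub>v v) = L2_set (\<lambda>i. cmod a * cmod (v $ i)) {..<dim_vec v}"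
    unfolding vec_l2norm_def by (intro L2_set_cong) (simp_all add: norm_mult)
  also have "\<dots> = cmod a * vec_l2norm v"
    unfolding vec_l2norm_def by (rule L2_set_right_distrib[symmetric]) simp
  finally show ?thesis .
qed

lemma vec_l2norm_nonneg: "0 \<le> vec_l2norm v"
  by (simp add: vec_l2norm_def L2_set_nonneg)

lemma mat_opnorm_bound:
  assumes M: "M \<in> carrier_mat n n" and v: "v \<in> carrier_vec n"
  shows "vec_l2norm (M *\<^sub>v v) \<le> mat_opnorm M * vec_l2norm v"
proof -
  let ?A = "{v \<in> carrier_vec (dim_col M). vec_l2norm v \<le> 1}"
  have bdd: "bdd_above ((\<lambda>v. vec_l2norm (M *\<^sub>v v)) ` ?A)"
  proof (rule bdd_aboveI2)
    fix u assume "u \<in> ?A"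
    then have u: "u \<in> carrier_vec n" "vec_l2norm u \<le> 1" using M by auto
    have u1: "cmod (u $ q) \<le> 1" if "q < n" for q
    proof -
      have "cmod (u $ q) \<le> vec_l2norm u"
        unfolding vec_l2norm_def using that u(1) by (intro member_le_L2_set) auto
      then show ?thesis using u(2) by simp
    qed
    have d: "dim_vec (M *\<^sub>v u) = n" using M by simp
    have "vec_l2norm (M *\<^sub>v u) \<le> (\<Sum>p<n. cmod ((M *\<^sub>v u) $ p))"
      unfolding vec_l2norm_def d by (rule L2_set_le_sum) simp
    also have "\<dots> \<le> (\<Sum>p<n. \<Sum>q<n. cmod (M $$ (p, q)))"
    proof (rule sum_mono)
      fix p assume "p \<in> {..<n}"
      then have "(M *\<^sub>v u) $ p = (\<Sum>q<n. M $$ (p, q) * u $ q)" using mat_vec_entry[OF M u(1)] by simp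
      then have "cmod ((M *\<^sub>v u) $ p) \<le> (\<Sum>q<n. cmod (M $$ (p, q) * u $ q))" by (simp add: norm_sum)
      also have "\<dots> \<le> (\<Sum>q<n. cmod (M $$ (p, q)))"
        using u1 by (intro sum_mono) (simp add: norm_mult mult_left_le)
      finally show "cmod ((M *\<^sub>v u) $ p) \<le> (\<Sum>q<n. cmod (M $$ (p, q)))" .
    qed
    finally show "vec_l2norm (M *\<^sub>v u) \<le> (\<Sum>p<n. \<Sum>q<n. cmod (M $$ (p, q)))" .
  qed
  define c where "c = vec_l2norm v"
  show ?thesis
  proof (cases "c = 0")
    case True
    then have "v $ q = 0" if "q < n" for q
      using that v unfolding c_def vec_l2norm_def by (simp add: L2_set_eq_0_iff)
    then have "(M *\<^sub>v v) $ p = 0" if "p < n" for p using that by (simp add: mat_vec_entry[OF M v])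
    then have "vec_l2norm (M *\<^sub>v v) = 0" using M by (simp add: vec_l2norm_def L2_set_eq_0_iff)
    then show ?thesis using True by (simp add: c_def)
  next
    case False
    then have c: "c > 0" using vec_l2norm_nonneg[of v] by (simp add: c_def)
    define u where "u = complex_of_real (1 / c) \<cdot>\<^sub>v v"
    have u: "u \<in> ?A" using M v c by (simp add: u_def vec_l2norm_smult norm_divide) (simp add: c_def)
    have "M *\<^sub>v u = complex_of_real (1 / c) \<cdot>\<^sub>v (M *\<^sub>v v)"
      unfolding u_def by (rule mult_mat_vec[OF M v])
    then have "vec_l2norm (M *\<^sub>v u) = vec_l2norm (M *\<^sub>v v) / c"
      using c by (simp add: vec_l2norm_smult norm_divide)
    moreover have "vec_l2norm (M *\<^sub>v u) \<le> mat_opnorm M"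
      unfolding mat_opnorm_def by (rule cSUP_upper[OF u bdd])
    ultimately show ?thesis using c by (simp add: field_simps c_def)
  qed
qed

text \<open>The adjoint of \<open>Z j\<close> acting on the first \<open>n\<close> coordinates, so that the estimates for iterated
  adjoints on a normed space apply to matrices.\<close>

definition mat_adjoint_map :: "nat \<Rightarrow> ('d \<Rightarrow> complex mat) \<Rightarrow> 'd \<Rightarrow> nat ell2 \<Rightarrow> nat ell2" where
  "mat_adjoint_map n Z j y = (\<Sum>q<n. (\<Sum>p<n. cnj (Z j $$ (p, q)) * ell2_nth y p) *\<^sub>C ell2_unit q)"

lemma ell2_nth_unit_combination:
  fixes n :: nat
  shows "ell2_nth (\<Sum>q<n. a q *\<^sub>C ell2_unit q) i = (if i < n then a i else 0)"
proof -
  have "ell2_nth (\<Sum>q<n. a q *\<^sub>C ell2_unit q) i = (\<Sum>q<n. if q = i then a q else 0)"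
    unfolding ell2_nth_sum by (intro sum.cong refl) (auto simp: scaleC.rep_eq ell2_unit.rep_eq)
  then show ?thesis by simp
qed

lemma norm_unit_combination:
  fixes n :: nat
  shows "(norm (\<Sum>q<n. a q *\<^sub>C ell2_unit q))\<^sup>2 = (\<Sum>q<n. (cmod (a q))\<^sup>2)"
proof -
  have "((\<lambda>i. (cmod (if i < n then a i else 0))\<^sup>2) has_sum (\<Sum>q<n. (cmod (a q))\<^sup>2)) UNIV"
    by (rule has_sum_cong_neutral[THEN iffD1, OF _ _ _ has_sum_finite[OF finite_lessThan[of n]]]) auto
  then show ?thesis
    using norm_ell2_has_sum[of "\<Sum>q<n. a q *\<^sub>C ell2_unit q"] has_sum_unique
    unfolding ell2_nth_unit_combination by blast
qed

lemma mat_adjoint_entry: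
  assumes "M \<in> carrier_mat n k" "q < k" "p < n"
  shows "mat_adjoint M $$ (q, p) = cnj (M $$ (p, q))"
  using assms by (simp add: mat_adjoint_def mat_of_rows_def)

lemma row_ball_fin_contraction:
  fixes Z :: "'d::finite \<Rightarrow> complex mat"
  assumes Z: "Z \<in> row_ball_fin n"
  shows "\<exists>\<rho>. (\<forall>y. (\<Sum>j\<in>UNIV. (norm (mat_adjoint_map n Z j y))\<^sup>2) \<le> \<rho> * (norm y)\<^sup>2) \<and> 0 \<le> \<rho> \<and> \<rho> < 1"
proof -
  define G where "G = mat n n (\<lambda>p. \<Sum>j\<in>UNIV. (Z j * mat_adjoint (Z j)) $$ p)"
  have Zc: "Z j \<in> carrier_mat n n" for j using Z by (simp add: row_ball_fin_def)
  have "sqrt (mat_opnorm G) < 1" using Z by (simp add: row_ball_fin_def G_def)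
  then have lt: "mat_opnorm G < 1" by simp
  have Gc: "G \<in> carrier_mat n n" by (simp add: G_def)
  have Ge: "G $$ (p, s) = (\<Sum>j\<in>UNIV. \<Sum>q<n. Z j $$ (p, q) * cnj (Z j $$ (s, q)))" if "p < n" "s < n" for p s
  proof -
    have "mat_adjoint (Z j) \<in> carrier_mat n n" for j
      using mat_of_rows_carrier(1)[of "dim_row (Z j)" "map conjugate (cols (Z j))"]
      unfolding mat_adjoint_def length_map cols_length carrier_matD[OF Zc] .
    then show ?thesis
      using that Zc by (simp add: G_def mat_mult_entry[of _ n n _ n] mat_adjoint_entry[of _ n n] del: index_mult_mat)
  qed
  have le: "(\<Sum>j\<in>UNIV. (norm (mat_adjoint_map n Z j y))\<^sup>2) \<le> max 0 (mat_opnorm G) * (norm y)\<^sup>2" for y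
  proof -
    define v where "v = vec n (ell2_nth y)"
    have v: "v \<in> carrier_vec n" by (simp add: v_def)
    have nv: "(vec_l2norm v)\<^sup>2 = (\<Sum>p<n. (cmod (ell2_nth y p))\<^sup>2)"
      by (simp add: vec_l2norm_def L2_set_def v_def sum_nonneg)
    define s where "s = (\<Sum>j\<in>UNIV. (norm (mat_adjoint_map n Z j y))\<^sup>2)"
    have "complex_of_real s = (\<Sum>j\<in>UNIV. \<Sum>q<n. cnj (\<Sum>p<n. cnj (Z j $$ (p, q)) * ell2_nth y p) * (\<Sum>t<n. cnj (Z j $$ (t, q)) * ell2_nth y t))"
      by (simp add: s_def mat_adjoint_map_def norm_unit_combination complex_norm_square mult.commute del: of_real_power cnj_sum)
    also have "\<dots> = (\<Sum>j\<in>UNIV. \<Sum>q<n. \<Sum>p<n. \<Sum>t<n. cnj (ell2_nth y p) * (Z j $$ (p, q) * cnj (Z j $$ (t, q)) * ell2_nth y t))"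
      unfolding cnj_sum sum_product by (intro sum.cong refl) (simp add: mult_ac)
    also have "\<dots> = (\<Sum>j\<in>UNIV. \<Sum>p<n. \<Sum>q<n. \<Sum>t<n. cnj (ell2_nth y p) * (Z j $$ (p, q) * cnj (Z j $$ (t, q)) * ell2_nth y t))"
      by (intro sum.cong refl sum.swap)
    also have "\<dots> = (\<Sum>j\<in>UNIV. \<Sum>p<n. \<Sum>t<n. \<Sum>q<n. cnj (ell2_nth y p) * (Z j $$ (p, q) * cnj (Z j $$ (t, q)) * ell2_nth y t))"
      by (intro sum.cong refl sum.swap)
    also have "\<dots> = (\<Sum>p<n. \<Sum>j\<in>UNIV. \<Sum>t<n. \<Sum>q<n. cnj (ell2_nth y p) * (Z j $$ (p, q) * cnj (Z j $$ (t, q)) * ell2_nth y t))"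
      by (rule sum.swap)
    also have "\<dots> = (\<Sum>p<n. \<Sum>t<n. \<Sum>j\<in>UNIV. \<Sum>q<n. cnj (ell2_nth y p) * (Z j $$ (p, q) * cnj (Z j $$ (t, q)) * ell2_nth y t))"
      by (intro sum.cong refl sum.swap)
    also have "\<dots> = (\<Sum>p<n. cnj (ell2_nth y p) * (G *\<^sub>v v) $ p)"
    proof (intro sum.cong refl)
      fix p assume "p \<in> {..<n}"
      then have p: "p < n" by simp
      have "(G *\<^sub>v v) $ p = (\<Sum>t<n. (\<Sum>j\<in>UNIV. \<Sum>q<n. Z j $$ (p, q) * cnj (Z j $$ (t, q))) * ell2_nth y t)"
        unfolding mat_vec_entry[OF Gc v p] using p by (intro sum.cong refl) (simp add: Ge v_def)
      then show "(\<Sum>t<n. \<Sum>j\<in>UNIV. \<Sum>q<n. cnj (ell2_nth y p) * (Z j $$ (p, q) * cnj (Z j $$ (t, q)) * ell2_nth y t)) =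
          cnj (ell2_nth y p) * (G *\<^sub>v v) $ p"
        by (simp add: sum_distrib_left sum_distrib_right)
    qed
    finally have "\<bar>s\<bar> = cmod (\<Sum>p<n. cnj (ell2_nth y p) * (G *\<^sub>v v) $ p)" by (metis norm_of_real)
    also have "\<dots> \<le> (\<Sum>p<n. \<bar>cmod (v $ p)\<bar> * \<bar>cmod ((G *\<^sub>v v) $ p)\<bar>)"
      by (rule order_trans[OF norm_sum]) (simp add: norm_mult v_def)
    also have "\<dots> \<le> L2_set (\<lambda>p. cmod (v $ p)) {..<n} * L2_set (\<lambda>p. cmod ((G *\<^sub>v v) $ p)) {..<n}"
      by (rule L2_set_mult_ineq)
    also have "\<dots> = vec_l2norm v * vec_l2norm (G *\<^sub>v v)"
      using Gc v by (simp add: vec_l2norm_def)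
    also have "\<dots> \<le> vec_l2norm v * (max 0 (mat_opnorm G) * vec_l2norm v)"
      by (intro mult_left_mono vec_l2norm_nonneg order_trans[OF mat_opnorm_bound[OF Gc v]] mult_right_mono) simp_all
    also have "\<dots> = max 0 (mat_opnorm G) * (vec_l2norm v)\<^sup>2" by (simp add: power2_eq_square mult_ac)
    also have "\<dots> \<le> max 0 (mat_opnorm G) * (norm y)\<^sup>2"
      unfolding nv by (intro mult_left_mono ell2_sum_le_norm) simp_all
    finally show ?thesis by (simp add: s_def)
  qed
  show ?thesis
    by (rule exI[of _ "max 0 (mat_opnorm G)"]) (intro conjI allI le; use lt in simp)
qed

lemma mat_adjoint_word:
  assumes Z: "\<forall>j. Z j \<in> carrier_mat n n" and q: "q < n"
  shows "ell2_nth (iterate_word (mat_adjoint_map n Z) \<alpha> y) q =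
    (\<Sum>p<n. cnj (mat_word n Z \<alpha> $$ (p, q)) * ell2_nth y p)"
proof (induction \<alpha> arbitrary: y)
  case Nil
  have "(\<Sum>p<n. cnj (mat_word n Z [] $$ (p, q)) * ell2_nth y p) = (\<Sum>p<n. if p = q then ell2_nth y p else 0)"
    using q by (intro sum.cong refl) (simp add: mat_word_def)
  then show ?case using q by simp
next
  case (Cons j \<alpha>)
  have Zj: "Z j \<in> carrier_mat n n" using Z by blast
  have "ell2_nth (iterate_word (mat_adjoint_map n Z) (j # \<alpha>) y) q =
      (\<Sum>l<n. \<Sum>p<n. cnj (mat_word n Z \<alpha> $$ (l, q)) * (cnj (Z j $$ (p, l)) * ell2_nth y p))"
    by (simp add: Cons.IH mat_adjoint_map_def ell2_nth_unit_combination sum_distrib_left)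
  also have "\<dots> = (\<Sum>p<n. (\<Sum>l<n. cnj (Z j $$ (p, l) * mat_word n Z \<alpha> $$ (l, q))) * ell2_nth y p)"
    by (subst sum.swap) (simp add: sum_distrib_right sum_distrib_left mult_ac)
  also have "\<dots> = (\<Sum>p<n. cnj (mat_word n Z (j # \<alpha>) $$ (p, q)) * ell2_nth y p)"
    using q by (intro sum.cong refl)
      (simp add: mat_word_Cons mat_mult_entry[OF Zj mat_word_carrier[OF Z]] del: index_mult_mat)
  finally show ?case .
qed

text \<open>The kernel of a matrix entry. Its coefficients are bounded by iterating the adjoints on the
  unit vector at \<open>p\<close>.\<close>

lemma eval_fin_kernel:
  fixes Z :: "'d::finite \<Rightarrow> complex mat"
  assumes Z: "Z \<in> row_ball_fin n" and pq: "p < n" "q < n"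
  shows "\<exists>K. (\<forall>\<alpha>. ell2_nth K \<alpha> = cnj (mat_word n Z \<alpha> $$ (p, q))) \<and>
    (\<forall>h. eval_fin h n Z $$ (p, q) = cinner h K)"
proof -
  obtain \<rho> where *: "(\<forall>y. (\<Sum>j\<in>UNIV. (norm (mat_adjoint_map n Z j y))\<^sup>2) \<le> \<rho> * (norm y)\<^sup>2) \<and> 0 \<le> \<rho> \<and> \<rho> < 1"
    using row_ball_fin_contraction[OF Z] ..
  have con: "(\<Sum>j\<in>UNIV. (norm (mat_adjoint_map n Z j y))\<^sup>2) \<le> \<rho> * (norm y)\<^sup>2" for y using * by simp
  have \<rho>: "0 \<le> \<rho>" "\<rho> < 1" using * by simp_all
  have Zc: "\<forall>j. Z j \<in> carrier_mat n n" using Z by (simp add: row_ball_fin_def)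
  let ?e = "ell2_unit p :: nat ell2"
  have "(\<Sum>\<alpha> | length \<alpha> = k. (cmod (mat_word n Z \<alpha> $$ (p, q)))\<^sup>2) \<le> (norm ?e)\<^sup>2 * \<rho> ^ k" for k
  proof -
    have "(\<Sum>\<alpha> | length \<alpha> = k. (cmod (mat_word n Z \<alpha> $$ (p, q)))\<^sup>2) \<le>
      (\<Sum>\<alpha> | length \<alpha> = k. (norm (iterate_word (mat_adjoint_map n Z) \<alpha> ?e))\<^sup>2)"
    proof (rule sum_mono)
      fix \<alpha>
      have "ell2_nth (iterate_word (mat_adjoint_map n Z) \<alpha> ?e) q = (\<Sum>s<n. if s = p then cnj (mat_word n Z \<alpha> $$ (s, q)) else 0)"
        unfolding mat_adjoint_word[OF Zc pq(2)] by (intro sum.cong refl) (simp add: ell2_unit.rep_eq)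
      then have "ell2_nth (iterate_word (mat_adjoint_map n Z) \<alpha> ?e) q = cnj (mat_word n Z \<alpha> $$ (p, q))"
        using pq(1) by simp
      then show "(cmod (mat_word n Z \<alpha> $$ (p, q)))\<^sup>2 \<le> (norm (iterate_word (mat_adjoint_map n Z) \<alpha> ?e))\<^sup>2"
        using ell2_nth_le_norm[of "iterate_word (mat_adjoint_map n Z) \<alpha> ?e" q] by (intro power_mono) simp_all
    qed
    also have "\<dots> \<le> \<rho> ^ k * (norm ?e)\<^sup>2" by (rule iterate_word_contraction[OF con \<rho>(1)])
    finally show ?thesis by (simp add: mult.commute)
  qed
  from word_kernel[OF this \<rho>] obtain K where K: "\<forall>\<alpha>. ell2_nth K \<alpha> = cnj (mat_word n Z \<alpha> $$ (p, q))"
    and Ks: "\<And>h. (\<lambda>k. \<Sum>\<alpha> | length \<alpha> = k. ell2_nth h \<alpha> * mat_word n Z \<alpha> $$ (p, q)) sums cinner h K"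
    by auto
  have "eval_fin h n Z $$ (p, q) = cinner h K" for h
    using sums_unique[OF Ks[of h]] pq by (simp add: eval_fin_def)
  with K show ?thesis by blast
qed

text \<open>As at operator points: the tail at \<open>\<beta>\<close> of the kernel \<open>Y q\<close> for the column \<open>q\<close> is a
  combination of the kernels for all columns, with coefficients from the column \<open>q\<close> of \<open>Z\<^sup>\<beta>\<close>.\<close>

lemma null_fin_range:
  fixes Z :: "'d::finite \<Rightarrow> complex mat"
  assumes T: "T \<in> hardy_ops" and Z: "Z \<in> row_ball_fin n" and y: "y \<in> carrier_vec n"
    and null: "null_fin (blinfun_apply T (ell2_unit [])) n Z y"
  shows "null_fin (blinfun_apply T f) n Z y"
proof -
  have Zc: "\<forall>j. Z j \<in> carrier_mat n n" using Z by (simp add: row_ball_fin_def)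
  define K where "K p q = (SOME K. (\<forall>\<alpha>. ell2_nth K \<alpha> = cnj (mat_word n Z \<alpha> $$ (p, q))) \<and>
    (\<forall>h. eval_fin h n Z $$ (p, q) = cinner h K))" for p q
  have K: "(\<forall>\<alpha>. ell2_nth (K p q) \<alpha> = cnj (mat_word n Z \<alpha> $$ (p, q))) \<and>
    (\<forall>h. eval_fin h n Z $$ (p, q) = cinner h (K p q))" if "p < n" "q < n" for p q
    unfolding K_def by (rule someI_ex[OF eval_fin_kernel[OF Z that]])
  define Y where "Y q = (\<Sum>p<n. y $ p *\<^sub>C K p q)" for q
  have Y: "col (eval_fin h n Z) q \<bullet>c y = cinner h (Y q)" if q: "q < n" for h q
  proof -
    have "col (eval_fin h n Z) q \<bullet>c y = (\<Sum>p<n. eval_fin h n Z $$ (p, q) * cnj (y $ p))"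
      using y q by (simp add: scalar_prod_def atLeast0LessThan eval_fin_def)
    then show ?thesis using K q by (simp add: Y_def cinner_sum_right cinner_scaleC_right mult.commute)
  qed
  have tail: "right_tail \<beta> (Y q) = (\<Sum>l<n. cnj (mat_word n Z \<beta> $$ (l, q)) *\<^sub>C Y l)" if q: "q < n" for \<beta> q
  proof (rule ell2_eqI)
    fix \<alpha>
    have YN: "ell2_nth (Y l) \<gamma> = (\<Sum>p<n. y $ p * cnj (mat_word n Z \<gamma> $$ (p, l)))" if "l < n" for l \<gamma>
      using K that by (simp add: Y_def ell2_nth_sum scaleC.rep_eq)
    have "ell2_nth (right_tail \<beta> (Y q)) \<alpha> = (\<Sum>p<n. y $ p * cnj (\<Sum>l<n. mat_word n Z \<alpha> $$ (p, l) * mat_word n Z \<beta> $$ (l, q)))"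
      using q by (simp add: right_tail.rep_eq YN mat_word_append[OF Zc]
          mat_mult_entry[OF mat_word_carrier[OF Zc] mat_word_carrier[OF Zc]] del: index_mult_mat cnj_sum)
    also have "\<dots> = (\<Sum>p<n. \<Sum>l<n. cnj (mat_word n Z \<beta> $$ (l, q)) * (y $ p * cnj (mat_word n Z \<alpha> $$ (p, l))))"
      by (simp add: sum_distrib_left mult_ac)
    also have "\<dots> = (\<Sum>l<n. cnj (mat_word n Z \<beta> $$ (l, q)) * ell2_nth (Y l) \<alpha>)"
      by (subst sum.swap) (simp add: sum_distrib_left YN)
    finally show "ell2_nth (right_tail \<beta> (Y q)) \<alpha> = ell2_nth (\<Sum>l<n. cnj (mat_word n Z \<beta> $$ (l, q)) *\<^sub>C Y l) \<alpha>"
      by (simp add: ell2_nth_sum scaleC.rep_eq)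
  qed
  have "cinner (blinfun_apply T f) (Y q) = 0" if q: "q < n" for q
  proof (rule range_orthogonal_kernel[OF T])
    fix \<beta>
    have "cinner (blinfun_apply T (ell2_unit [])) (Y l) = 0" if "l < n" for l
      using null that unfolding null_fin_def by (simp add: Y)
    then show "cinner (blinfun_apply T (ell2_unit [])) (right_tail \<beta> (Y q)) = 0"
      unfolding tail[OF q] by (simp add: cinner_sum_right cinner_scaleC_right)
  qed
  then show ?thesis unfolding null_fin_def by (simp add: Y)
qed

section \<open>Tails of a series\<close>

lemma series_decomposition:
  fixes f :: "'d::finite list ell2"
  shows "f = ell2_nth f [] *\<^sub>C ell2_unit [] + (\<Sum>k\<in>UNIV. right_shift_fun k (right_tail [k] f))"
proof (rule ell2_eqI)
  fix \<omega>
  show "ell2_nth f \<omega> =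
    ell2_nth (ell2_nth f [] *\<^sub>C ell2_unit [] + (\<Sum>k\<in>UNIV. right_shift_fun k (right_tail [k] f))) \<omega>"
    by (cases \<omega> rule: rev_cases)
      (simp_all add: plus_ell2.rep_eq scaleC.rep_eq ell2_unit.rep_eq ell2_nth_sum right_shift_fun.rep_eq right_tail.rep_eq)
qed

lemma norm_right_tails:
  fixes f :: "'d::finite list ell2"
  shows "(\<Sum>k\<in>UNIV. (norm (right_tail [k] f))\<^sup>2) = (norm f)\<^sup>2 - (cmod (ell2_nth f []))\<^sup>2"
proof -
  have "cinner f f = cinner (ell2_nth f [] *\<^sub>C ell2_unit [] + (\<Sum>k\<in>UNIV. right_shift_fun k (right_tail [k] f))) f"
    by (rule arg_cong[OF series_decomposition, of "\<lambda>x. cinner x f"])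
  also have "\<dots> = ell2_nth f [] * cnj (ell2_nth f []) + (\<Sum>k\<in>UNIV. cinner (right_tail [k] f) (right_tail [k] f))"
    by (simp add: cinner_add_left cinner_scaleC_left cinner_unit_left cinner_sum_left cinner_right_shift)
  finally have "complex_of_real ((norm f)\<^sup>2) = complex_of_real ((cmod (ell2_nth f []))\<^sup>2 + (\<Sum>k\<in>UNIV. (norm (right_tail [k] f))\<^sup>2))"
    unfolding cinner_self complex_norm_square[symmetric] of_real_add of_real_sum .
  then show ?thesis unfolding of_real_eq_iff by simp
qed

lemma words_snoc: "{\<alpha> :: 'd list. length \<alpha> = Suc k} = (\<Union>j. (\<lambda>\<alpha>. \<alpha> @ [j]) ` {\<alpha>. length \<alpha> = k})"
proof (intro equalityI subsetI)
  fix \<alpha> :: "'d list" assume "\<alpha> \<in> {\<alpha>. length \<alpha> = Suc k}"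
  then show "\<alpha> \<in> (\<Union>j. (\<lambda>\<alpha>. \<alpha> @ [j]) ` {\<alpha>. length \<alpha> = k})"
    by (cases \<alpha> rule: rev_cases) auto
qed auto

lemma sum_words_snoc:
  fixes g :: "'d::finite list \<Rightarrow> 'b::comm_monoid_add"
  shows "(\<Sum>\<alpha> | length \<alpha> = Suc k. g \<alpha>) = (\<Sum>j\<in>UNIV. \<Sum>\<alpha> | length \<alpha> = k. g (\<alpha> @ [j]))"
  unfolding words_snoc
  by (subst sum.UNION_disjoint) (auto simp: finite_words sum.reindex inj_on_def)

definition word_energy :: "nat \<Rightarrow> 'd list ell2 \<Rightarrow> real" where
  "word_energy l f = (\<Sum>\<alpha> | length \<alpha> = l. (cmod (ell2_nth f \<alpha>))\<^sup>2)"

text \<open>The sum of the squared coefficients at words of length at least \<open>n\<close>.\<close>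

definition tail_energy :: "nat \<Rightarrow> 'd list ell2 \<Rightarrow> real" where
  "tail_energy n f = (norm f)\<^sup>2 - (\<Sum>l<n. word_energy l f)"

definition radius_energy :: "real \<Rightarrow> nat \<Rightarrow> 'd list ell2 \<Rightarrow> real" where
  "radius_energy \<tau> N f = (\<Sum>l<N. \<tau> ^ l * word_energy l f)"

text \<open>The square sum of the coefficients stays finite when the words of length \<open>l\<close> get the weight
  \<open>\<tau> ^ l\<close>.\<close>

definition decaying :: "real \<Rightarrow> 'd list ell2 \<Rightarrow> bool" where
  "decaying \<tau> f \<longleftrightarrow> (\<exists>C. \<forall>N. radius_energy \<tau> N f \<le> C)"

lemma word_energy_0: "word_energy 0 f = (cmod (ell2_nth f []))\<^sup>2"
  by (simp add: word_energy_def)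

lemma word_energy_Suc:
  fixes f :: "'d::finite list ell2"
  shows "word_energy (Suc l) f = (\<Sum>k\<in>UNIV. word_energy l (right_tail [k] f))"
  by (simp add: word_energy_def sum_words_snoc right_tail.rep_eq)

lemma tail_energy_tendsto: "(\<lambda>n. tail_energy n f) \<longlonglongrightarrow> 0"
  for f :: "'d::finite list ell2"
proof -
  have "(\<lambda>k. word_energy k f) sums (norm f)\<^sup>2"
    unfolding word_energy_def by (rule has_sum_words_sums[OF norm_ell2_has_sum])
  then have "(\<lambda>n. \<Sum>l<n. word_energy l f) \<longlonglongrightarrow> (norm f)\<^sup>2" by (simp add: sums_def)
  then have "(\<lambda>n. (norm f)\<^sup>2 - (\<Sum>l<n. word_energy l f)) \<longlonglongrightarrow> (norm f)\<^sup>2 - (norm f)\<^sup>2"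
    by (rule tendsto_diff[OF tendsto_const])
  then show ?thesis by (simp add: tail_energy_def)
qed

lemma tail_energy_0: "tail_energy 0 f = (norm f)\<^sup>2"
  by (simp add: tail_energy_def)

lemma tail_energy_Suc:
  fixes f :: "'d::finite list ell2"
  shows "tail_energy (Suc n) f = (\<Sum>k\<in>UNIV. tail_energy n (right_tail [k] f))"
proof -
  have "(\<Sum>k\<in>UNIV. tail_energy n (right_tail [k] f)) =
    (\<Sum>k\<in>UNIV. (norm (right_tail [k] f))\<^sup>2) - (\<Sum>k\<in>UNIV. \<Sum>l<n. word_energy l (right_tail [k] f))"
    by (simp add: tail_energy_def sum_subtractf)
  also have "(\<Sum>k\<in>UNIV. \<Sum>l<n. word_energy l (right_tail [k] f)) = (\<Sum>l<n. word_energy (Suc l) f)"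
    by (subst sum.swap) (simp add: word_energy_Suc)
  also have "(\<Sum>k\<in>UNIV. (norm (right_tail [k] f))\<^sup>2) = (norm f)\<^sup>2 - word_energy 0 f"
    by (simp add: norm_right_tails word_energy_0)
  finally show ?thesis unfolding tail_energy_def sum.lessThan_Suc_shift by simp
qed

lemma tail_energy_words:
  fixes f :: "'d::finite list ell2"
  shows "(\<Sum>\<alpha> | length \<alpha> = n. (norm (right_tail \<alpha> f))\<^sup>2) = tail_energy n f"
proof (induction n)
  case 0
  then show ?case by (simp add: right_tail_Nil tail_energy_0)
next
  case (Suc n)
  have "(\<Sum>\<alpha> | length \<alpha> = Suc n. (norm (right_tail \<alpha> f))\<^sup>2) =
    (\<Sum>\<alpha> | length \<alpha> = n. \<Sum>j\<in>UNIV. (norm (right_tail [j] (right_tail \<alpha> f)))\<^sup>2)"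
    unfolding sum_words_Suc by (subst sum.swap) (simp add: right_tail_append)
  also have "\<dots> = tail_energy n f - word_energy n f"
    unfolding norm_right_tails sum_subtractf Suc.IH word_energy_def by (simp add: right_tail.rep_eq)
  finally show ?case by (simp add: tail_energy_def)
qed

lemma tail_energy_nonneg: "0 \<le> tail_energy n f" for f :: "'d::finite list ell2"
  unfolding tail_energy_words[symmetric] by (rule sum_nonneg) simp

lemma word_energy_nonneg: "0 \<le> word_energy l f"
  unfolding word_energy_def by (rule sum_nonneg) simp

lemma tail_energy_le: "tail_energy n f \<le> (norm f)\<^sup>2"
  unfolding tail_energy_def using sum_nonneg[of "{..<n}" "\<lambda>l. word_energy l f", OF word_energy_nonneg] by simp

lemma radius_energy_Suc:
  fixes f :: "'d::finite list ell2"
  shows "radius_energy \<tau> (Suc N) f = (cmod (ell2_nth f []))\<^sup>2 + \<tau> * (\<Sum>k\<in>UNIV. radius_energy \<tau> N (right_tail [k] f))"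
proof -
  have "\<tau> * (\<Sum>k\<in>UNIV. radius_energy \<tau> N (right_tail [k] f)) =
    (\<Sum>l<N. \<Sum>k\<in>UNIV. \<tau> ^ Suc l * word_energy l (right_tail [k] f))"
    unfolding radius_energy_def by (subst sum.swap) (simp add: sum_distrib_left mult_ac)
  also have "\<dots> = (\<Sum>l<N. \<tau> ^ Suc l * word_energy (Suc l) f)"
    unfolding word_energy_Suc sum_distrib_left ..
  finally show ?thesis
    unfolding radius_energy_def sum.lessThan_Suc_shift by (simp add: word_energy_0)
qed

lemma decaying_step:
  fixes f :: "'d::finite list ell2"
  assumes "0 \<le> \<tau>" and dec: "\<And>k. decaying \<tau> (right_tail [k] f)"
  shows "decaying \<tau> f"
proof -
  have "\<forall>k. \<exists>C. \<forall>N. radius_energy \<tau> N (right_tail [k] f) \<le> C"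
    using dec unfolding decaying_def by blast
  from choice[OF this] obtain C where C: "\<forall>k N. radius_energy \<tau> N (right_tail [k] f) \<le> C k" ..
  have "radius_energy \<tau> N f \<le> max 0 ((cmod (ell2_nth f []))\<^sup>2 + \<tau> * (\<Sum>k\<in>UNIV. C k))" for N
  proof (cases N)
    case 0
    then show ?thesis by (simp add: radius_energy_def)
  next
    case (Suc M)
    have "(\<Sum>k\<in>UNIV. radius_energy \<tau> M (right_tail [k] f)) \<le> (\<Sum>k\<in>UNIV. C k)"
      using C by (intro sum_mono) blast
    then have "radius_energy \<tau> N f \<le> (cmod (ell2_nth f []))\<^sup>2 + \<tau> * (\<Sum>k\<in>UNIV. C k)"
      unfolding Suc radius_energy_Suc using assms(1) by (intro add_left_mono mult_left_mono)
    then show ?thesis by simp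
  qed
  then show ?thesis unfolding decaying_def by blast
qed

lemma decaying_steps:
  fixes f :: "'d::finite list ell2"
  assumes "0 \<le> \<tau>" and "\<And>\<alpha>. length \<alpha> = n \<Longrightarrow> decaying \<tau> (right_tail \<alpha> f)"
  shows "decaying \<tau> f"
  using assms(2)
proof (induction n arbitrary: f)
  case 0
  from 0[of "[]"] show ?case by (simp add: right_tail_Nil)
next
  case (Suc n)
  show ?case
  proof (rule decaying_step[OF assms(1)])
    fix k
    show "decaying \<tau> (right_tail [k] f)"
      by (rule Suc.IH) (simp add: right_tail_append Suc.prems)
  qed
qed

section \<open>Finite-dimensional spaces invariant under the backward shifts\<close>

lemma right_tail_scaleR: "right_tail \<beta> (c *\<^sub>R f) = c *\<^sub>R right_tail \<beta> f"
  by (simp add: scaleR_scaleC right_tail_scaleC)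

lemma right_tail_zero: "right_tail \<beta> 0 = 0"
  by (rule ell2_eqI) (simp add: right_tail.rep_eq zero_ell2.rep_eq)

lemma right_tail_sum: "right_tail \<beta> (\<Sum>i\<in>I. g i) = (\<Sum>i\<in>I. right_tail \<beta> (g i))"
  by (induction I rule: infinite_finite_induct) (simp_all add: right_tail_zero right_tail_add)

text \<open>The orthogonal projection to the span of \<open>B\<close> when \<open>B\<close> is finite and orthogonal. A zero
  vector in \<open>B\<close> does no harm, since division by zero gives zero.\<close>

definition orth_proj :: "'a::real_inner set \<Rightarrow> 'a \<Rightarrow> 'a" where
  "orth_proj B x = (\<Sum>b\<in>B. (inner x b / (inner b b)) *\<^sub>R b)"

lemma orth_proj_in_span: "orth_proj B x \<in> span B"
  unfolding orth_proj_def by (intro span_sum span_scale span_base)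

lemma orth_proj_orthogonal:
  assumes B: "finite B" "pairwise real_inner_class.orthogonal B" and m: "m \<in> span B"
  shows "inner (x - orth_proj B x) m = 0"
proof -
  have base: "inner (x - orth_proj B x) b = 0" if b: "b \<in> B" for b
  proof -
    have "inner (orth_proj B x) b = (\<Sum>a\<in>B. if a = b then (inner x b / (inner b b)) * (inner b b) else 0)"
      unfolding orth_proj_def inner_sum_left
      using B(2) b by (intro sum.cong refl) (auto simp: pairwise_def real_inner_class.orthogonal_def)
    also have "\<dots> = inner x b" using B(1) b by (cases "b = 0") simp_all
    finally show ?thesis by (simp add: inner_diff_left)
  qed
  have "real_vector.subspace {m. inner (x - orth_proj B x) m = 0}"
    by (rule real_vector.subspaceI) (simp_all add: inner_add_right)
  then have "span B \<subseteq> {m. inner (x - orth_proj B x) m = 0}"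
    using base by (intro span_minimal) auto
  then show ?thesis using m by blast
qed

lemma orth_proj_id:
  assumes B: "finite B" "pairwise real_inner_class.orthogonal B" and m: "m \<in> span B"
  shows "orth_proj B m = m"
proof -
  have "m - orth_proj B m \<in> span B" by (intro span_diff m orth_proj_in_span)
  from orth_proj_orthogonal[OF B this, of m] show ?thesis by simp
qed

lemma norm_residual_le:
  assumes B: "finite B" "pairwise real_inner_class.orthogonal B"
  shows "(norm (x - orth_proj B x))\<^sup>2 \<le> (norm x)\<^sup>2"
proof -
  let ?w = "x - orth_proj B x"
  have "inner ?w (orth_proj B x) = 0" by (rule orth_proj_orthogonal[OF B orth_proj_in_span])
  then have "(norm (?w + orth_proj B x))\<^sup>2 = (norm ?w)\<^sup>2 + (norm (orth_proj B x))\<^sup>2"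
    by (intro norm_add_Pythagorean) (simp add: real_inner_class.orthogonal_def)
  then show ?thesis by simp
qed

text \<open>Expand \<open>m\<close> in the orthogonal basis and apply the Cauchy-Schwarz inequality to every tail.\<close>

lemma tail_energy_span_bound:
  fixes B :: "'d::finite list ell2 set"
  assumes B: "finite B" "pairwise real_inner_class.orthogonal B" and m: "m \<in> span B"
  shows "tail_energy n m \<le> (norm m)\<^sup>2 * (\<Sum>b\<in>B. tail_energy n b / (norm b)\<^sup>2)"
proof -
  define c where "c b = inner m b / (inner b b)" for b
  have mc: "m = (\<Sum>b\<in>B. c b *\<^sub>R b)" using orth_proj_id[OF B m] by (simp add: orth_proj_def c_def)
  have nm: "(\<Sum>b\<in>B. (\<bar>c b\<bar> * norm b)\<^sup>2) = (norm m)\<^sup>2"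
  proof -
    have "inner m m = (\<Sum>b\<in>B. c b * (inner b m))" by (subst mc) (simp add: inner_sum_left)
    also have "\<dots> = (\<Sum>b\<in>B. (\<bar>c b\<bar> * norm b)\<^sup>2)"
    proof (intro sum.cong refl)
      fix b
      show "c b * (inner b m) = (\<bar>c b\<bar> * norm b)\<^sup>2"
      proof (cases "b = 0")
        case False
        then have "c b * inner b b = inner b m" by (simp add: c_def inner_commute)
        then have "c b * inner b m = (c b)\<^sup>2 * inner b b" by (simp add: power2_eq_square)
        then show ?thesis by (simp add: power_mult_distrib power2_norm_eq_inner)
      qed simp
    qed
    finally show ?thesis by (simp add: power2_norm_eq_inner)
  qed
  have "(norm (right_tail \<alpha> m))\<^sup>2 \<le> (norm m)\<^sup>2 * (\<Sum>b\<in>B. (norm (right_tail \<alpha> b))\<^sup>2 / (norm b)\<^sup>2)" for \<alpha>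
  proof -
    have "right_tail \<alpha> m = (\<Sum>b\<in>B. c b *\<^sub>R right_tail \<alpha> b)"
      by (subst mc) (simp add: right_tail_sum right_tail_scaleR)
    then have "norm (right_tail \<alpha> m) \<le> (\<Sum>b\<in>B. norm (c b *\<^sub>R right_tail \<alpha> b))" by (simp only: norm_sum)
    also have "\<dots> = (\<Sum>b\<in>B. \<bar>\<bar>c b\<bar> * norm b\<bar> * \<bar>norm (right_tail \<alpha> b) / norm b\<bar>)"
    proof (intro sum.cong refl)
      fix b
      show "norm (c b *\<^sub>R right_tail \<alpha> b) = \<bar>\<bar>c b\<bar> * norm b\<bar> * \<bar>norm (right_tail \<alpha> b) / norm b\<bar>"
        by (cases "b = 0") (simp_all add: right_tail_zero abs_mult)
    qed
    also have "\<dots> \<le> L2_set (\<lambda>b. \<bar>c b\<bar> * norm b) B * L2_set (\<lambda>b. norm (right_tail \<alpha> b) / norm b) B"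
      by (rule L2_set_mult_ineq)
    finally have "(norm (right_tail \<alpha> m))\<^sup>2 \<le> (L2_set (\<lambda>b. \<bar>c b\<bar> * norm b) B * L2_set (\<lambda>b. norm (right_tail \<alpha> b) / norm b) B)\<^sup>2"
      by (rule power_mono) simp
    also have "\<dots> = (norm m)\<^sup>2 * (\<Sum>b\<in>B. (norm (right_tail \<alpha> b))\<^sup>2 / (norm b)\<^sup>2)"
    proof -
      have "(L2_set (\<lambda>b. \<bar>c b\<bar> * norm b) B)\<^sup>2 = (norm m)\<^sup>2" unfolding L2_set_def nm by simp
      moreover have "(L2_set (\<lambda>b. norm (right_tail \<alpha> b) / norm b) B)\<^sup>2 = (\<Sum>b\<in>B. (norm (right_tail \<alpha> b))\<^sup>2 / (norm b)\<^sup>2)"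
        by (simp add: L2_set_def sum_nonneg power_divide)
      ultimately show ?thesis by (simp add: power_mult_distrib)
    qed
    finally show ?thesis .
  qed
  then have "(\<Sum>\<alpha> | length \<alpha> = n. (norm (right_tail \<alpha> m))\<^sup>2) \<le>
    (\<Sum>\<alpha> | length \<alpha> = n. (norm m)\<^sup>2 * (\<Sum>b\<in>B. (norm (right_tail \<alpha> b))\<^sup>2 / (norm b)\<^sup>2))"
    by (intro sum_mono)
  also have "\<dots> = (norm m)\<^sup>2 * (\<Sum>b\<in>B. (\<Sum>\<alpha> | length \<alpha> = n. (norm (right_tail \<alpha> b))\<^sup>2) / (norm b)\<^sup>2)"
    unfolding sum_distrib_left[symmetric] by (subst sum.swap) (simp add: sum_divide_distrib)
  finally show ?thesis by (simp add: tail_energy_words)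
qed

text \<open>The energies of a finite basis beyond degree \<open>n\<close> tend to zero, and the previous bound makes
  this uniform: for some \<open>n\<close>, at least half the energy of every \<open>m\<close> in the span lies in degrees
  below \<open>n\<close>. The backward shifts are therefore jointly a strict contraction for the squared norm
  \<open>q m = (\<Sum>j<n. tail_energy j m)\<close>, which is equivalent to the original one. Iterating the
  contraction along the words bounds the weighted energies for every \<open>\<tau>\<close> with \<open>\<tau> \<rho> < 1\<close>.\<close>

lemma finite_dimensional_decay:
  fixes B :: "'d::finite list ell2 set"
  assumes B: "finite B" "pairwise real_inner_class.orthogonal B"
    and inv: "\<And>m k. m \<in> span B \<Longrightarrow> right_tail [k] m \<in> span B"
  shows "\<exists>\<tau>>1. \<forall>m\<in>span B. decaying \<tau> m"
proof -
  have "(\<lambda>n. \<Sum>b\<in>B. tail_energy n b / (norm b)\<^sup>2) \<longlonglongrightarrow> (\<Sum>b\<in>B. 0 / (norm b)\<^sup>2)"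
    by (intro tendsto_sum tendsto_divide_zero[THEN tendsto_eq_rhs] tail_energy_tendsto) simp
  then have "\<forall>\<^sub>F n in sequentially. (\<Sum>b\<in>B. tail_energy n b / (norm b)\<^sup>2) < 1 / 2"
    by (rule order_tendstoD) simp
  then have "\<forall>\<^sub>F n in sequentially. (\<Sum>b\<in>B. tail_energy n b / (norm b)\<^sup>2) < 1 / 2 \<and> 1 \<le> n"
    by (intro eventually_conj eventually_ge_at_top)
  then obtain n where n: "(\<Sum>b\<in>B. tail_energy n b / (norm b)\<^sup>2) < 1 / 2" "1 \<le> n"
    by (auto simp: eventually_sequentially)
  have half: "tail_energy n m \<le> (norm m)\<^sup>2 / 2" if "m \<in> span B" for m
  proof -
    have "tail_energy n m \<le> (norm m)\<^sup>2 * (\<Sum>b\<in>B. tail_energy n b / (norm b)\<^sup>2)"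
      by (rule tail_energy_span_bound[OF B that])
    also have "\<dots> \<le> (norm m)\<^sup>2 * (1 / 2)" using n(1) by (intro mult_left_mono) simp_all
    finally show ?thesis by simp
  qed
  define q where "q m = (\<Sum>j<n. tail_energy j m)" for m :: "'d list ell2"
  define \<rho> where "\<rho> = 1 - 1 / (2 * real n)"
  have \<rho>: "0 < \<rho>" "\<rho> < 1" using n(2) by (simp_all add: \<rho>_def field_simps)
  have q_upper: "q m \<le> real n * (norm m)\<^sup>2" for m
    unfolding q_def using sum_bounded_above[of "{..<n}" "\<lambda>j. tail_energy j m" "(norm m)\<^sup>2", OF tail_energy_le] by simp
  have q_lower: "(norm m)\<^sup>2 \<le> q m" for m
  proof -
    have "tail_energy 0 m \<le> q m"
      unfolding q_def using n(2) by (intro member_le_sum) (simp_all add: tail_energy_nonneg)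
    then show ?thesis by (simp add: tail_energy_0)
  qed
  have contract: "(\<Sum>k\<in>UNIV. q (right_tail [k] m)) \<le> \<rho> * q m" if m: "m \<in> span B" for m
  proof -
    have "(\<Sum>k\<in>UNIV. q (right_tail [k] m)) = (\<Sum>j<n. tail_energy (Suc j) m)"
      unfolding q_def tail_energy_Suc by (rule sum.swap)
    also have "\<dots> = q m + tail_energy n m - (norm m)\<^sup>2"
      using sum.lessThan_Suc_shift[of "\<lambda>j. tail_energy j m" n] by (simp add: q_def tail_energy_0)
    also have "\<dots> \<le> q m - (norm m)\<^sup>2 / 2" using half[OF m] by simp
    also have "\<dots> \<le> q m - q m / (2 * real n)"
    proof -
      have "q m / real n \<le> (norm m)\<^sup>2" using q_upper[of m] n(2) by (simp add: divide_le_eq mult.commute)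
      then have "q m / real n / 2 \<le> (norm m)\<^sup>2 / 2" by simp
      then show ?thesis by (simp add: mult.commute)
    qed
    also have "\<dots> = \<rho> * q m" by (simp add: \<rho>_def algebra_simps)
    finally show ?thesis .
  qed
  \<comment> \<open>Any \<open>\<tau>\<close> with \<open>1 < \<tau>\<close> and \<open>\<tau> \<rho> < 1\<close> would do; \<open>C\<close> is the fixed point of \<open>C \<mapsto> 1 + \<tau> \<rho> C\<close>.\<close>
  define \<tau> where "\<tau> = (1 + \<rho>) / (2 * \<rho>)"
  have \<tau>: "1 < \<tau>" "\<tau> * \<rho> = (1 + \<rho>) / 2" using \<rho> by (simp_all add: \<tau>_def field_simps)
  define C where "C = 2 / (1 - \<rho>)"
  have C: "0 \<le> C" "1 + \<tau> * \<rho> * C = C" using \<rho> unfolding \<tau>(2) C_def by (simp_all add: field_simps)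
  have bound: "radius_energy \<tau> N m \<le> C * q m" if "m \<in> span B" for N m
    using that
  proof (induction N arbitrary: m)
    case 0
    have "0 \<le> q m" using q_lower[of m] zero_le_power2[of "norm m"] by linarith
    then show ?case using C by (simp add: radius_energy_def)
  next
    case (Suc N)
    have "(\<Sum>k\<in>UNIV. radius_energy \<tau> N (right_tail [k] m)) \<le> (\<Sum>k\<in>UNIV. C * q (right_tail [k] m))"
      by (intro sum_mono Suc.IH inv Suc.prems)
    also have "\<dots> \<le> C * (\<rho> * q m)"
      unfolding sum_distrib_left[symmetric] by (intro mult_left_mono contract Suc.prems C)
    finally have 1: "\<tau> * (\<Sum>k\<in>UNIV. radius_energy \<tau> N (right_tail [k] m)) \<le> \<tau> * (C * (\<rho> * q m))"
      using \<tau> by (intro mult_left_mono) simp_all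
    have "(cmod (ell2_nth m []))\<^sup>2 \<le> (norm m)\<^sup>2"
      by (intro power_mono ell2_nth_le_norm) simp
    then have "(cmod (ell2_nth m []))\<^sup>2 \<le> q m" using q_lower[of m] by linarith
    with 1 have "radius_energy \<tau> (Suc N) m \<le> q m + \<tau> * (C * (\<rho> * q m))"
      unfolding radius_energy_Suc by linarith
    also have "\<dots> = (1 + \<tau> * \<rho> * C) * q m" by (simp add: algebra_simps)
    finally show ?case unfolding C(2) .
  qed
  then show ?thesis using \<tau>(1) unfolding decaying_def by blast
qed

section \<open>Points of the singularity locus built from the left shifts\<close>

lemma norm_mono_nth:
  assumes "\<And>i. cmod (ell2_nth x i) \<le> cmod (ell2_nth y i)"
  shows "norm x \<le> norm y"
  unfolding norm_ell2_def
  by (intro real_sqrt_le_mono infsum_mono ell2_nth_summable power_mono assms) simp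

text \<open>Series are indexed by words, whereas operator points act on families indexed by natural
  numbers; a bijection \<open>p\<close> identifies the two spaces.\<close>

definition relabel :: "('b \<Rightarrow> 'a) \<Rightarrow> 'a ell2 \<Rightarrow> 'b ell2" where
  "relabel p x = Abs_ell2 (\<lambda>b. ell2_nth x (p b))"

lemma relabel_nth:
  assumes "bij p" shows "ell2_nth (relabel p x) b = ell2_nth x (p b)"
proof -
  have "(\<lambda>b. (cmod (ell2_nth x (p b)))\<^sup>2) summable_on UNIV"
    using summable_on_reindex_bij_betw[OF assms, of "\<lambda>a. (cmod (ell2_nth x a))\<^sup>2"] ell2_nth_summable[of x] by simp
  then show ?thesis by (simp add: relabel_def Abs_ell2_inverse)
qed

lemma cinner_relabel: "bij p \<Longrightarrow> cinner (relabel p x) (relabel p y) = cinner x y"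
  unfolding cinner_def relabel_nth
  by (rule infsum_reindex_bij_betw[of p UNIV UNIV "\<lambda>a. ell2_nth x a * cnj (ell2_nth y a)"])

lemma norm_relabel: "bij p \<Longrightarrow> norm (relabel p x) = norm x"
  using cinner_relabel[of p x x] unfolding cinner_self of_real_eq_iff by simp

lemma relabel_inverse:
  assumes "bij p"
  shows "relabel p (relabel (inv_into UNIV p) y) = y" "relabel (inv_into UNIV p) (relabel p x) = x"
proof -
  have "bij (inv_into UNIV p)" by (rule bij_imp_bij_inv[OF assms])
  moreover have "inv_into UNIV p (p a) = a" "p (inv_into UNIV p b) = b" for a b
    using assms by (simp_all add: bij_is_inj bij_is_surj surj_f_inv_f)
  ultimately show "relabel p (relabel (inv_into UNIV p) y) = y" "relabel (inv_into UNIV p) (relabel p x) = x"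
    by (auto intro!: ell2_eqI simp: relabel_nth[OF assms] relabel_nth)
qed

text \<open>The adjoint of the left shift, see \<open>cinner_left_shift\<close>.\<close>

lift_definition left_tail :: "'d \<Rightarrow> 'd list ell2 \<Rightarrow> 'd list ell2" is "\<lambda>k f \<alpha>. f (k # \<alpha>)"
proof -
  fix k :: 'd and f :: "'d list \<Rightarrow> complex"
  assume "(\<lambda>i. (cmod (f i))\<^sup>2) summable_on UNIV"
  then have "(\<lambda>i. (cmod (f i))\<^sup>2) summable_on range (\<lambda>\<alpha>. k # \<alpha>)" by (rule summable_on_subset_banach) simp
  then show "(\<lambda>\<alpha>. (cmod (f (k # \<alpha>)))\<^sup>2) summable_on UNIV"
    by (subst (asm) summable_on_reindex) (auto simp: inj_on_def o_def)
qed

lemma cinner_left_shift: "cinner (left_shift_fun k f) g = cinner f (left_tail k g)"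
proof -
  have "((\<lambda>\<alpha>. ell2_nth (left_shift_fun k f) \<alpha> * cnj (ell2_nth g \<alpha>)) has_sum cinner f (left_tail k g)) (range (\<lambda>\<alpha>. k # \<alpha>))"
    using cinner_has_sum[of f "left_tail k g"]
    by (subst has_sum_reindex) (auto simp: inj_on_def o_def left_shift_fun.rep_eq left_tail.rep_eq)
  then have "((\<lambda>\<alpha>. ell2_nth (left_shift_fun k f) \<alpha> * cnj (ell2_nth g \<alpha>)) has_sum cinner f (left_tail k g)) UNIV"
    by (rule has_sum_cong_neutral[THEN iffD1, rotated -1])
      (auto simp: left_shift_fun.rep_eq image_iff intro: list.collapse[symmetric])
  then show ?thesis using cinner_has_sum has_sum_unique by blast
qed

lemma left_shift_unit: "left_shift_fun k (ell2_unit \<gamma>) = ell2_unit (k # \<gamma>)"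
  by (rule ell2_eqI) (auto simp: left_shift_fun.rep_eq ell2_unit.rep_eq neq_Nil_conv)

text \<open>The left shifts multiplied by \<open>s\<close>, transported to families indexed by natural numbers.\<close>

definition shift_point :: "(nat \<Rightarrow> 'd list) \<Rightarrow> real \<Rightarrow> 'd \<Rightarrow> nat ell2 \<Rightarrow>\<^sub>L nat ell2" where
  "shift_point \<pi> s k = Blinfun (\<lambda>x. relabel \<pi> (complex_of_real s *\<^sub>C left_shift_fun k (relabel (inv_into UNIV \<pi>) x)))"

lemma shift_point_apply:
  assumes \<pi>: "bij \<pi>"
  shows "blinfun_apply (shift_point \<pi> s k) x = relabel \<pi> (complex_of_real s *\<^sub>C left_shift_fun k (relabel (inv_into UNIV \<pi>) x))"
proof -
  have "bounded_linear (\<lambda>x. relabel \<pi> (complex_of_real s *\<^sub>C left_shift_fun k (relabel (inv_into UNIV \<pi>) x)))"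
  proof (rule bounded_linear_intro[of _ "\<bar>s\<bar>"])
    fix x y :: "nat ell2" and r :: real
    show "relabel \<pi> (complex_of_real s *\<^sub>C left_shift_fun k (relabel (inv_into UNIV \<pi>) (x + y))) =
      relabel \<pi> (complex_of_real s *\<^sub>C left_shift_fun k (relabel (inv_into UNIV \<pi>) x)) +
      relabel \<pi> (complex_of_real s *\<^sub>C left_shift_fun k (relabel (inv_into UNIV \<pi>) y))"
      by (rule ell2_eqI) (simp add: relabel_nth[OF \<pi>] relabel_nth[OF bij_imp_bij_inv[OF \<pi>]]
          scaleC.rep_eq plus_ell2.rep_eq left_shift_fun.rep_eq distrib_left)
    show "relabel \<pi> (complex_of_real s *\<^sub>C left_shift_fun k (relabel (inv_into UNIV \<pi>) (r *\<^sub>R x))) =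
      r *\<^sub>R relabel \<pi> (complex_of_real s *\<^sub>C left_shift_fun k (relabel (inv_into UNIV \<pi>) x))"
      by (rule ell2_eqI) (simp add: relabel_nth[OF \<pi>] relabel_nth[OF bij_imp_bij_inv[OF \<pi>]]
          scaleC.rep_eq scaleR_scaleC left_shift_fun.rep_eq)
    show "norm (relabel \<pi> (complex_of_real s *\<^sub>C left_shift_fun k (relabel (inv_into UNIV \<pi>) x))) \<le> norm x * \<bar>s\<bar>"
      by (simp add: norm_relabel[OF \<pi>] norm_relabel[OF bij_imp_bij_inv[OF \<pi>]] norm_scaleC norm_left_shift_fun)
  qed
  then show ?thesis unfolding shift_point_def by (simp add: bounded_linear_Blinfun_apply)
qed

lemma shift_point_adjoint:
  assumes \<pi>: "bij \<pi>"
  shows "adjoint (blinfun_apply (shift_point \<pi> s k)) =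
    (\<lambda>y. complex_of_real s *\<^sub>C relabel \<pi> (left_tail k (relabel (inv_into UNIV \<pi>) y)))"
proof (rule adjoint_eq_cinner)
  fix x y
  have move: "cinner (relabel \<pi> a) z = cinner a (relabel (inv_into UNIV \<pi>) z)" for a z
    using cinner_relabel[OF \<pi>, of a "relabel (inv_into UNIV \<pi>) z"] by (simp add: relabel_inverse[OF \<pi>])
  have move': "cinner (relabel (inv_into UNIV \<pi>) x) a = cinner x (relabel \<pi> a)" for a
    using cinner_relabel[OF \<pi>, of "relabel (inv_into UNIV \<pi>) x" a] by (simp add: relabel_inverse[OF \<pi>])
  show "cinner (blinfun_apply (shift_point \<pi> s k) x) y =
      cinner x (complex_of_real s *\<^sub>C relabel \<pi> (left_tail k (relabel (inv_into UNIV \<pi>) y)))"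
    by (simp add: shift_point_apply[OF \<pi>] move cinner_scaleC_left cinner_scaleC_right cinner_left_shift move')
qed

text \<open>The left shifts have orthogonal ranges, so the sum of \<open>Z\<^sub>k Z\<^sub>k\<^sup>*\<close> is \<open>s\<^sup>2\<close> times the
  projection to series without constant coefficient.\<close>

lemma shift_point_row_ball:
  fixes \<pi> :: "nat \<Rightarrow> 'd::finite list"
  assumes \<pi>: "bij \<pi>" and s: "0 \<le> s" "s < 1"
  shows "shift_point \<pi> s \<in> row_ball_inf"
proof -
  have bops: "shift_point \<pi> s k \<in> bounded_ops" for k
  proof (rule bounded_opsI)
    fix c x
    show "blinfun_apply (shift_point \<pi> s k) (c *\<^sub>C x) = c *\<^sub>C blinfun_apply (shift_point \<pi> s k) x"
      by (rule ell2_eqI) (simp add: shift_point_apply[OF \<pi>] relabel_nth[OF \<pi>] relabel_nth[OF bij_imp_bij_inv[OF \<pi>]]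
          scaleC.rep_eq left_shift_fun.rep_eq)
  qed
  let ?G = "\<lambda>x. \<Sum>k\<in>UNIV. blinfun_apply (shift_point \<pi> s k) (adjoint (blinfun_apply (shift_point \<pi> s k)) x)"
  have "norm (?G x) \<le> s\<^sup>2 * norm x" for x
  proof -
    have "cmod (ell2_nth (?G x) i) \<le> cmod (ell2_nth (complex_of_real (s\<^sup>2) *\<^sub>C x) i)" for i
    proof (cases "\<pi> i")
      case Nil
      then have "ell2_nth (?G x) i = 0"
        by (simp add: ell2_nth_sum shift_point_apply[OF \<pi>] relabel_nth[OF \<pi>] scaleC.rep_eq left_shift_fun.rep_eq)
      then show ?thesis by simp
    next
      case (Cons k \<gamma>)
      have inv: "inv_into UNIV \<pi> (k # \<gamma>) = i" using \<pi> by (simp add: bij_is_inj flip: Cons)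
      have surj: "\<pi> (inv_into UNIV \<pi> \<gamma>) = \<gamma>" using \<pi> by (simp add: bij_is_surj surj_f_inv_f)
      have "ell2_nth (?G x) i = (\<Sum>j\<in>UNIV. if j = k then complex_of_real (s\<^sup>2) * ell2_nth x i else 0)"
        unfolding ell2_nth_sum
        by (intro sum.cong refl) (auto simp: shift_point_apply[OF \<pi>] shift_point_adjoint[OF \<pi>] relabel_nth[OF \<pi>]
            relabel_nth[OF bij_imp_bij_inv[OF \<pi>]] scaleC.rep_eq left_shift_fun.rep_eq left_tail.rep_eq Cons inv surj power2_eq_square)
      then show ?thesis by (simp add: scaleC.rep_eq)
    qed
    then have "norm (?G x) \<le> norm (complex_of_real (s\<^sup>2) *\<^sub>C x)" by (rule norm_mono_nth)
    then show ?thesis by (simp add: norm_scaleC norm_power)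
  qed
  then have "onorm ?G \<le> s\<^sup>2" by (intro onorm_bound) simp_all
  moreover have "s\<^sup>2 < 1" using s by (simp add: abs_square_less_1)
  ultimately show ?thesis using bops unfolding row_ball_inf_def by simp
qed

lemma shift_point_word:
  assumes \<pi>: "bij \<pi>"
  shows "blinfun_apply (op_word (shift_point \<pi> s) \<alpha>) (relabel \<pi> (ell2_unit \<beta>)) =
    relabel \<pi> (complex_of_real (s ^ length \<alpha>) *\<^sub>C ell2_unit (\<alpha> @ \<beta>))"
proof (induction \<alpha>)
  case Nil
  then show ?case by (simp add: op_word_Nil)
next
  case (Cons k \<alpha>)
  have sh: "left_shift_fun k (c *\<^sub>C z) = c *\<^sub>C left_shift_fun k z" for c z
    by (rule ell2_eqI) (simp add: left_shift_fun.rep_eq scaleC.rep_eq)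
  show ?case
    by (simp add: op_word_Cons Cons.IH shift_point_apply[OF \<pi>] relabel_inverse[OF \<pi>] sh left_shift_unit)
qed

text \<open>Applied to the word \<open>\<beta>\<close>, the series \<open>h(sL)\<close> gives \<open>h \<beta>\<close> with coefficients damped by powers
  of \<open>s\<close>. The weights in \<open>Y\<close> undo the damping for \<open>s = 1 / t\<close> up to the power \<open>t ^ length \<beta>\<close>.\<close>

lemma shift_point_kernel:
  fixes \<pi> :: "nat \<Rightarrow> 'd::finite list" and Y g :: "'d list ell2"
  assumes \<pi>: "bij \<pi>" and t: "1 < t" and Y: "\<And>\<alpha>. ell2_nth Y \<alpha> = complex_of_real (t ^ length \<alpha>) * ell2_nth g \<alpha>"
  shows "cinner (blinfun_apply (eval_inf h (shift_point \<pi> (1 / t))) (relabel \<pi> (ell2_unit \<beta>))) (relabel \<pi> Y) =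
    complex_of_real (t ^ length \<beta>) * cinner (right_append \<beta> h) g"
proof -
  have Z: "shift_point \<pi> (1 / t) \<in> row_ball_inf" using t by (intro shift_point_row_ball[OF \<pi>]) simp_all
  from eval_inf_kernel[OF Z, of "relabel \<pi> (ell2_unit \<beta>)" "relabel \<pi> Y"]
  obtain K where K: "\<forall>\<alpha>. ell2_nth K \<alpha> =
      cnj (cinner (blinfun_apply (op_word (shift_point \<pi> (1 / t)) \<alpha>) (relabel \<pi> (ell2_unit \<beta>))) (relabel \<pi> Y))"
    and Kh: "\<forall>h. cinner (blinfun_apply (eval_inf h (shift_point \<pi> (1 / t))) (relabel \<pi> (ell2_unit \<beta>))) (relabel \<pi> Y) = cinner h K"
    by (elim exE conjE)
  have "K = complex_of_real (t ^ length \<beta>) *\<^sub>C right_tail \<beta> g"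
  proof (rule ell2_eqI)
    fix \<alpha>
    have "ell2_nth K \<alpha> = complex_of_real ((1 / t) ^ length \<alpha>) * ell2_nth Y (\<alpha> @ \<beta>)"
      by (simp add: K shift_point_word[OF \<pi>] cinner_relabel[OF \<pi>] cinner_scaleC_left cinner_unit_left)
    also have "\<dots> = complex_of_real ((1 / t) ^ length \<alpha> * t ^ length \<alpha> * t ^ length \<beta>) * ell2_nth g (\<alpha> @ \<beta>)"
      by (simp add: Y power_add)
    also have "(1 / t) ^ length \<alpha> * t ^ length \<alpha> = 1"
      using t by (simp add: power_divide)
    finally show "ell2_nth K \<alpha> = ell2_nth (complex_of_real (t ^ length \<beta>) *\<^sub>C right_tail \<beta> g) \<alpha>"
      by (simp add: scaleC.rep_eq right_tail.rep_eq)
  qed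
  then show ?thesis using Kh by (simp add: cinner_scaleC_right cinner_right_append)
qed

lemma ex_bij_words: "\<exists>\<pi> :: nat \<Rightarrow> 'd::finite list. bij \<pi>"
proof -
  have "infinite (UNIV :: 'd list set)" by (rule infinite_UNIV_listI)
  then have "bij (from_nat_into (UNIV :: 'd list set))"
    by (intro bij_betw_from_nat_into) simp_all
  then show ?thesis by (rule exI[of bij])
qed

text \<open>By the kernel formula, the point given by \<open>s L\<close> and the rescaled \<open>g\<close> belongs to the locus as
  soon as \<open>g\<close> is orthogonal to all right translates of \<open>\<Theta>\<close>. The condition on \<open>h\<close> at this point,
  tested on the unit word, is the claim. Decay makes the rescaled \<open>g\<close> square-summable.\<close>

lemma decaying_orthogonal:
  fixes g :: "'d::finite list ell2"
  assumes T: "T \<in> hardy_ops" and \<tau>: "1 < \<tau>" and g: "decaying \<tau> g"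
    and orth: "\<And>x. cinner (blinfun_apply T x) g = 0"
    and h: "\<And>Z y. (Z, y) \<in> sing_inf (blinfun_apply T (ell2_unit [])) \<Longrightarrow> null_inf h Z y"
  shows "cinner h g = 0"
proof (cases "g = 0")
  case False
  obtain \<pi> :: "nat \<Rightarrow> 'd list" where \<pi>: "bij \<pi>" using ex_bij_words by blast
  \<comment> \<open>The energy weights are \<open>\<tau> ^ length \<alpha>\<close>, so the coefficients are rescaled by the square root.\<close>
  define t where "t = sqrt \<tau>"
  have t: "1 < t" "t\<^sup>2 = \<tau>" using \<tau> by (simp_all add: t_def)
  obtain C where C: "\<forall>N. radius_energy \<tau> N g \<le> C" using g unfolding decaying_def ..
  have C0: "0 \<le> C" using C[rule_format, of 0] by (simp add: radius_energy_def)
  have bound: "(\<Sum>\<alpha>\<in>F. (cmod (complex_of_real (t ^ length \<alpha>) * ell2_nth g \<alpha>))\<^sup>2) \<le> (sqrt C)\<^sup>2"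
    if F: "finite F" for F
  proof -
    obtain n where n: "F \<subseteq> {\<alpha>. length \<alpha> < n}" using F by (rule finite_words_subset)
    have eq: "(cmod (complex_of_real (t ^ length \<alpha>) * ell2_nth g \<alpha>))\<^sup>2 = \<tau> ^ length \<alpha> * (cmod (ell2_nth g \<alpha>))\<^sup>2" for \<alpha>
      using t(1) by (simp add: norm_mult norm_power power_mult_distrib flip: t(2) power_mult)
    have "(\<Sum>\<alpha>\<in>F. (cmod (complex_of_real (t ^ length \<alpha>) * ell2_nth g \<alpha>))\<^sup>2) \<le>
      (\<Sum>\<alpha> | length \<alpha> < n. (cmod (complex_of_real (t ^ length \<alpha>) * ell2_nth g \<alpha>))\<^sup>2)"
      by (rule sum_mono2[OF finite_words_less n]) simp
    also have "\<dots> = radius_energy \<tau> n g"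
      unfolding eq sum_words_less radius_energy_def word_energy_def sum_distrib_left
      by (intro sum.cong refl) simp
    also have "\<dots> \<le> (sqrt C)\<^sup>2" using C C0 by simp
    finally show ?thesis .
  qed
  have "\<exists>Y. \<forall>\<alpha>. ell2_nth Y \<alpha> = complex_of_real (t ^ length \<alpha>) * ell2_nth g \<alpha>"
  proof (rule ell2_of_bounded_sums[OF bound])
    fix Y assume "\<And>\<alpha>. ell2_nth Y \<alpha> = complex_of_real (t ^ length \<alpha>) * ell2_nth g \<alpha>"
    then show "\<exists>Y. \<forall>\<alpha>. ell2_nth Y \<alpha> = complex_of_real (t ^ length \<alpha>) * ell2_nth g \<alpha>" by blast
  qed (use C0 in simp_all)
  then obtain Y where Y: "\<forall>\<alpha>. ell2_nth Y \<alpha> = complex_of_real (t ^ length \<alpha>) * ell2_nth g \<alpha>" ..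
  let ?Z = "shift_point \<pi> (1 / t)" and ?y = "relabel \<pi> Y"
  have Z: "?Z \<in> row_ball_inf" using t by (intro shift_point_row_ball[OF \<pi>]) simp_all
  note kernel = shift_point_kernel[OF \<pi> t(1) Y[rule_format]]
  have y: "?y \<noteq> 0"
  proof
    assume "?y = 0"
    then have "norm Y = 0" using norm_relabel[OF \<pi>, of Y] by simp
    then have "Y = 0" by simp
    then have "ell2_nth g \<alpha> = 0" for \<alpha> using Y[rule_format, of \<alpha>] t(1) by (simp add: zero_ell2.rep_eq)
    then have "g = 0" by (intro ell2_eqI) (simp add: zero_ell2.rep_eq)
    then show False using False by simp
  qed
  have "null_inf (blinfun_apply T (ell2_unit [])) ?Z ?y"
    unfolding null_inf_def
  proof
    let ?E = "eval_inf (blinfun_apply T (ell2_unit [])) ?Z"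
    fix x
    show "cinner (blinfun_apply ?E x) ?y = 0"
    proof (rule ell2_functional_eqI[where \<phi> = "\<lambda>x. cinner (blinfun_apply ?E x) ?y" and \<psi> = "\<lambda>_. 0"])
      show "bounded_linear (\<lambda>x. cinner (blinfun_apply ?E x) ?y)"
        by (rule bounded_linear_compose[OF bounded_linear_cinner_left blinfun.bounded_linear_right])
    next
      fix c x
      obtain K where K: "\<forall>\<alpha>. ell2_nth K \<alpha> = cnj (cinner (blinfun_apply (op_word ?Z \<alpha>) x) ?y)"
        and Kh: "\<forall>h. cinner (blinfun_apply (eval_inf h ?Z) x) ?y = cinner h K"
        using eval_inf_kernel[OF Z, of x ?y] by (elim exE conjE)
      obtain L where L: "\<forall>\<alpha>. ell2_nth L \<alpha> = cnj (cinner (blinfun_apply (op_word ?Z \<alpha>) (c *\<^sub>C x)) ?y)"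
        and Lh: "\<forall>h. cinner (blinfun_apply (eval_inf h ?Z) (c *\<^sub>C x)) ?y = cinner h L"
        using eval_inf_kernel[OF Z, of "c *\<^sub>C x" ?y] by (elim exE conjE)
      have Zb: "blinfun_apply (?Z k) (c *\<^sub>C z) = c *\<^sub>C blinfun_apply (?Z k) z" for k z
        using Z by (intro bounded_ops_scaleC) (simp add: row_ball_inf_def)
      have "blinfun_apply (op_word ?Z \<alpha>) (c *\<^sub>C x) = c *\<^sub>C blinfun_apply (op_word ?Z \<alpha>) x" for \<alpha>
        by (induction \<alpha>) (simp_all add: op_word_Nil op_word_Cons Zb)
      then have "L = cnj c *\<^sub>C K" by (intro ell2_eqI) (simp add: K L scaleC.rep_eq cinner_scaleC_left)
      then show "cinner (blinfun_apply ?E (c *\<^sub>C x)) ?y = c * cinner (blinfun_apply ?E x) ?y"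
        by (simp add: Kh Lh cinner_scaleC_right)
    next
      fix i
      have "ell2_unit i = relabel \<pi> (ell2_unit (\<pi> i))"
        using \<pi> by (intro ell2_eqI) (simp add: relabel_nth[OF \<pi>] ell2_unit.rep_eq inj_eq[OF bij_is_inj[OF \<pi>]])
      then show "cinner (blinfun_apply ?E (ell2_unit i)) ?y = 0"
        by (simp add: kernel hardy_op_right_append[OF T, symmetric] right_append_unit orth)
    qed simp_all
  qed
  then have "(?Z, ?y) \<in> sing_inf (blinfun_apply T (ell2_unit []))"
    using Z y by (simp add: sing_inf_def)
  then have "null_inf h ?Z ?y" by (rule h)
  then have "cinner (blinfun_apply (eval_inf h ?Z) (relabel \<pi> (ell2_unit []))) ?y = 0"
    unfolding null_inf_def by blast
  then show ?thesis using kernel[of h "[]"] by simp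
qed simp

section \<open>The inner factor is Blaschke\<close>

lemma right_tail_right_append:
  assumes "length \<alpha> = length \<beta>"
  shows "right_tail \<alpha> (right_append \<beta> f) = (if \<alpha> = \<beta> then f else 0)"
proof (rule ell2_eqI)
  fix \<gamma>
  show "ell2_nth (right_tail \<alpha> (right_append \<beta> f)) \<gamma> = ell2_nth (if \<alpha> = \<beta> then f else 0) \<gamma>"
  proof (cases "\<alpha> = \<beta>")
    case True
    then show ?thesis by (simp add: right_tail.rep_eq right_append_nth_append)
  next
    case False
    then have "\<nexists>\<delta>. \<gamma> @ \<alpha> = \<delta> @ \<beta>" using assms by simp
    from right_append_nth_other[OF this] show ?thesis using False
      by (simp add: right_tail.rep_eq zero_ell2.rep_eq)
  qed
qed

text \<open>An inner-outer factorization \<open>r = T f\<close>, with \<open>S\<close> the adjoint of the isometry \<open>T\<close>, of a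
  series whose tails span a finite-dimensional space. The words in \<open>W\<close> index tails that already
  span it.\<close>

locale rational_inner_outer =
  fixes T S :: "'d::finite list ell2 \<Rightarrow>\<^sub>L 'd list ell2" and f r :: "'d list ell2" and W :: "'d list set"
  assumes T: "T \<in> hardy_ops"
    and adj: "cinner (blinfun_apply T x) y = cinner x (blinfun_apply S y)"
    and ST: "blinfun_apply S (blinfun_apply T x) = x"
    and f: "nc_outer f" and r: "blinfun_apply T f = r"
    and W: "finite W" and tails: "\<exists>u. right_tail \<omega> r = (\<Sum>\<beta>\<in>W. u \<beta> *\<^sub>C right_tail \<beta> r)"
begin

text \<open>The orthogonal complement, inside the kernel of \<open>S\<close>, of the projections of the tails of \<open>r\<close>
  to that kernel.\<close>

definition perp :: "'d list ell2 \<Rightarrow> bool" where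
  "perp v \<longleftrightarrow> blinfun_apply S v = 0 \<and> (\<forall>\<beta>. cinner v (right_tail \<beta> r) = 0)"

text \<open>The orthogonal projection to the kernel of \<open>S\<close>, the complement of the range of \<open>T\<close>.\<close>

definition proj :: "'d list ell2 \<Rightarrow> 'd list ell2" where
  "proj x = x - blinfun_apply T (blinfun_apply S x)"

text \<open>Orthogonality is expressed by the real inner product and \<^const>\<open>span\<close> is real. The multiples by
  \<open>\<i>\<close> make the real span a complex subspace.\<close>

definition tail_projections :: "'d list ell2 set" where
  "tail_projections = (\<lambda>\<beta>. proj (right_tail \<beta> r)) ` W \<union> (\<lambda>\<beta>. \<i> *\<^sub>C proj (right_tail \<beta> r)) ` W"

lemma S_scaleC: "blinfun_apply S (c *\<^sub>C x) = c *\<^sub>C blinfun_apply S x"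
  by (rule ell2_eqI_cinner) (simp add: adj[symmetric] cinner_scaleC_right)

lemma S_proj: "blinfun_apply S (proj x) = 0"
  by (simp add: proj_def blinfun.diff_right ST)

lemma cinner_proj:
  assumes "blinfun_apply S v = 0" shows "cinner v (proj x) = cinner v x"
proof -
  have "cinner v (blinfun_apply T y) = 0" for y
    by (subst cinner_commute) (simp add: adj assms)
  then show ?thesis by (simp add: proj_def cinner_diff_right)
qed

lemma S_span: "m \<in> span tail_projections \<Longrightarrow> blinfun_apply S m = 0"
proof -
  have "real_vector.subspace {m. blinfun_apply S m = 0}"
    by (rule real_vector.subspaceI) (simp_all add: blinfun.add_right blinfun.scaleR_right)
  moreover have "tail_projections \<subseteq> {m. blinfun_apply S m = 0}"
    by (auto simp: tail_projections_def S_proj S_scaleC)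
  ultimately have "span tail_projections \<subseteq> {m. blinfun_apply S m = 0}"
    by (intro span_minimal)
  then show "m \<in> span tail_projections \<Longrightarrow> blinfun_apply S m = 0" by blast
qed

lemma perpI:
  assumes S: "blinfun_apply S v = 0" and orth: "\<And>m. m \<in> span tail_projections \<Longrightarrow> inner v m = 0"
  shows "perp v"
proof -
  have W0: "cinner v (right_tail \<beta> r) = 0" if \<beta>: "\<beta> \<in> W" for \<beta>
  proof -
    let ?p = "proj (right_tail \<beta> r)"
    have "?p \<in> span tail_projections" "\<i> *\<^sub>C ?p \<in> span tail_projections"
      using \<beta> by (auto simp: tail_projections_def intro!: span_base)
    from this[THEN orth] have "Re (cinner v ?p) = 0" "Re (cinner v (\<i> *\<^sub>C ?p)) = 0"
      by (simp_all add: inner_ell2_def)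
    then have "cinner v ?p = 0" by (simp add: cinner_scaleC_right complex_eq_iff)
    then show ?thesis by (simp add: cinner_proj[OF S])
  qed
  have "cinner v (right_tail \<omega> r) = 0" for \<omega>
  proof -
    obtain u where "right_tail \<omega> r = (\<Sum>\<beta>\<in>W. u \<beta> *\<^sub>C right_tail \<beta> r)" using tails ..
    then show ?thesis using W0 by (simp add: cinner_sum_right cinner_scaleC_right)
  qed
  then show ?thesis using S by (simp add: perp_def)
qed

lemma perp_orthogonal:
  assumes "perp v" and "m \<in> span tail_projections"
  shows "inner v m = 0"
proof -
  have "real_vector.subspace {m. inner v m = 0}"
    by (rule real_vector.subspaceI) (simp_all add: inner_add_right)
  moreover have "tail_projections \<subseteq> {m. inner v m = 0}"
    using assms(1) by (auto simp: tail_projections_def inner_ell2_def cinner_scaleC_right cinner_proj perp_def)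
  ultimately have "span tail_projections \<subseteq> {m. inner v m = 0}"
    by (intro span_minimal)
  then show ?thesis using assms(2) by blast
qed

text \<open>The right shift of \<open>v\<close> is orthogonal to the tails of \<open>r\<close> because its adjoint maps tails to
  tails. To stay in the kernel of \<open>S\<close> it must be orthogonal to the range of \<open>T\<close>, hence, \<open>f\<close> being
  outer, to the right translates of \<open>r = T f\<close>. For the empty word this is orthogonality of \<open>v\<close> to
  a tail of \<open>r\<close>; for a word ending in the letter \<open>l\<close>, stripping the last letter leaves \<open>v\<close> against
  an element of the range of \<open>T\<close>, or zero if \<open>l\<close> differs from \<open>k\<close>.\<close>

lemma perp_right_shift:
  assumes v: "perp v" shows "perp (right_shift_fun k v)"
proof -
  have Sv: "blinfun_apply S v = 0" and rv: "\<And>\<beta>. cinner v (right_tail \<beta> r) = 0"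
    using v by (simp_all add: perp_def)
  have rv': "cinner (right_tail \<beta> r) v = 0" for \<beta>
    by (subst cinner_commute) (simp add: rv)
  have "cinner (blinfun_apply T x) (right_shift_fun k v) = 0" for x
  proof (rule outer_functional_zero[OF f, where \<phi> = "\<lambda>x. cinner (blinfun_apply T x) (right_shift_fun k v)"])
    show "bounded_linear (\<lambda>x. cinner (blinfun_apply T x) (right_shift_fun k v))"
      by (rule bounded_linear_compose[OF bounded_linear_cinner_left blinfun.bounded_linear_right])
    show "cinner (blinfun_apply T (c *\<^sub>C x)) (right_shift_fun k v) =
        c * cinner (blinfun_apply T x) (right_shift_fun k v)" for c x
      by (simp add: bounded_ops_scaleC[OF hardy_ops_commute(1)[OF T]] cinner_scaleC_left)
    fix \<beta>
    have Tf: "blinfun_apply T (right_append \<beta> f) = right_append \<beta> r" for \<beta>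
      by (simp add: hardy_op_right_append[OF T] r)
    show "cinner (blinfun_apply T (right_append \<beta> f)) (right_shift_fun k v) = 0"
    proof (cases \<beta> rule: rev_cases)
      case Nil
      have "cinner r (right_shift_fun k v) = cnj (cinner (right_shift_fun k v) r)"
        by (rule cinner_commute)
      then show ?thesis by (simp add: r Nil cinner_right_shift rv)
    next
      case (snoc \<gamma> l)
      have "right_tail [l] (right_shift_fun k v) = (if l = k then v else 0)"
        using right_tail_right_append[of "[l]" "[k]" v] by simp
      moreover have "cinner (right_append \<gamma> r) v = 0"
        unfolding Tf[symmetric] by (simp add: adj Sv)
      ultimately show ?thesis
        unfolding snoc Tf by (simp add: right_append_append cinner_right_shift)
    qed
  qed
  then have "blinfun_apply S (right_shift_fun k v) = 0"
    by (intro ell2_eqI_cinner) (simp add: adj[symmetric])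
  then show ?thesis by (simp add: perp_def cinner_right_shift right_tail_append rv)
qed

lemma perp_right_append: "perp v \<Longrightarrow> perp (right_append \<beta> v)"
  by (induction \<beta> arbitrary: v) (simp_all add: perp_right_shift)

lemma S_right_tail:
  assumes "blinfun_apply S g = 0" shows "blinfun_apply S (right_tail \<beta> g) = 0"
proof (rule ell2_eqI_cinner)
  fix x
  have "cinner x (blinfun_apply S (right_tail \<beta> g)) = cinner (blinfun_apply T (right_append \<beta> x)) g"
    by (simp add: adj[symmetric] hardy_op_right_append[OF T] cinner_right_append)
  also have "\<dots> = 0" by (simp add: adj assms)
  finally show "cinner x (blinfun_apply S (right_tail \<beta> g)) = cinner x 0" by simp
qed

lemma perp_residual:
  assumes B: "finite B" "pairwise real_inner_class.orthogonal B" "span B = span tail_projections"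
    and x: "blinfun_apply S x = 0"
  shows "perp (x - orth_proj B x)"
proof (rule perpI)
  have "orth_proj B x \<in> span tail_projections" using orth_proj_in_span B(3) by blast
  then show "blinfun_apply S (x - orth_proj B x) = 0" by (simp add: blinfun.diff_right x S_span)
  fix m assume "m \<in> span tail_projections"
  then show "inner (x - orth_proj B x) m = 0"
    using orth_proj_orthogonal[OF B(1,2)] B(3) by blast
qed

text \<open>The part \<open>w\<close> of the tail orthogonal to the span belongs to \<^const>\<open>perp\<close>, and so does its right
  shift, which is therefore orthogonal to \<open>m\<close>. Moving the shift to the other side, \<open>w\<close> is
  orthogonal to the tail of \<open>m\<close>, hence to itself.\<close>

lemma right_tail_span:
  assumes B: "finite B" "pairwise real_inner_class.orthogonal B" "span B = span tail_projections"
    and m: "m \<in> span tail_projections"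
  shows "right_tail [k] m \<in> span tail_projections"
proof -
  let ?p = "orth_proj B (right_tail [k] m)"
  let ?w = "right_tail [k] m - ?p"
  have p: "?p \<in> span tail_projections" using orth_proj_in_span B(3) by blast
  have w: "perp ?w" by (rule perp_residual[OF B S_right_tail[OF S_span[OF m]]])
  have "inner ?w (right_tail [k] m) = inner (right_shift_fun k ?w) m"
    by (simp add: inner_ell2_def cinner_right_shift)
  also have "\<dots> = 0" by (rule perp_orthogonal[OF perp_right_shift[OF w] m])
  finally have "inner ?w (right_tail [k] m) = 0" .
  moreover have "inner ?w ?p = 0" by (rule perp_orthogonal[OF w p])
  ultimately have "inner ?w ?w = 0" by (simp only: inner_diff_right)
  then have "right_tail [k] m = ?p" by simp
  then show ?thesis using p by metis
qed

text \<open>Let \<open>w \<alpha>\<close> be the part of the tail of \<open>g\<close> at \<open>\<alpha>\<close> orthogonal to the span of the projected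
  tails, and put it back at all words \<open>\<alpha>\<close> of length \<open>n\<close> to form \<open>v\<close>. Then \<open>g - v\<close> stays in the
  kernel of \<open>S\<close>, and its tails of length \<open>n\<close> lie in a space of decaying series, so it decays and
  \<open>h\<close> is orthogonal to it. The norm of \<open>v\<close> is controlled by the energy of \<open>g\<close> from degree \<open>n\<close> on.\<close>

lemma orthogonal_to_kernel:
  assumes h: "\<And>Z y. (Z, y) \<in> sing_inf (blinfun_apply T (ell2_unit [])) \<Longrightarrow> null_inf h Z y"
    and g: "blinfun_apply S g = 0"
  shows "cinner h g = 0"
proof -
  have fin: "finite tail_projections" using W by (simp add: tail_projections_def)
  obtain B where B: "finite B" "pairwise real_inner_class.orthogonal B" "span B = span tail_projections"
    using basis_orthogonal[OF fin] by blast
  obtain \<tau> where \<tau>: "1 < \<tau>" and dec: "\<forall>m\<in>span B. decaying \<tau> m"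
    using finite_dimensional_decay[OF B(1,2)] right_tail_span[OF B] B(3) by blast
  have bound: "cmod (cinner h g) \<le> norm h * sqrt (tail_energy n g)" for n
  proof -
    define w where "w \<alpha> = right_tail \<alpha> g - orth_proj B (right_tail \<alpha> g)" for \<alpha>
    define v where "v = (\<Sum>\<alpha> | length \<alpha> = n. right_append \<alpha> (w \<alpha>))"
    have w: "perp (w \<alpha>)" for \<alpha> unfolding w_def by (rule perp_residual[OF B S_right_tail[OF g]])
    have tail: "right_tail \<alpha> v = w \<alpha>" if \<alpha>: "length \<alpha> = n" for \<alpha>
    proof -
      have "right_tail \<alpha> v = (\<Sum>\<beta> | length \<beta> = n. if \<alpha> = \<beta> then w \<beta> else 0)"
        unfolding v_def right_tail_sum using \<alpha>
        by (intro sum.cong refl) (simp add: right_tail_right_append)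
      then show ?thesis using \<alpha> by (simp add: finite_words)
    qed
    have "blinfun_apply S v = (\<Sum>\<alpha> | length \<alpha> = n. blinfun_apply S (right_append \<alpha> (w \<alpha>)))"
      unfolding v_def by (rule blinfun.sum_right)
    also have "\<dots> = 0" using perp_right_append[OF w] by (simp add: perp_def)
    finally have Sv: "blinfun_apply S (g - v) = 0" by (simp add: blinfun.diff_right g)
    have "decaying \<tau> (g - v)"
    proof (rule decaying_steps)
      fix \<alpha> :: "'d list" assume "length \<alpha> = n"
      then have "right_tail \<alpha> (g - v) = orth_proj B (right_tail \<alpha> g)"
        by (simp add: right_tail_diff tail w_def)
      then show "decaying \<tau> (right_tail \<alpha> (g - v))" using dec orth_proj_in_span by metis
    qed (use \<tau> in simp)
    then have "cinner h (g - v) = 0"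
      by (rule decaying_orthogonal[OF T \<tau> _ _ h]) (simp_all add: adj Sv)
    then have "cinner h g = cinner h v" by (simp add: cinner_diff_right)
    then have "cmod (cinner h g) \<le> norm h * norm v" by (simp add: cinner_Cauchy_Schwarz)
    also have "\<dots> \<le> norm h * sqrt (tail_energy n g)"
    proof (intro mult_left_mono real_le_rsqrt)
      have "cinner v v = (\<Sum>\<alpha> | length \<alpha> = n. cinner (w \<alpha>) (right_tail \<alpha> v))"
        by (subst (1) v_def) (simp add: cinner_sum_left cinner_right_append)
      also have "\<dots> = (\<Sum>\<alpha> | length \<alpha> = n. cinner (w \<alpha>) (w \<alpha>))"
        by (intro sum.cong refl) (simp add: tail)
      finally have "complex_of_real ((norm v)\<^sup>2) = complex_of_real (\<Sum>\<alpha> | length \<alpha> = n. (norm (w \<alpha>))\<^sup>2)"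
        unfolding cinner_self of_real_sum .
      then have "(norm v)\<^sup>2 = (\<Sum>\<alpha> | length \<alpha> = n. (norm (w \<alpha>))\<^sup>2)" unfolding of_real_eq_iff .
      also have "\<dots> \<le> (\<Sum>\<alpha> | length \<alpha> = n. (norm (right_tail \<alpha> g))\<^sup>2)"
        unfolding w_def by (intro sum_mono norm_residual_le B)
      also have "\<dots> = tail_energy n g" by (rule tail_energy_words)
      finally show "(norm v)\<^sup>2 \<le> tail_energy n g" .
    qed simp
    finally show ?thesis .
  qed
  have "(\<lambda>n. norm h * sqrt (tail_energy n g)) \<longlonglongrightarrow> norm h * sqrt 0"
    by (intro tendsto_intros tail_energy_tendsto)
  then have "cmod (cinner h g) \<le> norm h * sqrt 0"
    by (rule LIMSEQ_le_const) (intro exI allI impI bound)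
  then show ?thesis by simp
qed

text \<open>Applied to \<open>h\<close> and its projection to the kernel of \<open>S\<close>, orthogonality makes the projection
  vanish.\<close>

lemma range_of_singularity_locus:
  assumes h: "\<And>Z y. (Z, y) \<in> sing_inf (blinfun_apply T (ell2_unit [])) \<Longrightarrow> null_inf h Z y"
  shows "h \<in> range (blinfun_apply T)"
proof -
  have "cinner h (proj h) = 0" by (rule orthogonal_to_kernel[OF h S_proj])
  moreover have "cinner (blinfun_apply T (blinfun_apply S h)) (proj h) = 0" by (simp add: adj S_proj)
  ultimately have "cinner (proj h) (proj h) = 0"
    by (subst (1) proj_def) (simp add: cinner_diff_left)
  then have "proj h = 0" by (simp add: cinner_self)
  then show ?thesis by (auto simp: proj_def)
qed

end

lemma nc_blaschkeI:
  assumes inn: "nc_inner \<Theta>" and T: "T \<in> hardy_ops" "mult_op \<Theta> = T" "blinfun_apply T (ell2_unit []) = \<Theta>"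
    and range: "\<And>h. (\<And>Z y. (Z, y) \<in> sing_inf \<Theta> \<Longrightarrow> null_inf h Z y) \<Longrightarrow> h \<in> range (blinfun_apply T)"
  shows "nc_blaschke \<Theta>"
  unfolding nc_blaschke_def T(2)
proof (intro conjI inn equalityI subsetI)
  fix h assume "h \<in> range (blinfun_apply T)"
  then obtain x where h: "h = blinfun_apply T x" by blast
  have "null_fin h n Z y" if "(Z, y) \<in> sing_fin \<Theta> n" for n Z y
    using that null_fin_range[OF T(1), of Z n y x] by (simp add: sing_fin_def h T(3))
  moreover have "null_inf h Z y" if "(Z, y) \<in> sing_inf \<Theta>" for Z y
    using that null_inf_range[OF T(1), of Z y x] by (simp add: sing_inf_def h T(3))
  ultimately show "h \<in> {h. (\<forall>n. \<forall>(Z, y)\<in>sing_fin \<Theta> n. null_fin h n Z y) \<and> (\<forall>(Z, y)\<in>sing_inf \<Theta>. null_inf h Z y)}"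
    by auto
next
  fix h assume "h \<in> {h. (\<forall>n. \<forall>(Z, y)\<in>sing_fin \<Theta> n. null_fin h n Z y) \<and> (\<forall>(Z, y)\<in>sing_inf \<Theta>. null_inf h Z y)}"
  then show "h \<in> range (blinfun_apply T)" by (intro range) auto
qed

section \<open>Rational factors\<close>

text \<open>Finitely many states span all states, and the tails at the corresponding words span all
  tails.\<close>

lemma state_tails_finite:
  fixes r :: "'d list ell2"
  assumes A: "\<forall>j. A j \<in> carrier_mat n n" and b: "b \<in> carrier_vec n" and c: "c \<in> carrier_vec n"
    and r: "\<And>\<omega>. ell2_nth r \<omega> = (mat_word n A \<omega> *\<^sub>v c) \<bullet>c b"
  shows "\<exists>W. finite W \<and> (\<forall>\<omega>. \<exists>u. right_tail \<omega> r = (\<Sum>\<beta>\<in>W. u \<beta> *\<^sub>C right_tail \<beta> r))"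
proof (rule finite_spanning_subfamily[of "ell2_unit ` {..<n}" "state_series n A c"])
  show "state_series n A c \<omega> \<in> cspan (ell2_unit ` {..<n})" for \<omega>
    unfolding state_series_def by (intro ell2.span_sum ell2.span_scale ell2.span_base) simp
  fix W assume W: "finite W" "\<And>\<omega>. \<exists>u. state_series n A c \<omega> = (\<Sum>\<beta>\<in>W. u \<beta> *\<^sub>C state_series n A c \<beta>)"
  have "\<exists>u. right_tail \<omega> r = (\<Sum>\<beta>\<in>W. u \<beta> *\<^sub>C right_tail \<beta> r)" for \<omega>
  proof -
    obtain u where "state_series n A c \<omega> = (\<Sum>\<beta>\<in>W. u \<beta> *\<^sub>C state_series n A c \<beta>)" using W(2) ..
    from right_tail_relation[OF A b c r this] show ?thesis by (rule exI[of _ u])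
  qed
  with W(1) show ?thesis by blast
qed simp

lemma minimal_realization_le:
  assumes "nc_realization \<rr> n A b c"
  shows "\<exists>M A' b' c'. nc_minimal_realization \<rr> M A' b' c' \<and> M \<le> n"
proof -
  let ?P = "\<lambda>M. \<exists>A b c. nc_realization \<rr> M A b c"
  have P: "?P n" using assms by blast
  then have "?P (LEAST M. ?P M)" by (rule LeastI)
  then obtain A' b' c' where *: "nc_realization \<rr> (LEAST M. ?P M) A' b' c'" by blast
  have min: "(LEAST M. ?P M) \<le> M" if "nc_realization \<rr> M A b c" for M A b c
    by (rule Least_le) (use that in blast)
  have "nc_minimal_realization \<rr> (LEAST M. ?P M) A' b' c'"
    unfolding nc_minimal_realization_def using * min by blast
  moreover have "(LEAST M. ?P M) \<le> n" by (rule min[OF assms])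
  ultimately show ?thesis by blast
qed

theorem theorem5p2:
  fixes \<rr> :: "'d::finite nc_expr set" and r \<Theta> f :: "'d list ell2"
  assumes "\<rr> \<in> nc_rational_functions"
    and "nc_equals_series \<rr> r"
    and "nc_minimal_realization \<rr> N A b c"
    and "nc_inner_outer_factorization r \<Theta> f"
  shows "nc_blaschke \<Theta> \<and>
    (\<exists>\<theta>\<in>nc_rational_functions. nc_equals_series \<theta> \<Theta> \<and>
      (\<exists>M A' b' c'. nc_minimal_realization \<theta> M A' b' c' \<and> M \<le> 2 * N + 1)) \<and>
    (\<exists>\<ff>\<in>nc_rational_functions. nc_equals_series \<ff> f \<and>
      (\<exists>b'\<in>carrier_vec N. nc_realization \<ff> N A b' c))"
proof -
  have real: "nc_realization \<rr> N A b c" using assms(3) by (simp add: nc_minimal_realization_def)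
  then have A: "\<forall>j. A j \<in> carrier_mat N N" and b: "b \<in> carrier_vec N" and c: "c \<in> carrier_vec N"
    by (simp_all add: nc_realization_def)
  obtain n0 A0 b0 c0 where real0: "nc_realization \<rr> n0 A0 b0 c0"
    and r0: "\<forall>\<omega>. ell2_nth r \<omega> = (mat_word n0 A0 \<omega> *\<^sub>v c0) \<bullet>c b0"
    using assms(2) unfolding nc_equals_series_def by (elim exE conjE)
  have r: "ell2_nth r \<omega> = (mat_word N A \<omega> *\<^sub>v c) \<bullet>c b" for \<omega>
    using r0 nc_realization_coeffs_unique[OF assms(1) real0 real, of \<omega>] by simp
  obtain T S where T: "T \<in> hardy_ops" and "S \<in> bounded_ops" and mT: "mult_op \<Theta> = T"
    and T\<Theta>: "blinfun_apply T (ell2_unit []) = \<Theta>" and Tf: "blinfun_apply T f = r"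
    and f: "nc_outer f" and \<Theta>: "nc_inner \<Theta>"
    and S: "\<And>x y. cinner (blinfun_apply T x) y = cinner x (blinfun_apply S y)"
    and ST: "\<And>x. blinfun_apply S (blinfun_apply T x) = x"
    using inner_outer_operators[OF assms(4)] by blast
  obtain W where W: "finite W" "\<forall>\<omega>. \<exists>u. right_tail \<omega> r = (\<Sum>\<beta>\<in>W. u \<beta> *\<^sub>C right_tail \<beta> r)"
    using state_tails_finite[OF A b c r] by (elim exE conjE)
  interpret F: rational_inner_outer T S f r W
    by (rule rational_inner_outer.intro[OF T S ST f Tf W(1) W(2)[rule_format]])
  have blaschke: "nc_blaschke \<Theta>"
    by (rule nc_blaschkeI[OF \<Theta> T mT T\<Theta>]) (rule F.range_of_singularity_locus, simp add: T\<Theta>)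
  have Sr: "blinfun_apply S r = f" using ST[of f] by (simp add: Tf)
  have f\<Theta>: "ell2_nth f \<beta> = cinner (right_tail \<beta> r) \<Theta>" for \<beta>
    using outer_factor_nth[OF T S Sr] by (simp add: T\<Theta>)
  have "\<exists>b'. b' \<in> carrier_vec N \<and> (\<forall>\<omega>. ell2_nth f \<omega> = (mat_word N A \<omega> *\<^sub>v c) \<bullet>c b')"
    by (rule outer_factor_realization[OF A b c r f\<Theta>]) blast
  then obtain b' where b': "b' \<in> carrier_vec N"
    and "\<forall>\<omega>. ell2_nth f \<omega> = (mat_word N A \<omega> *\<^sub>v c) \<bullet>c b'" by (elim exE conjE)
  then have fb': "ell2_nth f \<omega> = (mat_word N A \<omega> *\<^sub>v c) \<bullet>c b'" for \<omega> by blast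
  obtain \<ff> where \<ff>: "\<ff> \<in> nc_rational_functions" "nc_realization \<ff> N A b' c" "(1, \<lambda>_. 0\<^sub>m 1 1) \<in> nc_dom \<ff>"
    by (rule nc_realization_exists[OF A b' c])
  have \<ff>f: "nc_equals_series \<ff> f"
    unfolding nc_equals_series_def using \<ff> fb' by blast
  have conv: "ell2_nth r \<omega> = (\<Sum>i\<le>length \<omega>. ell2_nth \<Theta> (take i \<omega>) * ell2_nth f (drop i \<omega>))" for \<omega>
    using hardy_op_nth[OF T, of f \<omega>] by (simp add: Tf T\<Theta>)
  have "\<exists>A' c'. (\<forall>j. A' j \<in> carrier_mat N N) \<and> c' \<in> carrier_vec N \<and>
      (\<forall>\<omega>. ell2_nth \<Theta> \<omega> = (mat_word N A' \<omega> *\<^sub>v c') \<bullet>c b)"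
    by (rule inner_factor_realization[OF A b c b' r fb' conv outer_nth_Nil[OF f]]) blast
  then obtain A' c' where A': "\<forall>j. A' j \<in> carrier_mat N N" and c': "c' \<in> carrier_vec N"
    and \<Theta>c': "\<forall>\<omega>. ell2_nth \<Theta> \<omega> = (mat_word N A' \<omega> *\<^sub>v c') \<bullet>c b"
    by (elim exE conjE)
  obtain \<theta> where \<theta>: "\<theta> \<in> nc_rational_functions" "nc_realization \<theta> N A' b c'" "(1, \<lambda>_. 0\<^sub>m 1 1) \<in> nc_dom \<theta>"
    by (rule nc_realization_exists[OF A' b c'])
  have \<theta>\<Theta>: "nc_equals_series \<theta> \<Theta>"
    unfolding nc_equals_series_def using \<theta> \<Theta>c' by blast
  obtain M A'' b'' c'' where M: "nc_minimal_realization \<theta> M A'' b'' c''" "M \<le> N"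
    using minimal_realization_le[OF \<theta>(2)] by (elim exE conjE)
  from M(2) have "M \<le> 2 * N + 1" by simp
  with M(1) have "\<exists>M A' b' c'. nc_minimal_realization \<theta> M A' b' c' \<and> M \<le> 2 * N + 1" by blast
  with blaschke \<theta>(1) \<theta>\<Theta> \<ff>(1,2) \<ff>f b' show ?thesis by blast
qed

end
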